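(* Given a minimum transmit power $\delta>0$ and an approximation factor $\epsilon>0$, there is an algorithm ($\epsilon$-JSPA) that computes an $\epsilon$-approximation of $\mathcal P'_{MC}$ on the discrete set $\mathcal F'$, i.e. an element $\bar{\boldsymbol P}\in\mathcal F'$ with $$\sum_{n=1}^N F^n(\bar P^n)\ \ge\ (1-\epsilon)\max_{\bar{\boldsymbol Q}\in\mathcal F'}\sum_{n=1}^N F^n(\bar Q^n).$$ The algorithm is a fully polynomial-time approximation scheme (FPTAS) with asymptotic complexity $$O\left(NMK^2+\min\left\{\log(J)\frac{N^2MK}{\epsilon}+\frac{N^3}{\epsilon^2},\ JNMK+J^2N\right\}\right),$$ where $J=\lfloor P_{max}/\delta\rfloor$.
   Context: Setting. $K$ users, $N$ subcarriers, $M\ge1$; for each subcarrier $n$: bandwidth $W_n>0$, normalized noise powers $\tilde\eta^n_k>0$, and a permutation $\pi_n$ of $\{1,\dots,K\}$ with $\tilde\eta^n_{\pi_n(1)}\ge\dots\ge\tilde\eta^n_{\pi_n(K)}$; weights $w_1,\dots,w_K>0$; total power budget $P_{max}$ and per-subcarrier limits $P^n_{max}$. Define $$f^n_i(x)=\begin{cases}W_n w_{\pi_n(1)}\log_2(x+\tilde\eta^n_{\pi_n(1)}) & i=1,\\ W_n\left[w_{\pi_n(i)}\log_2(x+\tilde\eta^n_{\pi_n(i)})-w_{\pi_n(i-1)}\log_2(x+\tilde\eta^n_{\pi_n(i-1)})\right] & i>1,\end{cases}$$ and $A^n=W_n w_{\pi_n(K)}\log_2(1/\tilde\eta^n_{\pi_n(K)})$.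 Single-carrier optimal value. $F^n(\bar P^n)$ is the maximum of $\sum_{i=1}^K f^n_i(x^n_i)+A^n$ over $\bar P^n\ge x^n_1\ge\dots\ge x^n_K\ge0$ with $|\{i:x^n_i>x^n_{i+1}\}|\le M$, where $x^n_{K+1}=0$. Multi-carrier problem $\mathcal P'_{MC}$: maximize $\sum_{n=1}^N F^n(\bar P^n)$ over power budget vectors $\bar{\boldsymbol P}=(\bar P^1,\dots,\bar P^N)$ with $\sum_n\bar P^n\le P_{max}$ and $0\le\bar P^n\le P^n_{max}$ for all $n$. The discrete feasible set is $$\mathcal F'=\Big\{\bar{\boldsymbol P}:\sum_{n=1}^N\bar P^n\le P_{max},\ 0\le\bar P^n\le P^n_{max},\ \bar P^n\in\{l\delta:l=0,1,\dots,J\}\ \forall n\Big\}.$$ An algorithm is an FPTAS if, for any $\epsilon>0$, it outputs a solution within a factor $1-\epsilon$ of the optimum and its running time is bounded by a polynomial in both the input size and $1/\epsilon$; power values are encoded in $O(\log J)$ bits. Complexity is the worst-case number of basic operations (real arithmetic, logarithm evaluations, comparisons), each counted with unit cost. The input consists of the $w_k$, $W_n$, $\tilde\eta^n_k$, $M$, $P_{max}$, $P^n_{max}$, $\delta$ and $\epsilon$; the functions $F^n$ are not given as oracles and must be computed by the algorithm. *)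

theory Defs
  imports Complex_Main "HOL-Library.FuncSet" "HOL-Combinatorics.Permutations"
    "HOL-Computational_Algebra.Polynomial"
begin

section \<open>The resource allocation problem\<close>

record noma =
  users :: nat                                  \<comment> \<open>\<open>K\<close>\<close>
  carriers :: nat                               \<comment> \<open>\<open>N\<close>\<close>
  mux :: nat                                    \<comment> \<open>\<open>M\<close>\<close>
  weight :: "nat \<Rightarrow> real"                  \<comment> \<open>\<open>w k\<close>\<close>
  bandwidth :: "nat \<Rightarrow> real"               \<comment> \<open>\<open>W n\<close>\<close>
  noise :: "nat \<Rightarrow> nat \<Rightarrow> real"             \<comment> \<open>normalized noise power, subcarrier first, then user\<close>
  dec_order :: "nat \<Rightarrow> nat \<Rightarrow> nat"              \<comment> \<open>\<open>\<pi> n i\<close>\<close>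
  total_power :: real                           \<comment> \<open>\<open>P_max\<close>\<close>
  carrier_power :: "nat \<Rightarrow> real"           \<comment> \<open>\<open>P_max\<close> of subcarrier \<open>n\<close>\<close>
  power_unit :: real                            \<comment> \<open>\<open>\<delta>\<close>\<close>

text \<open>Users are indexed by \<open>{1..K}\<close> and subcarriers by \<open>{1..N}\<close>; values of the
  fields outside these ranges are irrelevant.\<close>

definition valid_noma :: "noma \<Rightarrow> bool" where
  "valid_noma I \<longleftrightarrow>
     users I \<ge> 1 \<and> carriers I \<ge> 1 \<and> mux I \<ge> 1 \<and>
     (\<forall>k\<in>{1..users I}. weight I k > 0) \<and>
     (\<forall>n\<in>{1..carriers I}.
        bandwidth I n > 0 \<and>
        (\<forall>k\<in>{1..users I}. noise I n k > 0) \<and>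
        dec_order I n permutes {1..users I} \<and>
        (\<forall>i\<in>{1..<users I}. noise I n (dec_order I n i) \<ge> noise I n (dec_order I n (i + 1))) \<and>
        carrier_power I n \<ge> 0) \<and>
     total_power I \<ge> 0 \<and> power_unit I > 0"

definition f_user :: "noma \<Rightarrow> nat \<Rightarrow> nat \<Rightarrow> real \<Rightarrow> real" where
  "f_user I n i x =
     (if i = 1
      then bandwidth I n * weight I (dec_order I n 1) * log 2 (x + noise I n (dec_order I n 1))
      else bandwidth I n *
        (weight I (dec_order I n i) * log 2 (x + noise I n (dec_order I n i)) -
         weight I (dec_order I n (i - 1)) * log 2 (x + noise I n (dec_order I n (i - 1)))))"

definition A_carrier :: "noma \<Rightarrow> nat \<Rightarrow> real" where
  "A_carrier I n = bandwidth I n * weight I (dec_order I n (users I)) *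
     log 2 (1 / noise I n (dec_order I n (users I)))"

definition sc_feasible :: "noma \<Rightarrow> real \<Rightarrow> (nat \<Rightarrow> real) set" where
  "sc_feasible I P =
     {x. P \<ge> x 1 \<and> (\<forall>i\<in>{1..<users I}. x i \<ge> x (i + 1)) \<and> x (users I) \<ge> 0 \<and>
         card {i\<in>{1..users I}. x i > (if i = users I then 0 else x (i + 1))} \<le> mux I}"

text \<open>The supremum below is attained for \<open>P \<ge> 0\<close>: only finitely many coordinates matter,
  and the constraints (including the one on the number of strict descents) cut out a
  compact set of them.\<close>

definition F_opt :: "noma \<Rightarrow> nat \<Rightarrow> real \<Rightarrow> real" where
  "F_opt I n P = Sup ((\<lambda>x. (\<Sum>i=1..users I. f_user I n i (x i)) + A_carrier I n) ` sc_feasible I P)"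

definition mc_objective :: "noma \<Rightarrow> (nat \<Rightarrow> real) \<Rightarrow> real" where
  "mc_objective I P = (\<Sum>n=1..carriers I. F_opt I n (P n))"

definition J_levels :: "noma \<Rightarrow> nat" where
  "J_levels I = nat \<lfloor>total_power I / power_unit I\<rfloor>"

definition discrete_feasible :: "noma \<Rightarrow> (nat \<Rightarrow> real) set" where
  "discrete_feasible I =
     {P \<in> extensional {1..carriers I}.
        (\<Sum>n=1..carriers I. P n) \<le> total_power I \<and>
        (\<forall>n\<in>{1..carriers I}. 0 \<le> P n \<and> P n \<le> carrier_power I n \<and>
           P n \<in> {real l * power_unit I | l. l \<in> {0..J_levels I}})}"

lemma finite_discrete_feasible: "finite (discrete_feasible I)"
proof -
  have "finite ({1..carriers I} \<rightarrow>\<^sub>E ((\<lambda>l. real l * power_unit I) ` {0..J_levels I}))"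
    by (intro finite_PiE) auto
  moreover have "discrete_feasible I \<subseteq>
      ({1..carriers I} \<rightarrow>\<^sub>E ((\<lambda>l. real l * power_unit I) ` {0..J_levels I}))"
    unfolding discrete_feasible_def PiE_def Pi_def by fastforce
  ultimately show ?thesis by (rule rev_finite_subset)
qed

lemma discrete_feasible_nonempty:
  assumes "valid_noma I"
  shows "discrete_feasible I \<noteq> {}"
proof -
  have "(\<lambda>n\<in>{1..carriers I}. 0) \<in> discrete_feasible I"
    using assms by (auto simp: discrete_feasible_def valid_noma_def intro!: exI[of _ 0])
  then show ?thesis by blast
qed

definition approx_solution :: "noma \<Rightarrow> real \<Rightarrow> (nat \<Rightarrow> real) \<Rightarrow> bool" where
  "approx_solution I \<epsilon> P \<longleftrightarrow>
     P \<in> discrete_feasible I \<and>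
     mc_objective I P \<ge> (1 - \<epsilon>) * Max (mc_objective I ` discrete_feasible I)"


section \<open>A real random access machine\<close>

text \<open>Programs are finite pieces of syntax, so that one program has to serve all inputs.
  They work on two stores of arrays of arbitrary dimension, one holding natural numbers
  (loop counters, indices) and one holding exact real numbers; a scalar is an array accessed
  with the empty list of indices. Numeric constants are natural numbers only, and
  there is no operation from reals to natural numbers (in particular, no floor).\<close>

type_synonym vname = string

record state =
  nats :: "vname \<Rightarrow> nat list \<Rightarrow> nat"
  reals :: "vname \<Rightarrow> nat list \<Rightarrow> real"

datatype nexp =
    NConst nat
  | NVar vname "nexp list"
  | NAdd nexp nexp
  | NSub nexp nexp

datatype rexp =
    OfNat nexp
  | RVar vname "nexp list"
  | RAdd rexp rexp
  | RSub rexp rexp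
  | RMul rexp rexp
  | RDiv rexp rexp
  | RLog rexp

datatype bexp =
    NLess nexp nexp
  | RLess rexp rexp
  | BNot bexp
  | BAnd bexp bexp

datatype com =
    CSkip
  | NAssign vname "nexp list" nexp
  | RAssign vname "nexp list" rexp
  | CSeq com com
  | CIf bexp com com
  | CWhile bexp com

fun nval :: "state \<Rightarrow> nexp \<Rightarrow> nat" where
  "nval s (NConst c) = c"
| "nval s (NVar x es) = nats s x (map (nval s) es)"
| "nval s (NAdd a b) = nval s a + nval s b"
| "nval s (NSub a b) = nval s a - nval s b"

fun rval :: "state \<Rightarrow> rexp \<Rightarrow> real" where
  "rval s (OfNat a) = real (nval s a)"
| "rval s (RVar x es) = reals s x (map (nval s) es)"
| "rval s (RAdd a b) = rval s a + rval s b"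
| "rval s (RSub a b) = rval s a - rval s b"
| "rval s (RMul a b) = rval s a * rval s b"
| "rval s (RDiv a b) = rval s a / rval s b"
| "rval s (RLog a) = (if rval s a > 0 then log 2 (rval s a) else 0)"

fun bval :: "state \<Rightarrow> bexp \<Rightarrow> bool" where
  "bval s (NLess a b) \<longleftrightarrow> nval s a < nval s b"
| "bval s (RLess a b) \<longleftrightarrow> rval s a < rval s b"
| "bval s (BNot b) \<longleftrightarrow> \<not> bval s b"
| "bval s (BAnd a b) \<longleftrightarrow> bval s a \<and> bval s b"

text \<open>Every node of an evaluated expression has unit cost. So besides real arithmetic,
  logarithms and comparisons, the count also includes index arithmetic, memory
  accesses, assignments and control flow.\<close>

fun ncost :: "nexp \<Rightarrow> nat" where
  "ncost (NConst c) = 1"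
| "ncost (NVar x es) = 1 + sum_list (map ncost es)"
| "ncost (NAdd a b) = 1 + ncost a + ncost b"
| "ncost (NSub a b) = 1 + ncost a + ncost b"

fun rcost :: "rexp \<Rightarrow> nat" where
  "rcost (OfNat a) = 1 + ncost a"
| "rcost (RVar x es) = 1 + sum_list (map ncost es)"
| "rcost (RAdd a b) = 1 + rcost a + rcost b"
| "rcost (RSub a b) = 1 + rcost a + rcost b"
| "rcost (RMul a b) = 1 + rcost a + rcost b"
| "rcost (RDiv a b) = 1 + rcost a + rcost b"
| "rcost (RLog a) = 1 + rcost a"

fun bcost :: "bexp \<Rightarrow> nat" where
  "bcost (NLess a b) = 1 + ncost a + ncost b"
| "bcost (RLess a b) = 1 + rcost a + rcost b"
| "bcost (BNot b) = 1 + bcost b"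
| "bcost (BAnd a b) = 1 + bcost a + bcost b"

definition nupdate :: "state \<Rightarrow> vname \<Rightarrow> nat list \<Rightarrow> nat \<Rightarrow> state" where
  "nupdate s x is v = s\<lparr>nats := (nats s)(x := (nats s x)(is := v))\<rparr>"

definition rupdate :: "state \<Rightarrow> vname \<Rightarrow> nat list \<Rightarrow> real \<Rightarrow> state" where
  "rupdate s x is v = s\<lparr>reals := (reals s)(x := (reals s x)(is := v))\<rparr>"

text \<open>\<open>exec c s t s'\<close>: started in \<open>s\<close>, the program \<open>c\<close> terminates in \<open>s'\<close> after \<open>t\<close> steps.\<close>

inductive exec :: "com \<Rightarrow> state \<Rightarrow> nat \<Rightarrow> state \<Rightarrow> bool" where
  Skip: "exec CSkip s 1 s"
| NAssign: "exec (NAssign x es e) s (1 + sum_list (map ncost es) + ncost e)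
     (nupdate s x (map (nval s) es) (nval s e))"
| RAssign: "exec (RAssign x es e) s (1 + sum_list (map ncost es) + rcost e)
     (rupdate s x (map (nval s) es) (rval s e))"
| Seq: "exec c1 s t1 s1 \<Longrightarrow> exec c2 s1 t2 s2 \<Longrightarrow> exec (CSeq c1 c2) s (t1 + t2) s2"
| IfTrue: "bval s b \<Longrightarrow> exec c1 s t s' \<Longrightarrow> exec (CIf b c1 c2) s (1 + bcost b + t) s'"
| IfFalse: "\<not> bval s b \<Longrightarrow> exec c2 s t s' \<Longrightarrow> exec (CIf b c1 c2) s (1 + bcost b + t) s'"
| WhileFalse: "\<not> bval s b \<Longrightarrow> exec (CWhile b c) s (1 + bcost b) s"
| WhileTrue: "bval s b \<Longrightarrow> exec c s t1 s1 \<Longrightarrow> exec (CWhile b c) s1 t2 s2 \<Longrightarrow>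
     exec (CWhile b c) s (1 + bcost b + t1 + t2) s2"

inductive_cases exec_SkipE: "exec CSkip s t s'"
inductive_cases exec_NAssignE: "exec (NAssign x es e) s t s'"
inductive_cases exec_RAssignE: "exec (RAssign x es e) s t s'"
inductive_cases exec_SeqE: "exec (CSeq c1 c2) s t s'"
inductive_cases exec_IfE: "exec (CIf b c1 c2) s t s'"
inductive_cases exec_WhileE: "exec (CWhile b c) s t s'"

lemma exec_deterministic:
  assumes "exec c s t s'" and "exec c s u s''"
  shows "t = u \<and> s' = s''"
  using assms
proof (induction arbitrary: u s'' rule: exec.induct)
  case (Skip s)
  from Skip.prems show ?case by (rule exec_SkipE) simp
next
  case (NAssign x es e s)
  from NAssign.prems show ?case by (rule exec_NAssignE) simp
next
  case (RAssign x es e s)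
  from RAssign.prems show ?case by (rule exec_RAssignE) simp
next
  case (Seq c1 s t1 s1 c2 t2 s2)
  from Seq.prems obtain u1 v u2
    where u: "u = u1 + u2" "exec c1 s u1 v" "exec c2 v u2 s''"
    by (rule exec_SeqE)
  from Seq.IH(1)[OF u(2)] u(3) have "t1 = u1" "exec c2 s1 u2 s''" by simp_all
  with Seq.IH(2)[of u2 s''] u(1) show ?case by simp
next
  case (IfTrue s b c1 t s' c2)
  from IfTrue.prems show ?case
  proof (rule exec_IfE)
    fix v assume "u = Suc (bcost b + v)" "exec c1 s v s''"
    with IfTrue.IH[of v s''] show ?thesis by simp
  qed (use IfTrue.hyps in simp)
next
  case (IfFalse s b c2 t s' c1)
  from IfFalse.prems show ?case
  proof (rule exec_IfE)
    fix v assume "u = Suc (bcost b + v)" "exec c2 s v s''"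
    with IfFalse.IH[of v s''] show ?thesis by simp
  qed (use IfFalse.hyps in simp)
next
  case (WhileFalse s b c)
  from WhileFalse.prems show ?case
    by (rule exec_WhileE) (use WhileFalse.hyps in simp_all)
next
  case (WhileTrue s b c t1 s1 t2 s2)
  from WhileTrue.prems show ?case
  proof (rule exec_WhileE)
    fix u1 v u2
    assume u: "u = Suc (bcost b + u1 + u2)" "exec c s u1 v" "exec (CWhile b c) v u2 s''"
    from WhileTrue.IH(1)[OF u(2)] u(3) have "t1 = u1" "exec (CWhile b c) s1 u2 s''" by simp_all
    with WhileTrue.IH(2)[of u2 s''] u(1) show ?thesis by simp
  qed (use WhileTrue.hyps in simp)
qed


section \<open>Algorithms for the discretized problem\<close>

text \<open>The decoding orders are not part of the input. Cells that do not hold input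
  are zero, so the initial state carries no other information.\<close>

definition init_state :: "noma \<Rightarrow> real \<Rightarrow> state" where
  "init_state I \<epsilon> =
     \<lparr>nats = (\<lambda>x is.
        if x = ''K'' \<and> is = [] then users I
        else if x = ''N'' \<and> is = [] then carriers I
        else if x = ''M'' \<and> is = [] then mux I
        else 0),
      reals = (\<lambda>x is.
        if x = ''w'' \<and> (\<exists>k\<in>{1..users I}. is = [k]) then weight I (is ! 0)
        else if x = ''W'' \<and> (\<exists>n\<in>{1..carriers I}. is = [n]) then bandwidth I (is ! 0)
        else if x = ''eta'' \<and> (\<exists>n\<in>{1..carriers I}. \<exists>k\<in>{1..users I}. is = [n, k])
          then noise I (is ! 0) (is ! 1)
        else if x = ''Pmax'' \<and> is = [] then total_power I
        else if x = ''Pn'' \<and> (\<exists>n\<in>{1..carriers I}. is = [n]) then carrier_power I (is ! 0)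
        else if x = ''delta'' \<and> is = [] then power_unit I
        else if x = ''eps'' \<and> is = [] then \<epsilon>
        else 0)\<rparr>"

definition runs :: "com \<Rightarrow> noma \<Rightarrow> real \<Rightarrow> nat \<Rightarrow> (nat \<Rightarrow> real) \<Rightarrow> bool" where
  "runs c I \<epsilon> t P \<longleftrightarrow>
     (\<exists>s. exec c (init_state I \<epsilon>) t s \<and> P = (\<lambda>n\<in>{1..carriers I}. reals s ''P'' [n]))"

text \<open>Each of the \<open>N + 2\<close> power values \<open>P_max\<close>, \<open>\<delta>\<close> and the \<open>N\<close> limits per subcarrier
  has \<open>O(log J)\<close> bits and \<open>M\<close> is written in binary; the weights, bandwidths, noise powers
  and \<open>\<epsilon>\<close> are real numbers of unit size. The summands 1 keep the logarithmic sizes positive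
  for \<open>J \<le> 1\<close> and \<open>M = 1\<close>.\<close>

definition input_size :: "noma \<Rightarrow> real" where
  "input_size I =
     real (users I) + real (carriers I) + real (carriers I) * real (users I) +
     (1 + log 2 (real (mux I))) +
     (real (carriers I) + 2) * (1 + log 2 (1 + real (J_levels I))) + 1"

text \<open>\<open>p\<close> is a polynomial in two variables; the bound is \<open>p\<close> evaluated at the input size
  and at \<open>1/\<epsilon>\<close>.\<close>

definition fptas :: "com \<Rightarrow> bool" where
  "fptas c \<longleftrightarrow>
     (\<exists>p :: real poly poly. \<forall>I \<epsilon>. valid_noma I \<and> \<epsilon> > 0 \<longrightarrow>
        (\<exists>t P. runs c I \<epsilon> t P \<and> approx_solution I \<epsilon> P \<and>
           real t \<le> poly (poly p [:1 / \<epsilon>:]) (input_size I)))"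

end

theory Submission
  imports Defs
begin

text \<open>
On a single carrier the order constraint can be dropped: the utility of a user \<open>z\<close> minus that of a
user \<open>u\<close> with larger noise is quasiconcave in the power level, so exchanging pieces sorts any
splitting of \<open>[0, P]\<close> into at most \<open>M\<close> user pieces without loss. The same exchange shows that, for
each number of pieces and each last user, one switching point, optimal over \<open>[0, P_max]\<close>,
serves all smaller budgets; these points are tabulated with \<open>O(MK\<^sup>2)\<close> operations per carrier, and a value of
\<open>F\<close> then is a maximum over \<open>K\<close> entries.

What remains is a multiple-choice knapsack problem. It is solved exactly over the \<open>J\<close> levels, or
approximately over profits rounded down to multiples of \<open>\<epsilon> V / N\<close>, where the guess \<open>V\<close> of the optimum runs through
\<open>U, 2 U, 4 U, \<dots>\<close> up to \<open>N U\<close> and \<open>U\<close> is the best value of a single carrier. No carrier earns more than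
\<open>U\<close>, so for the guess \<open>V\<close> there are at most \<open>(N / \<epsilon>) (U / V)\<close> profit levels per carrier, and the costs of
the rounds form a geometric series: no constant-factor estimate of the optimum is needed
beforehand. The program runs whichever of the two algorithms has the smaller cost estimate.
\<close>

section \<open>Piecewise allocations of a single carrier\<close>

text \<open>What makes pieces exchangeable is that the derivative of a difference of two user
  utilities has the sign of an affine function of the power level; with ordered noises it changes
  sign at most once, from plus to minus. The delicate case for the tables is a budget below a
  tabulated switching point: there \<open>attain_trim\<close> shows that the last user can be
  dispensed with altogether. The machine shapes the rest. It can neither round a real to a natural
  number nor halve a natural number, so \<open>J\<close>, the caps and the least power level that
  earns a given profit are found by binary search with tabulated powers of two, while the number of
  profit levels and the size of the profit table are found by counting. The profit table reaches up
  to \<open>2 V\<close>, because the round for the guess \<open>V\<close> has to serve every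
  solution of value in \<open>[V, 2 V)\<close>; on that range the rounding loss
  \<open>N g = \<epsilon> V\<close> is at most the fraction \<open>\<epsilon>\<close> of the
  value.\<close>

text \<open>\<open>attain h A m P v\<close>: the interval \<open>[0, P]\<close> can be split into at most \<open>m\<close> pieces, each
  served by a user of \<open>A\<close> in an arbitrary order, with total utility \<open>v\<close>.\<close>

inductive attain :: "(nat \<Rightarrow> real \<Rightarrow> real) \<Rightarrow> nat set \<Rightarrow> nat \<Rightarrow> real \<Rightarrow> real \<Rightarrow> bool"
  for h :: "nat \<Rightarrow> real \<Rightarrow> real" and A :: "nat set" where
  zero: "attain h A m 0 0"
| piece: "attain h A m y v \<Longrightarrow> u \<in> A \<Longrightarrow> y \<le> P \<Longrightarrow> attain h A (Suc m) P (v + h u P - h u y)"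

lemma attain_nonneg: "attain h A m P v \<Longrightarrow> 0 \<le> P"
  by (induction rule: attain.induct) auto

lemma attain_Suc: "attain h A m P v \<Longrightarrow> attain h A (Suc m) P v"
  by (induction rule: attain.induct) (auto intro: attain.intros)

lemma attain_mono: "attain h A m P v \<Longrightarrow> m \<le> m' \<Longrightarrow> attain h A m' P v"
  by (rotate_tac, induction m' rule: dec_induct) (auto intro: attain_Suc)

lemma attain_subset: "attain h A m P v \<Longrightarrow> A \<subseteq> A' \<Longrightarrow> attain h A' m P v"
  by (induction rule: attain.induct) (auto intro: attain.intros)

lemma attain_0D: "attain h A m P v \<Longrightarrow> P = 0 \<Longrightarrow> v = 0"
  by (induction rule: attain.induct) (auto dest: attain_nonneg)

lemma attain_empty: "attain h {} m P v \<Longrightarrow> P = 0 \<and> v = 0"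
  by (induction rule: attain.induct) auto

lemma attain_zeroD: "attain h A 0 P v \<Longrightarrow> P = 0 \<and> v = 0"
  by (auto elim: attain.cases)

text \<open>The topmost piece is stretched up to \<open>P'\<close>, which costs nothing by
  monotonicity. An empty allocation has no piece to stretch and must open one, hence
  \<open>0 < m\<close> and \<open>A \<noteq> {}\<close>.\<close>

lemma attain_extend:
  assumes "attain h A m P v" "P \<le> P'" "A \<noteq> {}" "0 < m"
    and mono: "\<And>u x y. u \<in> A \<Longrightarrow> 0 \<le> x \<Longrightarrow> x \<le> y \<Longrightarrow> h u x \<le> h u y"
  shows "\<exists>v'\<ge>v. attain h A m P' v'"
  using assms(1)
proof cases
  case zero
  obtain u where u: "u \<in> A" using assms(3) by blast
  obtain k where k: "m = Suc k" using assms(4) by (cases m) auto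
  have "attain h A m P' (0 + h u P' - h u 0)"
    unfolding k by (rule attain.piece[OF attain.zero u]) (use zero assms(2) in simp)
  then show ?thesis using mono[OF u, of 0 P'] zero assms(2) by (intro exI[of _ "0 + h u P' - h u 0"]) auto
next
  case (piece k y v0 u)
  have "attain h A m P' (v0 + h u P' - h u y)"
    unfolding piece(1) by (rule attain.piece[OF piece(3) piece(4)]) (use piece assms(2) in simp)
  then show ?thesis using mono[OF piece(4), of P P'] piece assms(2) attain_nonneg[OF piece(3)]
    by (intro exI[of _ "v0 + h u P' - h u y"]) auto
qed

section \<open>Exchange arguments for quasiconcave utility differences\<close>

definition quasiconcave :: "(real \<Rightarrow> real) \<Rightarrow> bool" where
  "quasiconcave d \<longleftrightarrow> (\<forall>a b c. 0 \<le> a \<and> a \<le> b \<and> b \<le> c \<longrightarrow> min (d a) (d c) \<le> d b)"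

lemma quasiconcaveD: "quasiconcave d \<Longrightarrow> 0 \<le> a \<Longrightarrow> a \<le> b \<Longrightarrow> b \<le> c \<Longrightarrow> d a \<le> d b \<or> d c \<le> d b"
  unfolding quasiconcave_def by (metis min_le_iff_disj)

text \<open>The sorting step: the user \<open>u\<close>, typically the one with the largest noise,
  is either removed or pushed to the top. Whenever a piece of some \<open>z\<close> lies directly
  above a piece of \<open>u\<close>, one of the two can take over both pieces without loss, so
  \<open>u\<close> never has to stay below another user.\<close>

lemma attain_last_user:
  assumes "attain h (insert u A) m P v"
    and qc: "\<And>z. z \<in> A \<Longrightarrow> quasiconcave (\<lambda>x. h z x - h u x)"
  shows "(\<exists>v'\<ge>v. attain h A m P v') \<or>
     (\<exists>m' y v'. m = Suc m' \<and> y \<le> P \<and> attain h A m' y v' \<and> v \<le> v' + h u P - h u y)"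
  using assms(1)
proof (induction rule: attain.induct)
  case (zero m)
  then show ?case by (auto intro: attain.zero)
next
  case (piece m y v z P)
  show ?case using piece.IH
  proof (elim disjE exE conjE)
    fix v' assume v': "v \<le> v'" "attain h A m y v'"
    show ?thesis
    proof (cases "z \<in> A")
      case True
      have "attain h A (Suc m) P (v' + h z P - h z y)"
        by (rule attain.piece[OF v'(2) True piece.hyps(3)])
      then show ?thesis using v'(1) by (intro disjI1 exI[of _ "v' + h z P - h z y"]) simp
    next
      case False
      then have "z = u" using piece.hyps by blast
      then show ?thesis using v' piece.hyps(3)
        by (intro disjI2 exI[of _ m] exI[of _ y] exI[of _ v']) simp
    qed
  next
    fix m' y' v' assume *: "m = Suc m'" "y' \<le> y" "attain h A m' y' v'" "v \<le> v' + h u y - h u y'"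
    show ?thesis
    proof (cases "z = u")
      case True
      then show ?thesis using * piece.hyps(3) attain_Suc[OF *(3)]
        by (intro disjI2 exI[of _ m] exI[of _ y'] exI[of _ v']) auto
    next
      case False
      then have z: "z \<in> A" using piece.hyps by blast
      \<comment> \<open>User \<open>u\<close> holds \<open>[y', y]\<close> and \<open>z\<close>
        holds \<open>[y, P]\<close>. Either \<open>z\<close> gains at least as much as
        \<open>u\<close> on the lower interval, or \<open>u\<close> gains at least as much as
        \<open>z\<close> on the upper one.\<close>
      have "h z y' - h u y' \<le> h z y - h u y \<or> h z P - h u P \<le> h z y - h u y"
        using quasiconcaveD[OF qc[OF z] attain_nonneg[OF *(3)] *(2) piece.hyps(3)] by simp
      then show ?thesis
      proof
        assume "h z y' - h u y' \<le> h z y - h u y"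
        moreover have "attain h A (Suc m) P (v' + h z P - h z y')"
          unfolding *(1) by (intro attain_Suc attain.piece[OF *(3) z]) (use * piece.hyps in simp)
        ultimately show ?thesis using * by (intro disjI1 exI[of _ "v' + h z P - h z y'"]) simp
      next
        assume "h z P - h u P \<le> h z y - h u y"
        then show ?thesis using * attain_Suc[OF *(3)] piece.hyps(3)
          by (intro disjI2 exI[of _ m] exI[of _ y'] exI[of _ v']) auto
      qed
    qed
  qed
qed

text \<open>The reason why a single switching point serves all smaller budgets. Cutting the top off
  costs at most what \<open>u\<close> would earn there, unless some piece of a user \<open>z\<close>
  earns more than \<open>u\<close> above \<open>P\<close>; then quasiconcavity makes
  \<open>z\<close> at least as good as \<open>u\<close> on every interval ending at
  \<open>P\<close>.\<close>

lemma attain_trim: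
  assumes "attain h A m Y v" "P \<le> Y" "0 \<le> P"
    and qc: "\<And>z. z \<in> A \<Longrightarrow> quasiconcave (\<lambda>x. h z x - h u x)"
  shows "(\<exists>v'. attain h A m P v' \<and> v - (h u Y - h u P) \<le> v') \<or>
     (\<exists>z\<in>A. \<forall>y. 0 \<le> y \<and> y \<le> P \<longrightarrow> h u P - h u y \<le> h z P - h z y)"
  using assms(1,2)
proof (induction rule: attain.induct)
  case (zero m)
  then have "P = 0" using assms(3) by simp
  then show ?case by (auto intro: attain.zero)
next
  case (piece m y0 v0 z Y)
  note q = quasiconcaveD[OF qc[OF piece.hyps(2)]]
  show ?case
  proof (cases "P \<le> y0")
    case True
    from piece.IH[OF True] show ?thesis
    proof (elim disjE exE conjE)
      fix v' assume v': "attain h A m P v'" "v0 - (h u y0 - h u P) \<le> v'"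
      show ?thesis
      proof (cases "h z Y - h z y0 \<le> h u Y - h u y0")
        case True
        then show ?thesis using v' attain_Suc[OF v'(1)] by (intro disjI1 exI[of _ v']) auto
      next
        case False
        \<comment> \<open>The difference \<open>h z - h u\<close> is larger at \<open>Y\<close> than
          at \<open>y0\<close>, so by quasiconcavity it cannot exceed its value at \<open>P\<close>
          anywhere below \<open>P\<close>.\<close>
        have "h u P - h u y \<le> h z P - h z y" if "0 \<le> y" "y \<le> P" for y
          using q[of y y0 Y] q[of y P Y] False that True piece by linarith
        then show ?thesis using piece.hyps by blast
      qed
    qed blast
  next
    case False
    show ?thesis
    proof (cases "h z Y - h z P \<le> h u Y - h u P")
      case True
      have "attain h A (Suc m) P (v0 + h z P - h z y0)"
        by (rule attain.piece[OF piece.hyps(1,2)]) (use False in simp)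
      then show ?thesis using True by (intro disjI1 exI[of _ "v0 + h z P - h z y0"]) simp
    next
      case False
      have "h u P - h u y \<le> h z P - h z y" if "0 \<le> y" "y \<le> P" for y
        using q[of y P Y] False that piece by linarith
      then show ?thesis using piece.hyps by blast
    qed
  qed
qed

text \<open>Users are listed by increasing noise. \<open>Y m i\<close> is the level at which the
  last user \<open>us i\<close> takes over, and \<open>G m i\<close> is the value with the
  contribution of the upper end left out: an entry is worth \<open>G m i + h (us i) P\<close> at
  every budget \<open>P\<close> from \<open>Y m i\<close> on, so it need not be recomputed for each
  budget. An entry without predecessor is the single piece \<open>[0, P]\<close>.\<close>

locale user_tables =
  fixes h :: "nat \<Rightarrow> real \<Rightarrow> real" and us :: "nat \<Rightarrow> nat" and K M :: nat and B :: real
    and Y G :: "nat \<Rightarrow> nat \<Rightarrow> real"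
  assumes qc: "\<And>i j. 1 \<le> j \<Longrightarrow> j < i \<Longrightarrow> i \<le> K \<Longrightarrow> quasiconcave (\<lambda>x. h (us j) x - h (us i) x)"
    and sound: "\<And>m i. 1 \<le> m \<Longrightarrow> m \<le> M \<Longrightarrow> 1 \<le> i \<Longrightarrow> i \<le> K \<Longrightarrow>
      Y m i = 0 \<and> G m i = - h (us i) 0 \<or>
      1 < m \<and> Y m i \<le> B \<and> (\<exists>e. 1 \<le> e \<and> e < i \<and> Y (m - 1) e \<le> Y m i \<and>
        G m i = G (m - 1) e + h (us e) (Y m i) - h (us i) (Y m i))"
    and base: "\<And>m i. 1 \<le> m \<Longrightarrow> m \<le> M \<Longrightarrow> 1 \<le> i \<Longrightarrow> i \<le> K \<Longrightarrow> m = 1 \<or> i = 1 \<Longrightarrow>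
      Y m i = 0 \<and> G m i = - h (us i) 0"
    and complete: "\<And>m i e y. 1 < m \<Longrightarrow> m \<le> M \<Longrightarrow> i \<le> K \<Longrightarrow> 1 \<le> e \<Longrightarrow> e < i \<Longrightarrow>
      Y (m - 1) e \<le> y \<Longrightarrow> y \<le> B \<Longrightarrow> G (m - 1) e + h (us e) y - h (us i) y \<le> G m i"
begin

text \<open>Unrolls an entry along its predecessors: the predecessor serves the levels just below
  \<open>Y m i\<close>, where its own entry is valid because its switching point is not
  higher.\<close>

lemma attain_table:
  "1 \<le> m \<Longrightarrow> m \<le> M \<Longrightarrow> 1 \<le> i \<Longrightarrow> i \<le> K \<Longrightarrow> Y m i \<le> P \<Longrightarrow>
    attain h (us ` {1..i}) m P (G m i + h (us i) P)"
proof (induction m arbitrary: i P)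
  case (Suc m)
  from sound[of "Suc m" i] Suc.prems(1-4)
  have "Y (Suc m) i = 0 \<and> G (Suc m) i = - h (us i) 0 \<or>
      1 < Suc m \<and> Y (Suc m) i \<le> B \<and> (\<exists>e. 1 \<le> e \<and> e < i \<and> Y (Suc m - 1) e \<le> Y (Suc m) i \<and>
        G (Suc m) i = G (Suc m - 1) e + h (us e) (Y (Suc m) i) - h (us i) (Y (Suc m) i))" by blast
  then show ?case
  proof (elim disjE conjE exE)
    assume "Y (Suc m) i = 0" "G (Suc m) i = - h (us i) 0"
    moreover have "us i \<in> us ` {1..i}" using Suc.prems by simp
    ultimately show ?thesis using attain.piece[OF attain.zero, of "us i" "us ` {1..i}" P h m] Suc.prems
      by simp
  next
    fix e assume *: "1 < Suc m" "1 \<le> e" "e < i" "Y (Suc m - 1) e \<le> Y (Suc m) i"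
      "G (Suc m) i = G (Suc m - 1) e + h (us e) (Y (Suc m) i) - h (us i) (Y (Suc m) i)"
    have "attain h (us ` {1..e}) m (Y (Suc m) i) (G m e + h (us e) (Y (Suc m) i))"
      using Suc.IH[of e "Y (Suc m) i"] * Suc.prems by simp
    then have "attain h (us ` {1..i}) m (Y (Suc m) i) (G m e + h (us e) (Y (Suc m) i))"
      by (rule attain_subset) (use * in auto)
    from attain.piece[OF this, of "us i" P]
    have "attain h (us ` {1..i}) (Suc m) P
        (G m e + h (us e) (Y (Suc m) i) + h (us i) P - h (us i) (Y (Suc m) i))" using * Suc.prems by simp
    moreover have "G m e + h (us e) (Y (Suc m) i) + h (us i) P - h (us i) (Y (Suc m) i) = G (Suc m) i + h (us i) P"
      using * by simp
    ultimately show ?thesis by simp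
  qed
qed simp

text \<open>Nested induction on pieces and users. By \<open>attain_last_user\<close> the noisiest
  user is absent, which is the inner induction, or holds the top piece; in the latter case the part
  below is bounded by the previous row and \<open>complete\<close> yields the bound, provided that
  the entry is usable at \<open>P\<close>.\<close>

lemma attain_le_table:
  "m \<le> M \<Longrightarrow> 1 \<le> m \<Longrightarrow> 1 \<le> i \<Longrightarrow> i \<le> K \<Longrightarrow> P \<le> B \<Longrightarrow> attain h (us ` {1..i}) m P v \<Longrightarrow>
    \<exists>e. 1 \<le> e \<and> e \<le> i \<and> Y m e \<le> P \<and> v \<le> G m e + h (us e) P"
proof (induction m arbitrary: i P v)
  case (Suc m)
  note IHm = Suc.IH
  from Suc.prems(3-6) show ?case
  proof (induction i arbitrary: P v)
    case (Suc i)
    let ?u = "us (Suc i)" and ?A = "us ` {1..i}"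
    have A: "us ` {1..Suc i} = insert ?u ?A" using Suc.prems
      by (simp add: atLeastAtMostSuc_conv)
    have q: "quasiconcave (\<lambda>x. h z x - h ?u x)" if "z \<in> ?A" for z
      using that qc[of _ "Suc i"] Suc.prems by auto
    have P0: "0 \<le> P" by (rule attain_nonneg[OF Suc.prems(4)])
    have IHi: ?case if "attain h ?A (Suc m) P v'" "v \<le> v'" for v'
    proof (cases "i = 0")
      case True
      then have "P = 0" "v' = 0" using attain_empty[of h "Suc m" P v'] that by auto
      moreover have "Y (Suc m) 1 = 0" "G (Suc m) 1 = - h (us 1) 0"
        using base[of "Suc m" 1] Suc.prems \<open>Suc m \<le> M\<close> by auto
      ultimately show ?thesis using that True by (intro exI[of _ 1]) simp
    next
      case False
      then show ?thesis using Suc.IH[OF _ _ Suc.prems(3) that(1)] Suc.prems that(2)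
        by (force intro: order_trans)
    qed
    from attain_last_user[OF Suc.prems(4)[unfolded A], OF q]
    have "(\<exists>v'\<ge>v. attain h ?A (Suc m) P v') \<or>
     (\<exists>m' y v'. Suc m = Suc m' \<and> y \<le> P \<and> attain h ?A m' y v' \<and> v \<le> v' + h ?u P - h ?u y)" by blast
    then show ?case
    proof (elim disjE exE conjE)
      fix v' assume "v \<le> v'" "attain h ?A (Suc m) P v'"
      then show ?thesis using IHi by blast
    next
      fix m' y v' assume *: "Suc m = Suc m'" "y \<le> P" "attain h ?A m' y v'" "v \<le> v' + h ?u P - h ?u y"
      have y0: "0 \<le> y" using attain_nonneg[OF *(3)] .
      show ?thesis
      \<comment> \<open>Without earlier pieces or earlier users nothing lies below the top piece,
        and the entry is the default one.\<close>
      proof (cases "m = 0 \<or> i = 0")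
        case True
        then have "y = 0" "v' = 0" using * attain_zeroD[of h ?A y v'] attain_empty[of h m' y v'] by auto
        moreover have "Y (Suc m) (Suc i) = 0" "G (Suc m) (Suc i) = - h ?u 0"
          using base[of "Suc m" "Suc i"] Suc.prems \<open>Suc m \<le> M\<close> True by auto
        ultimately show ?thesis using * P0 by (intro exI[of _ "Suc i"]) simp
      next
        case False
        from IHm[of i y v'] * False Suc.prems \<open>Suc m \<le> M\<close> obtain e where
          e: "1 \<le> e" "e \<le> i" "Y m e \<le> y" "v' \<le> G m e + h (us e) y" by auto
        have "G m e + h (us e) y - h ?u y \<le> G (Suc m) (Suc i)"
          using complete[of "Suc m" "Suc i" e y] e False Suc.prems \<open>Suc m \<le> M\<close> * by simp
        then have v: "v \<le> G (Suc m) (Suc i) + h ?u P" using e * by simp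
        show ?thesis
        proof (cases "Y (Suc m) (Suc i) \<le> P")
          case True
          then show ?thesis using v by (intro exI[of _ "Suc i"]) simp
        next
          \<comment> \<open>The table switches to the last user only above the budget. Trimming the
            tabulated allocation to \<open>P\<close> either yields an equally good allocation
            without that user, or exhibits a user that can replace it in the given
            allocation.\<close>
          case nle: False
          let ?Y = "Y (Suc m) (Suc i)"
          from sound[of "Suc m" "Suc i"] nle P0 Suc.prems \<open>Suc m \<le> M\<close> obtain f where
            f: "1 \<le> f" "f < Suc i" "Y m f \<le> ?Y" "G (Suc m) (Suc i) = G m f + h (us f) ?Y - h ?u ?Y"
            by auto
          have "attain h (us ` {1..f}) m ?Y (G m f + h (us f) ?Y)"
            using attain_table[of m f ?Y] f False Suc.prems \<open>Suc m \<le> M\<close> by simp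
          then have "attain h ?A m ?Y (G (Suc m) (Suc i) + h ?u ?Y)"
            using f by (auto intro: attain_subset)
          from attain_trim[OF this _ P0, OF _ q] nle
          have "(\<exists>v'. attain h ?A m P v' \<and> G (Suc m) (Suc i) + h ?u ?Y - (h ?u ?Y - h ?u P) \<le> v') \<or>
             (\<exists>z\<in>?A. \<forall>y. 0 \<le> y \<and> y \<le> P \<longrightarrow> h ?u P - h ?u y \<le> h z P - h z y)" by auto
          then show ?thesis
          proof (elim disjE exE bexE conjE)
            fix v1 assume "attain h ?A m P v1" "G (Suc m) (Suc i) + h ?u ?Y - (h ?u ?Y - h ?u P) \<le> v1"
            then show ?thesis using IHi[OF attain_Suc, of v1] v by simp
          next
            fix z assume z: "z \<in> ?A" "\<forall>y. 0 \<le> y \<and> y \<le> P \<longrightarrow> h ?u P - h ?u y \<le> h z P - h z y"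
            have "attain h ?A (Suc m) P (v' + h z P - h z y)"
              using attain.piece[OF *(3) z(1) *(2)] * by simp
            then show ?thesis using IHi[of "v' + h z P - h z y"] z(2)[rule_format, of y] y0 * by simp
          qed
        qed
      qed
    qed
  qed simp
qed simp

end

section \<open>The optimal value of a single carrier\<close>

definition hh :: "noma \<Rightarrow> nat \<Rightarrow> nat \<Rightarrow> real \<Rightarrow> real" where
  "hh I n k x = bandwidth I n * weight I k * log 2 (x + noise I n k)"

text \<open>The hypothesis \<open>pos\<close> is the nonnegativity of the derivative with the
  denominators cleared, which leaves an inequality that is affine in \<open>x\<close>.\<close>

lemma log_diff_mono:
  fixes c a b p q lo hi :: real
  assumes "0 \<le> lo" "lo \<le> hi" "0 < c" "0 < p" "0 < q"
    and pos: "\<And>x. lo \<le> x \<Longrightarrow> x \<le> hi \<Longrightarrow> b * (x + p) \<le> a * (x + q)"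
  shows "c * a * log 2 (lo + p) - c * b * log 2 (lo + q) \<le> c * a * log 2 (hi + p) - c * b * log 2 (hi + q)"
proof (rule DERIV_nonneg_imp_nondecreasing[OF assms(2)])
  fix x assume x: "lo \<le> x" "x \<le> hi"
  have p: "0 < x + p" "0 < x + q" using x assms by auto
  have d: "((\<lambda>x. c * a * log 2 (x + p)) has_real_derivative c * a / ((x + p) * ln 2)) (at x)"
    if "0 < x + p" for a p
    unfolding log_def using that by (auto intro!: derivative_eq_intros)
  have "((\<lambda>x. c * a * log 2 (x + p) - c * b * log 2 (x + q)) has_real_derivative
      c * a / ((x + p) * ln 2) - c * b / ((x + q) * ln 2)) (at x)"
    by (intro DERIV_diff d p)
  moreover have "b / (x + q) \<le> a / (x + p)" using pos[OF x] p by (simp add: field_simps)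
  then have "c / ln 2 * (b / (x + q)) \<le> c / ln 2 * (a / (x + p))"
    using assms(3) by (intro mult_left_mono) auto
  then have "0 \<le> c * a / ((x + p) * ln 2) - c * b / ((x + q) * ln 2)" by (simp add: field_simps)
  ultimately show "\<exists>y. ((\<lambda>x. c * a * log 2 (x + p) - c * b * log 2 (x + q)) has_real_derivative y) (at x) \<and> 0 \<le> y"
    by blast
qed

context
  fixes I :: noma and n :: nat
  assumes valid: "valid_noma I" and n: "n \<in> {1..carriers I}"
begin

lemma bandwidth_pos: "0 < bandwidth I n"
  using valid n by (simp add: valid_noma_def)

lemma weight_pos: "k \<in> {1..users I} \<Longrightarrow> 0 < weight I k"
  using valid by (simp add: valid_noma_def)

lemma noise_pos: "k \<in> {1..users I} \<Longrightarrow> 0 < noise I n k"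
  using valid n by (simp add: valid_noma_def)

lemma hh_mono: "k \<in> {1..users I} \<Longrightarrow> 0 \<le> x \<Longrightarrow> x \<le> y \<Longrightarrow> hh I n k x \<le> hh I n k y"
  using bandwidth_pos weight_pos[of k] noise_pos[of k]
  unfolding hh_def by (intro mult_left_mono) (auto simp: log_le_cancel_iff)

lemma hh_diff_mono:
  assumes "z \<in> {1..users I}" "u \<in> {1..users I}" "0 \<le> lo" "lo \<le> hi"
    "\<And>x. lo \<le> x \<Longrightarrow> x \<le> hi \<Longrightarrow> weight I u * (x + noise I n z) \<le> weight I z * (x + noise I n u)"
  shows "hh I n z lo - hh I n u lo \<le> hh I n z hi - hh I n u hi"
  unfolding hh_def using assms bandwidth_pos noise_pos by (intro log_diff_mono) auto

text \<open>The derivative has the sign of \<open>w_z (x + eta_u) - w_u (x + eta_z)\<close>. For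
  \<open>w_z \<ge> w_u\<close> this is nonnegative on all levels because the noise of
  \<open>z\<close> is not larger; otherwise it decreases in \<open>x\<close>. So its sign at
  \<open>b\<close> settles whether the difference has increased since \<open>a\<close> or decreases
  up to \<open>c\<close>.\<close>

lemma hh_quasiconcave:
  assumes z: "z \<in> {1..users I}" and u: "u \<in> {1..users I}" and le: "noise I n z \<le> noise I n u"
  shows "quasiconcave (\<lambda>x. hh I n z x - hh I n u x)"
  unfolding quasiconcave_def
proof (intro allI impI, elim conjE)
  fix a b c :: real assume abc: "0 \<le> a" "a \<le> b" "b \<le> c"
  let ?z = "weight I z" and ?u = "weight I u"
  let ?p = "noise I n z" and ?q = "noise I n u"
  note pos = weight_pos[OF z] weight_pos[OF u] noise_pos[OF z] noise_pos[OF u]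
  have zq: "?z * ?p \<le> ?z * ?q" using le pos by simp
  show "min (hh I n z a - hh I n u a) (hh I n z c - hh I n u c) \<le> hh I n z b - hh I n u b"
  proof (cases "?u * (b + ?p) \<le> ?z * (b + ?q)")
    case True
    have "?u * (x + ?p) \<le> ?z * (x + ?q)" if x: "a \<le> x" "x \<le> b" for x
    proof (cases "?u \<le> ?z")
      case True
      have "?u * (x + ?p) \<le> ?z * (x + ?p)" using True x abc pos by (intro mult_right_mono) auto
      also have "\<dots> \<le> ?z * (x + ?q)" using pos le by (intro mult_left_mono) auto
      finally show ?thesis .
    next
      case False
      then have "(?u - ?z) * x \<le> (?u - ?z) * b" using x by (intro mult_left_mono) auto
      then show ?thesis using True by (simp add: algebra_simps)
    qed
    then have "hh I n z a - hh I n u a \<le> hh I n z b - hh I n u b"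
      using hh_diff_mono[OF z u abc(1,2)] by blast
    then show ?thesis by simp
  next
    case False
    have "?z < ?u"
    proof (rule ccontr)
      assume "\<not> ?z < ?u"
      then have "?u * (b + ?p) \<le> ?z * (b + ?p)" using abc pos by (intro mult_right_mono) auto
      also have "\<dots> \<le> ?z * (b + ?q)" using pos le by (intro mult_left_mono) auto
      finally show False using False by simp
    qed
    have "?z * (x + ?q) \<le> ?u * (x + ?p)" if x: "b \<le> x" "x \<le> c" for x
    proof -
      have "(?u - ?z) * b \<le> (?u - ?z) * x" using x \<open>?z < ?u\<close> by (intro mult_left_mono) auto
      then show ?thesis using False by (simp add: algebra_simps)
    qed
    then have "hh I n u b - hh I n z b \<le> hh I n u c - hh I n z c"
      using hh_diff_mono[OF u z _ abc(3)] abc by auto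
    then show ?thesis by simp
  qed
qed

text \<open>The root \<open>y0\<close> of the affine sign function is where the difference peaks,
  and clamping it to \<open>[lo, B]\<close> gives the best admissible level. If \<open>z\<close> has
  at least the weight of \<open>u\<close>, the difference increases throughout and the peak is at
  \<open>B\<close>.\<close>

lemma hh_best_switch:
  assumes z: "z \<in> {1..users I}" and u: "u \<in> {1..users I}" and le: "noise I n z \<le> noise I n u"
    and lo: "0 \<le> lo" and y: "lo \<le> y" "y \<le> B"
    and y0: "y0 = (if weight I z < weight I u
      then (weight I z * noise I n u - weight I u * noise I n z) / (weight I u - weight I z) else B)"
  shows "hh I n z y - hh I n u y \<le> hh I n z (min B (max lo y0)) - hh I n u (min B (max lo y0))"
proof -
  let ?z = "weight I z" and ?u = "weight I u"
  let ?p = "noise I n z" and ?q = "noise I n u"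
  let ?y = "min B (max lo y0)"
  note pos = weight_pos[OF z] weight_pos[OF u] noise_pos[OF z] noise_pos[OF u]
  show ?thesis
  proof (cases "?z < ?u")
    case False
    then have "?y = B" using y0 y by simp
    moreover have "?u * (x + ?p) \<le> ?z * (x + ?q)" if "y \<le> x" for x
    proof -
      have "?u * (x + ?p) \<le> ?z * (x + ?p)" using False that lo y pos by (intro mult_right_mono) auto
      also have "\<dots> \<le> ?z * (x + ?q)" using pos le by (intro mult_left_mono) auto
      finally show ?thesis .
    qed
    ultimately show ?thesis using hh_diff_mono[OF z u _ y(2)] lo y by auto
  next
    case True
    then have "(?u - ?z) * y0 = ?z * ?q - ?u * ?p" using y0 by simp
    then have q: "?z * (x + ?q) - ?u * (x + ?p) = (?u - ?z) * (y0 - x)" for x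
      by (simp add: algebra_simps)
    have below: "?u * (x + ?p) \<le> ?z * (x + ?q)" if "x \<le> y0" for x
      using q[of x] that True by (smt (verit) mult_nonneg_nonneg)
    have above: "?z * (x + ?q) \<le> ?u * (x + ?p)" if "y0 \<le> x" for x
      using q[of x] that True by (smt (verit) mult_nonneg_nonneg mult_minus_right)
    consider "y = ?y" | "y < ?y" | "?y < y" by linarith
    then show ?thesis
    proof cases
      case 1
      then show ?thesis by simp
    next
      case 2
      then have "?y \<le> y0" using y by linarith
      then show ?thesis using 2 lo y by (intro hh_diff_mono[OF z u] below) auto
    next
      case 3
      then have "y0 \<le> ?y" using y by linarith
      then have "hh I n u ?y - hh I n z ?y \<le> hh I n u y - hh I n z y"
        using 3 lo y by (intro hh_diff_mono[OF u z] above) auto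
      then show ?thesis by simp
    qed
  qed
qed

section \<open>From decreasing level vectors to piecewise allocations and back\<close>

definition sc_value :: "(nat \<Rightarrow> real) \<Rightarrow> real" where
  "sc_value x = (\<Sum>i=1..users I. f_user I n i (x i)) + A_carrier I n"

lemma dec_order_image: "dec_order I n ` {1..users I} = {1..users I}"
  using valid n by (intro permutes_image) (simp add: valid_noma_def)

lemma dec_order_mem: "i \<in> {1..users I} \<Longrightarrow> dec_order I n i \<in> {1..users I}"
  using dec_order_image by blast

lemma dec_order_sorted:
  assumes "1 \<le> i" "i \<le> j" "j \<le> users I"
  shows "noise I n (dec_order I n j) \<le> noise I n (dec_order I n i)"
  using assms(2,1,3)
proof (induction j rule: dec_induct)
  case (step j)
  then have "noise I n (dec_order I n (j + 1)) \<le> noise I n (dec_order I n j)"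
    using valid n by (simp add: valid_noma_def)
  then show ?case using step by simp
qed simp

lemma users_pos: "1 \<le> users I"
  using valid by (simp add: valid_noma_def)

text \<open>Summation by parts: \<open>f_user\<close> at position \<open>i\<close> is the utility of
  the user at \<open>i\<close> minus that of the user at \<open>i - 1\<close>, so the user at
  position \<open>i\<close> is credited with the increment of its own utility from
  \<open>x (Suc i)\<close> to \<open>x i\<close>. The constant \<open>A_carrier\<close> cancels the
  remaining term at level 0.\<close>

lemma sc_value_telescope:
  assumes "x (Suc (users I)) = 0"
  shows "sc_value x = (\<Sum>i=1..users I. hh I n (dec_order I n i) (x i) - hh I n (dec_order I n i) (x (Suc i)))"
proof -
  let ?h = "\<lambda>i. hh I n (dec_order I n i)"
  have *: "(\<Sum>i=1..k. f_user I n i (x i)) =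
      (\<Sum>i=1..k. ?h i (x i) - ?h i (x (Suc i))) + ?h k (x (Suc k))" if "1 \<le> k" for k
    using that
  proof (induction k rule: dec_induct)
    case base
    then show ?case by (simp add: f_user_def hh_def)
  next
    case (step k)
    then show ?case by (simp add: f_user_def hh_def algebra_simps)
  qed
  have "A_carrier I n = - ?h (users I) 0"
    using noise_pos[OF dec_order_mem[of "users I"]] users_pos
    by (simp add: A_carrier_def hh_def log_divide)
  then show ?thesis using *[OF users_pos] assms by (simp add: sc_value_def)
qed

text \<open>Strict descents of \<open>x\<close> are exactly the nonempty pieces, stacked from the
  last decoding position upwards. The allocation ends at \<open>x 1\<close>; extending it to the
  full budget \<open>P\<close> is what turns equality into an inequality.\<close>

lemma sc_feasible_attain:
  assumes x: "x \<in> sc_feasible I P"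
  shows "\<exists>v\<ge>sc_value x. attain (hh I n) {1..users I} (min (mux I) (users I)) P v"
proof -
  let ?K = "users I" and ?h = "\<lambda>i. hh I n (dec_order I n i)"
  \<comment> \<open>Coordinates of \<open>x\<close> beyond the last user are arbitrary;
    \<open>x'\<close> installs the boundary value \<open>x_{K+1} = 0\<close>.\<close>
  define x' where "x' = x(Suc ?K := 0)"
  define D where "D i = {j\<in>{i..?K}. x' (Suc j) < x' j}" for i
  have P: "x' 1 \<le> P" and dec: "\<And>j. j \<in> {1..?K} \<Longrightarrow> x' (Suc j) \<le> x' j"
    using x users_pos by (auto simp: x'_def sc_feasible_def le_Suc_eq)
  have "D 1 = {i\<in>{1..?K}. x i > (if i = ?K then 0 else x (i + 1))}"
    unfolding D_def x'_def by auto
  then have card: "card (D 1) \<le> mux I" using x by (simp add: sc_feasible_def)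
  have cardK: "card (D 1) \<le> ?K"
    using card_mono[of "{1..?K}" "D 1"] unfolding D_def by force
  have val: "sc_value x = sc_value x'"
    by (auto simp: sc_value_def x'_def intro!: sum.cong)
  have "attain (hh I n) {1..?K} (card (D 1)) (x' 1) (\<Sum>j=1..?K. ?h j (x' j) - ?h j (x' (Suc j)))"
  proof (rule inc_induct[of 1 "Suc ?K" "\<lambda>i. attain (hh I n) {1..?K} (card (D i)) (x' i)
      (\<Sum>j=i..?K. ?h j (x' j) - ?h j (x' (Suc j)))"])
    show "attain (hh I n) {1..?K} (card (D (Suc ?K))) (x' (Suc ?K))
        (\<Sum>j=Suc ?K..?K. ?h j (x' j) - ?h j (x' (Suc j)))"
      by (simp add: x'_def attain.zero)
  next
    fix i assume i: "1 \<le> i" "i < Suc ?K"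
      and IH: "attain (hh I n) {1..?K} (card (D (Suc i))) (x' (Suc i))
        (\<Sum>j=Suc i..?K. ?h j (x' j) - ?h j (x' (Suc j)))"
    have iv: "{i..?K} = insert i {Suc i..?K}" using i by auto
    show "attain (hh I n) {1..?K} (card (D i)) (x' i) (\<Sum>j=i..?K. ?h j (x' j) - ?h j (x' (Suc j)))"
    proof (cases "x' (Suc i) < x' i")
      case True
      then have "D i = insert i (D (Suc i))" unfolding D_def iv by auto
      then have c: "card (D i) = Suc (card (D (Suc i)))" by (simp add: D_def)
      show ?thesis unfolding c iv
        using attain.piece[OF IH dec_order_mem[of i], of "x' i"] dec[of i] i by (simp add: algebra_simps)
    next
      case False
      then have eq: "x' i = x' (Suc i)" using dec[of i] i by auto
      then have "D i = D (Suc i)" unfolding D_def iv by auto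
      then show ?thesis unfolding iv using IH eq i by simp
    qed
  qed simp
  then have "attain (hh I n) {1..?K} (card (D 1)) (x' 1) (sc_value x)"
    unfolding val using sc_value_telescope[of x'] by (simp add: x'_def)
  then have "attain (hh I n) {1..?K} (min (mux I) ?K) (x' 1) (sc_value x)"
    by (rule attain_mono) (use card cardK in simp)
  from attain_extend[OF this P] show ?thesis
    using users_pos valid hh_mono by (auto simp: valid_noma_def)
qed

text \<open>Here the order constraint is recovered. The induction goes down to the first decoding
  position; among the users from position \<open>i\<close> on, the one at \<open>i\<close> has the
  largest noise, so \<open>attain_last_user\<close> either drops it, giving
  \<open>x i = x (i + 1)\<close>, or puts it on top, giving \<open>x i = P\<close>.\<close>

lemma attain_sc_feasible:
  assumes "attain (hh I n) {1..users I} m P v" "m \<le> mux I"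
  shows "\<exists>x\<in>sc_feasible I P. v \<le> sc_value x"
proof -
  let ?K = "users I" and ?h = "\<lambda>i. hh I n (dec_order I n i)" and ?\<pi> = "dec_order I n"
  have "\<forall>m P v. attain (hh I n) (?\<pi> ` {1..?K}) m P v \<longrightarrow>
     (\<exists>x. x 1 \<le> P \<and> x (Suc ?K) = 0 \<and> (\<forall>j\<in>{1..?K}. x (Suc j) \<le> x j) \<and>
        card {j\<in>{1..?K}. x (Suc j) < x j} \<le> m \<and>
        v \<le> (\<Sum>j=1..?K. ?h j (x j) - ?h j (x (Suc j))))"
  proof (rule inc_induct[of 1 "Suc ?K"], goal_cases)
    case 2
    show ?case
    proof (intro allI impI)
      fix m P v assume "attain (hh I n) (?\<pi> ` {Suc ?K..?K}) m P v"
      then have "P = 0" "v = 0" using attain_empty by auto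
      then show "\<exists>x. x (Suc ?K) \<le> P \<and> x (Suc ?K) = 0 \<and> (\<forall>j\<in>{Suc ?K..?K}. x (Suc j) \<le> x j) \<and>
        card {j\<in>{Suc ?K..?K}. x (Suc j) < x j} \<le> m \<and>
        v \<le> (\<Sum>j=Suc ?K..?K. ?h j (x j) - ?h j (x (Suc j)))"
        by (intro exI[of _ "\<lambda>_. 0"]) simp
    qed
  next
    case (3 i)
    show ?case
    proof (intro allI impI)
      fix m P v assume at: "attain (hh I n) (?\<pi> ` {i..?K}) m P v"
      have iv: "{i..?K} = insert i {Suc i..?K}" using 3 by auto
      have q: "quasiconcave (\<lambda>x. hh I n z x - hh I n (?\<pi> i) x)" if "z \<in> ?\<pi> ` {Suc i..?K}" for z
        using that 3 dec_order_mem[of i] by (auto intro!: hh_quasiconcave dec_order_mem dec_order_sorted)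
      from at have "attain (hh I n) (insert (?\<pi> i) (?\<pi> ` {Suc i..?K})) m P v" by (simp add: iv)
      from attain_last_user[OF this, OF q]
      have "(\<exists>v'\<ge>v. attain (hh I n) (?\<pi> ` {Suc i..?K}) m P v') \<or>
        (\<exists>m' y v'. m = Suc m' \<and> y \<le> P \<and> attain (hh I n) (?\<pi> ` {Suc i..?K}) m' y v' \<and>
           v \<le> v' + ?h i P - ?h i y)" by blast
      then show "\<exists>x. x i \<le> P \<and> x (Suc ?K) = 0 \<and> (\<forall>j\<in>{i..?K}. x (Suc j) \<le> x j) \<and>
        card {j\<in>{i..?K}. x (Suc j) < x j} \<le> m \<and>
        v \<le> (\<Sum>j=i..?K. ?h j (x j) - ?h j (x (Suc j)))"
      proof (elim disjE exE conjE)
        fix v' assume v': "v \<le> v'" "attain (hh I n) (?\<pi> ` {Suc i..?K}) m P v'"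
        from 3(3) v'(2) obtain x where x: "x (Suc i) \<le> P" "x (Suc ?K) = 0"
          "\<forall>j\<in>{Suc i..?K}. x (Suc j) \<le> x j" "card {j\<in>{Suc i..?K}. x (Suc j) < x j} \<le> m"
          "v' \<le> (\<Sum>j=Suc i..?K. ?h j (x j) - ?h j (x (Suc j)))" by blast
        let ?x = "x(i := x (Suc i))"
        have "{j\<in>{i..?K}. ?x (Suc j) < ?x j} = {j\<in>{Suc i..?K}. x (Suc j) < x j}" by (auto simp: iv)
        moreover have "(\<Sum>j=i..?K. ?h j (?x j) - ?h j (?x (Suc j))) =
          (\<Sum>j=Suc i..?K. ?h j (x j) - ?h j (x (Suc j)))"
          unfolding iv by (auto intro!: sum.cong)
        ultimately show ?thesis using x v' 3 by (intro exI[of _ ?x]) (auto simp: iv)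
      next
        fix m' y v' assume *: "m = Suc m'" "y \<le> P" "attain (hh I n) (?\<pi> ` {Suc i..?K}) m' y v'"
          "v \<le> v' + ?h i P - ?h i y"
        from 3(3) *(3) obtain x where x: "x (Suc i) \<le> y" "x (Suc ?K) = 0"
          "\<forall>j\<in>{Suc i..?K}. x (Suc j) \<le> x j" "card {j\<in>{Suc i..?K}. x (Suc j) < x j} \<le> m'"
          "v' \<le> (\<Sum>j=Suc i..?K. ?h j (x j) - ?h j (x (Suc j)))" by blast
        have "Suc i \<le> Suc ?K \<Longrightarrow> 0 \<le> x (Suc i)"
          by (rule inc_induct[of "Suc i" "Suc ?K"]) (use x in \<open>auto intro: order_trans\<close>)
        then have x0: "0 \<le> x (Suc i)" using 3 by simp
        let ?x = "x(i := P)"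
        have "{j\<in>{i..?K}. ?x (Suc j) < ?x j} \<subseteq> insert i {j\<in>{Suc i..?K}. x (Suc j) < x j}" by (auto simp: iv)
        from card_mono[OF _ this] have "card {j\<in>{i..?K}. ?x (Suc j) < ?x j} \<le> m"
          using x(4) *(1) by simp
        moreover have "(\<Sum>j=i..?K. ?h j (?x j) - ?h j (?x (Suc j))) =
          ?h i P - ?h i (x (Suc i)) + (\<Sum>j=Suc i..?K. ?h j (x j) - ?h j (x (Suc j)))"
          unfolding iv by (auto intro!: sum.cong)
        \<comment> \<open>The induction only yields \<open>x (Suc i) \<le> y\<close>. Any gap is
          added to the piece of the user at position \<open>i\<close>, which does not lose by
          monotonicity.\<close>
        moreover have "?h i (x (Suc i)) \<le> ?h i y"
          using x(1) x0 3 by (intro hh_mono dec_order_mem) auto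
        ultimately show ?thesis using x * 3 by (intro exI[of _ ?x]) (auto simp: iv)
      qed
    qed
  qed simp
  then obtain x where x: "x 1 \<le> P" "x (Suc ?K) = 0" "\<forall>j\<in>{1..?K}. x (Suc j) \<le> x j"
    "card {j\<in>{1..?K}. x (Suc j) < x j} \<le> m" "v \<le> (\<Sum>j=1..?K. ?h j (x j) - ?h j (x (Suc j)))"
    using assms(1) unfolding dec_order_image by blast
  have "{j\<in>{1..?K}. x (Suc j) < x j} = {j\<in>{1..?K}. x j > (if j = ?K then 0 else x (j + 1))}"
    using x(2) by auto
  then have "x \<in> sc_feasible I P" using x assms(2) users_pos
    by (auto simp: sc_feasible_def dest: bspec[of _ _ ?K])
  moreover have "v \<le> sc_value x" using x(5) sc_value_telescope[of x, OF x(2)] by simp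
  ultimately show ?thesis by blast
qed

text \<open>The interface to the algorithm: by the two preceding exchanges the optimum of the
  carrier is a maximum over allocations in which the decoding order no longer occurs.\<close>

lemma F_opt_eqI:
  assumes "attain (hh I n) {1..users I} (min (mux I) (users I)) P r"
    and "\<And>v. attain (hh I n) {1..users I} (min (mux I) (users I)) P v \<Longrightarrow> v \<le> r"
  shows "F_opt I n P = r"
proof -
  have le: "sc_value x \<le> r" if "x \<in> sc_feasible I P" for x
    using sc_feasible_attain[OF that] assms(2) order_trans by blast
  obtain x where x: "x \<in> sc_feasible I P" "r \<le> sc_value x"
    using attain_sc_feasible[OF assms(1)] by auto
  have r: "r \<in> sc_value ` sc_feasible I P" by (rule image_eqI[of _ _ x]) (use x le[of x] in simp_all)
  have "Sup (sc_value ` sc_feasible I P) = r"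
    by (rule cSup_eq_maximum[OF r]) (use le in blast)
  then show ?thesis by (simp add: F_opt_def sc_value_def)
qed

lemma F_opt_0: "F_opt I n 0 = 0"
  by (rule F_opt_eqI) (auto intro: attain.zero dest: attain_0D)

text \<open>A crude bound, each piece being charged to all users at once. It supplies the
  boundedness without which the suprema in \<open>F_opt_mono\<close> could not be compared.\<close>

lemma attain_bounded:
  assumes "attain (hh I n) {1..users I} m P v"
  shows "v \<le> (\<Sum>k\<in>{1..users I}. hh I n k P - hh I n k 0)"
  using assms
proof (induction rule: attain.induct)
  case (piece m y v u P)
  have y: "0 \<le> y" using piece.hyps(1) by (rule attain_nonneg)
  have "hh I n u P - hh I n u y \<le> (\<Sum>k\<in>{1..users I}. hh I n k P - hh I n k y)"
    using y piece.hyps by (intro member_le_sum) (auto intro!: hh_mono)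
  then show ?case using piece.IH by (simp add: sum_subtractf)
qed simp

lemma F_opt_mono:
  assumes "0 \<le> P" "P \<le> P'"
  shows "F_opt I n P \<le> F_opt I n P'"
proof -
  have "(\<lambda>_. 0) \<in> sc_feasible I P" using assms by (simp add: sc_feasible_def)
  moreover have "sc_feasible I P \<subseteq> sc_feasible I P'" using assms by (auto simp: sc_feasible_def)
  moreover have "bdd_above (sc_value ` sc_feasible I P')"
    unfolding bdd_above_def using sc_feasible_attain attain_bounded order_trans by blast
  ultimately have "Sup (sc_value ` sc_feasible I P) \<le> Sup (sc_value ` sc_feasible I P')"
    by (intro cSup_subset_mono) auto
  then show ?thesis by (simp add: F_opt_def sc_value_def)
qed

end

section \<open>The knapsack dynamic program\<close>

text \<open>In the table, every unit of the budget \<open>j\<close> that is left over costs \<open>z\<close>. With \<open>z = 0\<close> the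
  choices need not exhaust the budget (exact algorithm); with \<open>z = J + 1\<close> an entry that is at
  least \<open>-J\<close> certifies that they do (scaled algorithm, where \<open>j\<close> counts profit units and \<open>c\<close> is
  the negated number of power levels).\<close>

definition dp_row :: "(nat \<Rightarrow> nat) \<Rightarrow> (nat \<Rightarrow> nat \<Rightarrow> real) \<Rightarrow> nat \<Rightarrow>
    (nat \<Rightarrow> nat \<Rightarrow> real) \<Rightarrow> (nat \<Rightarrow> nat \<Rightarrow> nat) \<Rightarrow> nat \<Rightarrow> nat \<Rightarrow> bool" where
  "dp_row L c H D ch n j \<longleftrightarrow> ch n j \<le> j \<and> ch n j \<le> L n \<and>
     D n j = D (n - 1) (j - ch n j) + c n (ch n j) \<and>
     (\<forall>a\<le>H. a \<le> j \<and> a \<le> L n \<longrightarrow> D (n - 1) (j - a) + c n a \<le> D n j)"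

definition dp_table :: "nat \<Rightarrow> nat \<Rightarrow> (nat \<Rightarrow> nat) \<Rightarrow> nat \<Rightarrow> (nat \<Rightarrow> nat \<Rightarrow> real) \<Rightarrow>
    (nat \<Rightarrow> nat \<Rightarrow> real) \<Rightarrow> (nat \<Rightarrow> nat \<Rightarrow> nat) \<Rightarrow> bool" where
  "dp_table N T L z c D ch \<longleftrightarrow> (\<forall>j\<le>T. D 0 j = - (real z * real j)) \<and>
     (\<forall>n\<in>{1..N}. \<forall>j\<le>T. dp_row L c T D ch n j)"

text \<open>Any admissible choice \<open>a\<close> is among the candidates compared in every row, so
  the table dominates it after the charge \<open>z\<close> for each budget unit left over.\<close>

lemma dp_upper:
  assumes "dp_table N T L z c D ch" "\<And>i. i \<in> {1..N} \<Longrightarrow> a i \<le> L i"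
  shows "n \<le> N \<Longrightarrow> (\<Sum>i=1..n. a i) \<le> j \<Longrightarrow> j \<le> T \<Longrightarrow>
    (\<Sum>i=1..n. c i (a i)) - real z * (real j - real (\<Sum>i=1..n. a i)) \<le> D n j"
proof (induction n arbitrary: j)
  case 0
  then show ?case using assms(1) by (simp add: dp_table_def)
next
  case (Suc n)
  have "dp_row L c T D ch (Suc n) j" using assms(1) Suc.prems by (simp add: dp_table_def)
  then have "a (Suc n) \<le> T \<and> a (Suc n) \<le> j \<and> a (Suc n) \<le> L (Suc n) \<longrightarrow>
      D n (j - a (Suc n)) + c (Suc n) (a (Suc n)) \<le> D (Suc n) j"
    unfolding dp_row_def by auto
  then have "D n (j - a (Suc n)) + c (Suc n) (a (Suc n)) \<le> D (Suc n) j"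
    using assms(2)[of "Suc n"] Suc.prems by simp
  moreover have "(\<Sum>i=1..n. c i (a i)) - real z * (real (j - a (Suc n)) - real (\<Sum>i=1..n. a i)) \<le> D n (j - a (Suc n))"
    using Suc.prems by (intro Suc.IH) auto
  moreover have "real (j - a (Suc n)) = real j - real (a (Suc n))" using Suc.prems by (simp add: of_nat_diff)
  ultimately show ?case by (simp add: algebra_simps)
qed

locale knapsack =
  fixes N J :: nat and cap :: "nat \<Rightarrow> nat" and u :: "nat \<Rightarrow> nat \<Rightarrow> real"
  assumes N: "1 \<le> N"
    and cap: "\<And>n. n \<in> {1..N} \<Longrightarrow> cap n \<le> J"
    and mono: "\<And>n l l'. n \<in> {1..N} \<Longrightarrow> l \<le> l' \<Longrightarrow> l' \<le> cap n \<Longrightarrow> u n l \<le> u n l'"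
    and zero: "\<And>n. n \<in> {1..N} \<Longrightarrow> u n 0 = 0"
begin

definition feas :: "(nat \<Rightarrow> nat) \<Rightarrow> bool" where
  "feas l \<longleftrightarrow> (\<forall>n\<in>{1..N}. l n \<le> cap n) \<and> (\<Sum>n=1..N. l n) \<le> J"

definition val :: "(nat \<Rightarrow> nat) \<Rightarrow> real" where
  "val l = (\<Sum>n=1..N. u n (l n))"

lemma u_nonneg: "n \<in> {1..N} \<Longrightarrow> l \<le> cap n \<Longrightarrow> 0 \<le> u n l"
  using mono[of n 0 l] zero[of n] by simp

lemma val_nonneg: "feas l \<Longrightarrow> 0 \<le> val l"
  unfolding val_def feas_def by (intro sum_nonneg u_nonneg) auto

text \<open>Since no cap exceeds \<open>J\<close>, one carrier may take its whole cap. So the best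
  single-carrier value \<open>U\<close> bounds the optimum from below, and \<open>val_le\<close>
  bounds it by \<open>N U\<close> from above: the range over which guesses have to be tried.\<close>

lemma feas_single: "n \<in> {1..N} \<Longrightarrow> feas (\<lambda>i. if i = n then cap n else 0) \<and>
    val (\<lambda>i. if i = n then cap n else 0) = u n (cap n)"
proof
  assume n: "n \<in> {1..N}"
  show "feas (\<lambda>i. if i = n then cap n else 0)"
    using n cap[OF n] by (simp add: feas_def)
  have "val (\<lambda>i. if i = n then cap n else 0) = (\<Sum>i=1..N. if i = n then u n (cap n) else 0)"
    unfolding val_def using zero by (intro sum.cong) auto
  then show "val (\<lambda>i. if i = n then cap n else 0) = u n (cap n)" using n by simp
qed

lemma val_le:
  assumes "feas l" "\<And>n. n \<in> {1..N} \<Longrightarrow> u n (cap n) \<le> U"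
  shows "val l \<le> real N * U"
proof -
  have "u n (l n) \<le> U" if "n \<in> {1..N}" for n
    using assms(1) mono[OF that, of "l n" "cap n"] assms(2)[OF that] that by (simp add: feas_def)
  then have "val l \<le> (\<Sum>n=1..N. U)" unfolding val_def by (rule sum_mono)
  then show ?thesis by simp
qed

lemma exact_dp:
  assumes "dp_table N J cap 0 u D ch" "feas l"
  shows "val l \<le> D N J"
  using dp_upper[OF assms(1), of l N J] assms(2) by (simp add: feas_def val_def)

text \<open>A single leftover unit would already cost more than the \<open>J\<close> that the entry
  can afford, so \<open>r = 0\<close>; the entry is then minus the total number of power levels,
  which is therefore at most \<open>J\<close>.\<close>

lemma scaled_dp_feasible:
  fixes g :: real
  assumes "D N j = - (real (Suc J) * real r) + (\<Sum>n=1..N. - real (wt n (a n)))" "- real J \<le> D N j"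
    "(\<Sum>n=1..N. a n) + r = j" "0 \<le> g"
    and "\<And>n. n \<in> {1..N} \<Longrightarrow> wt n (a n) \<le> cap n \<and> real (a n) * g \<le> u n (wt n (a n))"
  shows "feas (\<lambda>n. wt n (a n)) \<and> real j * g \<le> val (\<lambda>n. wt n (a n))"
proof -
  have "0 \<le> (\<Sum>n=1..N. real (wt n (a n)))" by (simp add: sum_nonneg)
  then have *: "real (Suc J) * real r + (\<Sum>n=1..N. real (wt n (a n))) \<le> real J"
    using assms(1,2) by (simp add: sum_negf)
  have r: "r = 0"
  proof (rule ccontr)
    assume "r \<noteq> 0"
    then have "real (Suc J) * 1 \<le> real (Suc J) * real r" by (intro mult_left_mono) auto
    moreover have "real (Suc J) * real r \<le> real J"
      using * \<open>0 \<le> (\<Sum>n=1..N. real (wt n (a n)))\<close> by linarith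
    ultimately have "real (Suc J) * 1 \<le> real J" by (rule order_trans)
    then show False by simp
  qed
  then have "real (\<Sum>n=1..N. wt n (a n)) \<le> real J" using * by simp
  then have "feas (\<lambda>n. wt n (a n))" using assms(5) unfolding feas_def of_nat_le_iff by blast
  moreover have "real j * g = (\<Sum>n=1..N. real (a n) * g)"
    using assms(3) r by (simp add: sum_distrib_right[symmetric] flip: of_nat_sum)
  then have "real j * g \<le> val (\<lambda>n. wt n (a n))"
    unfolding val_def using assms(5) by (simp, intro sum_mono) auto
  ultimately show ?thesis by blast
qed

text \<open>Rounding the profits of \<open>l\<close> down to multiples of \<open>g\<close> loses at
  most \<open>g\<close> per carrier. The rounded choice passes the test against \<open>- J\<close>,
  so the largest passing index \<open>j\<close> is at least its number of profit units.\<close>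

lemma scaled_dp_good:
  fixes g :: real
  assumes dp: "dp_table N T L (Suc J) (\<lambda>n a. - real (wt n a)) D ch"
    and g: "0 < g" and T: "val l \<le> real T * g" and l: "feas l"
    and L: "\<And>n. n \<in> {1..N} \<Longrightarrow> u n (cap n) < real (Suc (L n)) * g"
    and wt: "\<And>n a k. n \<in> {1..N} \<Longrightarrow> a \<le> L n \<Longrightarrow> k \<le> cap n \<Longrightarrow> real a * g \<le> u n k \<Longrightarrow> wt n a \<le> k"
    and j: "j \<le> T" "\<And>i. j < i \<Longrightarrow> i \<le> T \<Longrightarrow> D N i < - real J"
  shows "val l - real N * g \<le> real j * g"
proof -
  define a where "a n = nat \<lfloor>u n (l n) / g\<rfloor>" for n
  have ln: "l n \<le> cap n" if "n \<in> {1..N}" for n using l that by (simp add: feas_def)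
  have un: "0 \<le> u n (l n)" if "n \<in> {1..N}" for n using u_nonneg[OF that ln[OF that]] .
  have a: "real (a n) * g \<le> u n (l n) \<and> u n (l n) < (real (a n) + 1) * g" if n: "n \<in> {1..N}" for n
  proof -
    have q: "real (a n) = of_int \<lfloor>u n (l n) / g\<rfloor>"
      using un[OF n] g by (simp add: a_def)
    have "real (a n) \<le> u n (l n) / g" "u n (l n) / g < real (a n) + 1"
      unfolding q by linarith+
    then show ?thesis using g by (simp add: field_simps)
  qed
  have aL: "a n \<le> L n" if n: "n \<in> {1..N}" for n
  proof -
    have "real (a n) * g < real (Suc (L n)) * g"
      using a[OF n] L[OF n] mono[OF n ln[OF n] order_refl] by linarith
    then show ?thesis using g by simp
  qed
  let ?S = "\<Sum>n=1..N. a n"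
  have "real ?S * g = (\<Sum>n=1..N. real (a n) * g)" by (simp add: sum_distrib_right)
  also have "\<dots> \<le> val l" unfolding val_def using a by (intro sum_mono) auto
  also have "\<dots> \<le> real T * g" by (rule T)
  finally have "real ?S \<le> real T" using g by (simp del: of_nat_sum)
  then have ST: "?S \<le> T" by (simp only: of_nat_le_iff)
  \<comment> \<open>\<open>wt n (a n)\<close> is a least level count reaching \<open>a n\<close>
    profit units, and \<open>l n\<close> levels reach them as well.\<close>
  have "(\<Sum>n=1..N. real (wt n (a n))) \<le> (\<Sum>n=1..N. real (l n))"
    using wt[OF _ aL ln] a by (intro sum_mono) auto
  also have "\<dots> \<le> real J" using l by (simp add: feas_def flip: of_nat_sum)
  finally have "- real J \<le> (\<Sum>n=1..N. - real (wt n (a n)))" by (simp add: sum_negf)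
  also have "\<dots> \<le> D N ?S" using dp_upper[OF dp aL, of N ?S] ST by simp
  finally have "?S \<le> j" using j(2)[of ?S] ST by (meson not_le)
  then have "real ?S * g \<le> real j * g" using g by (intro mult_right_mono) (simp_all only: of_nat_le_iff less_imp_le)
  moreover have "val l \<le> (\<Sum>n=1..N. (real (a n) + 1) * g)"
    unfolding val_def using a by (intro sum_mono) (auto intro: less_imp_le)
  then have "val l \<le> real ?S * g + real N * g"
    by (simp add: sum.distrib distrib_right sum_distrib_right)
  ultimately show ?thesis by linarith
qed

end

section \<open>Cost calculus for programs\<close>

fun nmods :: "com \<Rightarrow> vname set" where
  "nmods CSkip = {}"
| "nmods (NAssign x es e) = {x}"
| "nmods (RAssign x es e) = {}"
| "nmods (CSeq c1 c2) = nmods c1 \<union> nmods c2"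
| "nmods (CIf b c1 c2) = nmods c1 \<union> nmods c2"
| "nmods (CWhile b c) = nmods c"

fun rmods :: "com \<Rightarrow> vname set" where
  "rmods CSkip = {}"
| "rmods (NAssign x es e) = {}"
| "rmods (RAssign x es e) = {x}"
| "rmods (CSeq c1 c2) = rmods c1 \<union> rmods c2"
| "rmods (CIf b c1 c2) = rmods c1 \<union> rmods c2"
| "rmods (CWhile b c) = rmods c"

definition unch :: "vname set \<Rightarrow> vname set \<Rightarrow> state \<Rightarrow> state \<Rightarrow> bool" where
  "unch X Y s s' \<longleftrightarrow> (\<forall>x. x \<notin> X \<longrightarrow> nats s' x = nats s x) \<and> (\<forall>x. x \<notin> Y \<longrightarrow> reals s' x = reals s x)"

lemma nats_nupdate [simp]: "nats (nupdate s x is v) = (nats s)(x := (nats s x)(is := v))"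
  and reals_nupdate [simp]: "reals (nupdate s x is v) = reals s"
  and nats_rupdate [simp]: "nats (rupdate s x is w) = nats s"
  and reals_rupdate [simp]: "reals (rupdate s x is w) = (reals s)(x := (reals s x)(is := w))"
  by (simp_all add: nupdate_def rupdate_def)

lemma unch_refl [simp]: "unch X Y s s"
  by (simp add: unch_def)

lemma unch_trans: "unch X Y s s' \<Longrightarrow> unch X' Y' s' s'' \<Longrightarrow> X \<subseteq> Z \<Longrightarrow> X' \<subseteq> Z \<Longrightarrow> Y \<subseteq> Z' \<Longrightarrow> Y' \<subseteq> Z' \<Longrightarrow> unch Z Z' s s''"
  unfolding unch_def by (metis subsetD)

lemma unch_mono: "unch X Y s s' \<Longrightarrow> X \<subseteq> Z \<Longrightarrow> Y \<subseteq> Z' \<Longrightarrow> unch Z Z' s s'"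
  unfolding unch_def by blast

lemma exec_unch: "exec c s t s' \<Longrightarrow> unch (nmods c) (rmods c) s s'"
proof (induction rule: exec.induct)
  case (Seq c1 s t1 s1 c2 t2 s2)
  show ?case by (rule unch_trans[OF Seq.IH]) auto
next
  case (IfTrue s b c1 t s' c2)
  show ?case by (rule unch_mono[OF IfTrue.IH]) auto
next
  case (IfFalse s b c2 t s' c1)
  show ?case by (rule unch_mono[OF IfFalse.IH]) auto
next
  case (WhileTrue s b c t1 s1 t2 s2)
  show ?case by (rule unch_trans[OF WhileTrue.IH]) auto
qed (simp_all add: unch_def)

text \<open>A weakest precondition for total correctness with a time budget. As a predicate on the
  start state it can itself serve as the postcondition of a preceding command.\<close>

definition run :: "com \<Rightarrow> real \<Rightarrow> (state \<Rightarrow> bool) \<Rightarrow> state \<Rightarrow> bool" where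
  "run c B Q s \<longleftrightarrow> (\<exists>t s'. exec c s t s' \<and> real t \<le> B \<and> Q s')"

lemma runI: "exec c s t s' \<Longrightarrow> real t \<le> B \<Longrightarrow> Q s' \<Longrightarrow> run c B Q s"
  unfolding run_def by blast

lemma runE:
  assumes "run c B Q s"
  obtains t s' where "exec c s t s'" "real t \<le> B" "Q s'"
  using assms unfolding run_def by blast

lemma run_conseq:
  assumes "run c B Q s" "B \<le> B'"
    "\<And>s'. unch (nmods c) (rmods c) s s' \<Longrightarrow> Q s' \<Longrightarrow> Q' s'"
  shows "run c B' Q' s"
proof -
  obtain t s' where e: "exec c s t s'" "real t \<le> B" "Q s'" using assms(1) by (rule runE)
  show ?thesis by (rule runI[OF e(1)]) (use e assms(2,3) exec_unch[OF e(1)] in auto)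
qed

lemma run_Skip [simp]: "run CSkip B Q s \<longleftrightarrow> 1 \<le> B \<and> Q s"
  by (auto intro: runI exec.Skip elim!: runE exec_SkipE)

lemma run_NAssign [simp]: "run (NAssign x es e) B Q s \<longleftrightarrow>
    real (1 + sum_list (map ncost es) + ncost e) \<le> B \<and> Q (nupdate s x (map (nval s) es) (nval s e))"
  by (auto intro: runI exec.NAssign elim!: runE exec_NAssignE)

lemma run_RAssign [simp]: "run (RAssign x es e) B Q s \<longleftrightarrow>
    real (1 + sum_list (map ncost es) + rcost e) \<le> B \<and> Q (rupdate s x (map (nval s) es) (rval s e))"
  by (auto intro: runI exec.RAssign elim!: runE exec_RAssignE)

lemma run_SeqI:
  assumes "run c1 B1 (run c2 B2 Q) s" "B1 + B2 \<le> B"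
  shows "run (CSeq c1 c2) B Q s"
proof -
  obtain t1 s1 where 1: "exec c1 s t1 s1" "real t1 \<le> B1" "run c2 B2 Q s1"
    using assms(1) by (rule runE)
  obtain t2 s2 where 2: "exec c2 s1 t2 s2" "real t2 \<le> B2" "Q s2" using 1(3) by (rule runE)
  show ?thesis by (rule runI[OF exec.Seq[OF 1(1) 2(1)]]) (use 1 2 assms(2) in auto)
qed

text \<open>Being an equivalence, this executes straight-line code by rewriting, with the cost of
  each assignment deducted from the remaining budget.\<close>

lemma run_Seq_NAssign [simp]: "run (CSeq (NAssign x es e) c) B Q s \<longleftrightarrow>
    run c (B - real (1 + sum_list (map ncost es) + ncost e)) Q (nupdate s x (map (nval s) es) (nval s e))"
  (is "?L \<longleftrightarrow> ?R")
proof
  assume ?L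
  then obtain t s' where e: "exec (CSeq (NAssign x es e) c) s t s'" "real t \<le> B" "Q s'"
    by (rule runE)
  from e(1) show ?R
  proof (rule exec_SeqE)
    fix t1 s1 t2 assume *: "t = t1 + t2" "exec (NAssign x es e) s t1 s1" "exec c s1 t2 s'"
    from *(2) have "t1 = 1 + sum_list (map ncost es) + ncost e"
      "s1 = nupdate s x (map (nval s) es) (nval s e)" by (auto elim: exec_NAssignE)
    then show ?R using * e by (intro runI[of c _ t2 s']) auto
  qed
next
  assume ?R
  then obtain t s' where e: "exec c (nupdate s x (map (nval s) es) (nval s e)) t s'"
    "real t \<le> B - real (1 + sum_list (map ncost es) + ncost e)" "Q s'" by (rule runE)
  show ?L by (rule runI[OF exec.Seq[OF exec.NAssign e(1)]]) (use e in auto)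
qed

lemma run_Seq_RAssign [simp]: "run (CSeq (RAssign x es e) c) B Q s \<longleftrightarrow>
    run c (B - real (1 + sum_list (map ncost es) + rcost e)) Q (rupdate s x (map (nval s) es) (rval s e))"
  (is "?L \<longleftrightarrow> ?R")
proof
  assume ?L
  then obtain t s' where e: "exec (CSeq (RAssign x es e) c) s t s'" "real t \<le> B" "Q s'"
    by (rule runE)
  from e(1) show ?R
  proof (rule exec_SeqE)
    fix t1 s1 t2 assume *: "t = t1 + t2" "exec (RAssign x es e) s t1 s1" "exec c s1 t2 s'"
    from *(2) have "t1 = 1 + sum_list (map ncost es) + rcost e"
      "s1 = rupdate s x (map (nval s) es) (rval s e)" by (auto elim: exec_RAssignE)
    then show ?R using * e by (intro runI[of c _ t2 s']) auto
  qed
next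
  assume ?R
  then obtain t s' where e: "exec c (rupdate s x (map (nval s) es) (rval s e)) t s'"
    "real t \<le> B - real (1 + sum_list (map ncost es) + rcost e)" "Q s'" by (rule runE)
  show ?L by (rule runI[OF exec.Seq[OF exec.RAssign e(1)]]) (use e in auto)
qed

lemma run_If [simp]: "run (CIf b c1 c2) B Q s \<longleftrightarrow>
    (if bval s b then run c1 (B - real (1 + bcost b)) Q s else run c2 (B - real (1 + bcost b)) Q s)"
  (is "?L \<longleftrightarrow> ?R")
proof
  assume ?L
  then obtain t s' where e: "exec (CIf b c1 c2) s t s'" "real t \<le> B" "Q s'"
    by (rule runE)
  from e(1) show ?R
  proof (rule exec_IfE)
    fix u assume "t = Suc (bcost b + u)" "bval s b" "exec c1 s u s'"
    then show ?R using e by (auto intro!: runI[of c1 s u s'])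
  next
    fix u assume "t = Suc (bcost b + u)" "\<not> bval s b" "exec c2 s u s'"
    then show ?R using e by (auto intro!: runI[of c2 s u s'])
  qed
next
  assume R: ?R
  show ?L
  proof (cases "bval s b")
    case True
    with R obtain t s' where e: "exec c1 s t s'" "real t \<le> B - real (1 + bcost b)" "Q s'"
      by (auto elim: runE)
    show ?thesis by (rule runI[OF exec.IfTrue[OF True e(1)]]) (use e in auto)
  next
    case False
    with R obtain t s' where e: "exec c2 s t s'" "real t \<le> B - real (1 + bcost b)" "Q s'"
      by (auto elim: runE)
    show ?thesis by (rule runI[OF exec.IfFalse[OF False e(1)]]) (use e in auto)
  qed
qed

text \<open>One potential does both jobs: it pays for all remaining iterations, and since each of
  them consumes at least 1, its floor proves termination. The cost of the body may differ from one
  iteration to the next, which the geometric series of the doubling loop exploits.\<close>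

lemma run_While:
  fixes \<phi> :: "state \<Rightarrow> real"
  assumes init: "Inv s0" "\<phi> s0 \<le> B"
    and cost: "\<And>s. Inv s \<Longrightarrow> 1 + real (bcost b) \<le> \<phi> s"
    and step: "\<And>s. Inv s \<Longrightarrow> unch (nmods c) (rmods c) s0 s \<Longrightarrow> bval s b \<Longrightarrow>
      \<exists>B. run c B (\<lambda>s'. Inv s' \<and> 1 + real (bcost b) + B + \<phi> s' \<le> \<phi> s) s"
  shows "run (CWhile b c) B (\<lambda>s. Inv s \<and> \<not> bval s b) s0"
proof -
  have "Inv s \<Longrightarrow> unch (nmods c) (rmods c) s0 s \<Longrightarrow> nat \<lfloor>\<phi> s\<rfloor> = k \<Longrightarrow>
      run (CWhile b c) (\<phi> s) (\<lambda>s. Inv s \<and> \<not> bval s b) s" for s k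
  proof (induction k arbitrary: s rule: less_induct)
    case (less k)
    show ?case
    proof (cases "bval s b")
      case False
      have "exec (CWhile b c) s (1 + bcost b) s" by (rule exec.WhileFalse[OF False])
      then show ?thesis unfolding run_def using cost[OF less.prems(1)] less.prems(1) False
        by (intro exI[of _ "1 + bcost b"] exI[of _ s]) simp
    next
      case True
      obtain B' where "run c B' (\<lambda>s'. Inv s' \<and> 1 + real (bcost b) + B' + \<phi> s' \<le> \<phi> s) s"
        using step[OF less.prems(1,2) True] by blast
      then obtain t s' where e: "exec c s t s'" "real t \<le> B'" "Inv s'"
        "1 + real (bcost b) + B' + \<phi> s' \<le> \<phi> s"
        unfolding run_def by blast
      have u: "unch (nmods c) (rmods c) s0 s'"
        using unch_trans[OF less.prems(2) exec_unch[OF e(1)]] by simp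
      have p: "0 \<le> \<phi> s'" using cost[OF e(3)] by linarith
      have "\<phi> s' + 1 \<le> \<phi> s" using e(2,4) by linarith
      then have "nat \<lfloor>\<phi> s'\<rfloor> < k" using less.prems(3) p by linarith
      from less.IH[OF this e(3) u refl] obtain t2 s2 where
        e2: "exec (CWhile b c) s' t2 s2" "real t2 \<le> \<phi> s'" "Inv s2 \<and> \<not> bval s2 b"
        unfolding run_def by blast
      have "exec (CWhile b c) s (1 + bcost b + t + t2) s2"
        by (rule exec.WhileTrue[OF True e(1) e2(1)])
      moreover have "real (1 + bcost b + t + t2) \<le> \<phi> s" using e e2 by simp
      ultimately show ?thesis unfolding run_def using e2(3) by blast
    qed
  qed
  then have "run (CWhile b c) (\<phi> s0) (\<lambda>s. Inv s \<and> \<not> bval s b) s0" using init by simp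
  then show ?thesis by (rule run_conseq) (use init in auto)
qed

section \<open>Counting loops\<close>

abbreviation nv :: "vname \<Rightarrow> nexp" where "nv x \<equiv> NVar x []"
abbreviation rv :: "vname \<Rightarrow> rexp" where "rv x \<equiv> RVar x []"
abbreviation inc :: "vname \<Rightarrow> com" where "inc x \<equiv> NAssign x [] (NAdd (nv x) (NConst 1))"
abbreviation dec :: "vname \<Rightarrow> com" where "dec x \<equiv> NAssign x [] (NSub (nv x) (NConst 1))"

text \<open>The bound \<open>hi\<close> is excluded and is evaluated anew at every test, so
  inclusive loops are written with a successor and each iteration pays for the evaluation.\<close>

definition FOR :: "vname \<Rightarrow> nat \<Rightarrow> nexp \<Rightarrow> com \<Rightarrow> com" where
  "FOR i l hi c = CSeq (NAssign i [] (NConst l)) (CWhile (NLess (nv i) hi) (CSeq c (inc i)))"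

definition DOWN :: "vname \<Rightarrow> nexp \<Rightarrow> com \<Rightarrow> com" where
  "DOWN i hi c = CSeq (NAssign i [] hi) (CWhile (NLess (NConst 0) (nv i)) (CSeq c (dec i)))"

lemma mods_FOR [simp]: "nmods (FOR i l hi c) = insert i (nmods c)" "rmods (FOR i l hi c) = rmods c"
  by (auto simp: FOR_def)

lemma mods_DOWN [simp]: "nmods (DOWN i hi c) = insert i (nmods c)" "rmods (DOWN i hi c) = rmods c"
  by (auto simp: DOWN_def)

text \<open>\<open>P k\<close> describes the state when all indices below \<open>k\<close> are done.
  It has to ignore the counter cell (\<open>upd\<close>), since the counter is advanced after the
  body has established \<open>P (Suc k)\<close>.\<close>

lemma run_FOR:
  assumes init: "P l s0"
    and upd: "\<And>k s v. P k s \<Longrightarrow> P k (nupdate s i [] v)"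
    and hi: "\<And>s. unch (insert i (nmods c)) (rmods c) s0 s \<Longrightarrow> nval s hi = h"
    and i: "i \<notin> nmods c"
    and lh: "l \<le> h" and B: "0 \<le> B"
    and body: "\<And>k s. l \<le> k \<Longrightarrow> k < h \<Longrightarrow> nats s i [] = k \<Longrightarrow>
      unch (insert i (nmods c)) (rmods c) s0 s \<Longrightarrow> P k s \<Longrightarrow> run c B (P (Suc k)) s"
    and C: "(real h - real l) * (B + 7 + ncost hi) + 5 + ncost hi \<le> C"
  shows "run (FOR i l hi c) C (P h) s0"
proof -
  let ?c = "CSeq c (inc i)"
  let ?b = "NLess (nv i) hi"
  let ?s = "nupdate s0 i [] l"
  \<comment> \<open>Besides the body, an iteration costs \<open>3 + ncost hi\<close> for the test
    and 4 for the increment. Outside of it, initialisation costs 2 and the last, failing test again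
    \<open>3 + ncost hi\<close>.\<close>
  define D where "D = B + 7 + ncost hi"
  define \<phi> :: "state \<Rightarrow> real" where "\<phi> s = (real h - real (nats s i [])) * D + 3 + ncost hi" for s
  define Inv :: "state \<Rightarrow> bool" where "Inv s \<longleftrightarrow> unch (insert i (nmods c)) (rmods c) s0 s \<and> nats s i [] \<le> h \<and>
     l \<le> nats s i [] \<and> P (nats s i []) s" for s
  have D: "D \<ge> 0" using B by (simp add: D_def)
  have "run (CWhile ?b ?c) (C - 2) (\<lambda>s. Inv s \<and> \<not> bval s ?b) ?s"
  proof (rule run_While[where \<phi> = \<phi>])
    show "Inv ?s" using upd[OF init(1)] lh by (simp add: Inv_def unch_def)
    show "\<phi> ?s \<le> C - 2" using C by (simp add: \<phi>_def D_def)
  next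
    fix s assume "Inv s"
    then have "0 \<le> (real h - real (nats s i [])) * D" using D by (simp add: Inv_def)
    then show "1 + real (bcost ?b) \<le> \<phi> s" by (simp add: \<phi>_def)
  next
    fix s assume I: "Inv s" and b: "bval s ?b"
    let ?k = "nats s i []"
    have u: "unch (insert i (nmods c)) (rmods c) s0 s" using I by (simp add: Inv_def)
    have k: "?k < h" using b hi[OF u] by simp
    have "run c B (P (Suc ?k)) s"
      using body[OF _ k refl u] I by (simp add: Inv_def)
    then have "run c B (\<lambda>s'. run (inc i) 4 (\<lambda>s'. Inv s' \<and> 1 + real (bcost ?b) + (B + 4) + \<phi> s' \<le> \<phi> s) s') s"
    proof (rule run_conseq)
      fix s' assume u': "unch (nmods c) (rmods c) s s'" and P: "P (Suc ?k) s'"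
      have ik: "nats s' i [] = ?k" using u' i by (simp add: unch_def)
      have u2: "unch (insert i (nmods c)) (rmods c) s0 s'"
        by (rule unch_trans[OF u u']) auto
      then have u3: "unch (insert i (nmods c)) (rmods c) s0 (nupdate s' i [] (Suc ?k))"
        by (simp add: unch_def)
      have "real h - (1 + real ?k) = (real h - real ?k) - 1" by simp
      then have "(real h - (1 + real ?k)) * D = (real h - real ?k) * D - D" by (simp add: algebra_simps)
      then show "run (inc i) 4 (\<lambda>s'. Inv s' \<and> 1 + real (bcost ?b) + (B + 4) + \<phi> s' \<le> \<phi> s) s'"
        using k upd[OF P] u3 I by (simp add: ik Inv_def \<phi>_def) (simp add: D_def)
    qed simp
    then show "\<exists>B. run ?c B (\<lambda>s'. Inv s' \<and> 1 + real (bcost ?b) + B + \<phi> s' \<le> \<phi> s) s"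
      by (intro exI[of _ "B + 4"], elim run_SeqI) simp
  qed
  then have "run (CWhile ?b ?c) (C - 2) (P h) ?s"
  proof (rule run_conseq)
    fix s' assume *: "Inv s' \<and> \<not> bval s' ?b"
    then have "nats s' i [] = h" using hi[of s'] by (simp add: Inv_def)
    then show "P h s'" using * by (auto simp: Inv_def)
  qed simp
  then show ?thesis unfolding FOR_def run_Seq_NAssign by simp
qed

text \<open>\<open>P k\<close> describes the state in which the indices \<open>1..k\<close> are
  still to be processed; the body for index \<open>Suc k\<close> leads from \<open>P (Suc k)\<close>
  to \<open>P k\<close>.\<close>

lemma run_DOWN:
  assumes hi: "nval s0 hi = h" and init: "P h s0"
    and upd: "\<And>k s v. P k s \<Longrightarrow> P k (nupdate s i [] v)"
    and i: "i \<notin> nmods c" and B: "0 \<le> B"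
    and body: "\<And>k s. k < h \<Longrightarrow> nats s i [] = Suc k \<Longrightarrow>
      unch (insert i (nmods c)) (rmods c) s0 s \<Longrightarrow> P (Suc k) s \<Longrightarrow> run c B (P k) s"
    and C: "real h * (B + 10) + 10 + ncost hi \<le> C"
  shows "run (DOWN i hi c) C (P 0) s0"
proof -
  let ?c = "CSeq c (dec i)"
  let ?b = "NLess (NConst 0) (nv i)"
  let ?s = "nupdate s0 i [] h"
  define D where "D = B + 10"
  define \<phi> :: "state \<Rightarrow> real" where "\<phi> s = real (nats s i []) * D + 5" for s
  define Inv :: "state \<Rightarrow> bool" where "Inv s \<longleftrightarrow> unch (insert i (nmods c)) (rmods c) s0 s \<and> nats s i [] \<le> h \<and>
     P (nats s i []) s" for s
  have D: "D \<ge> 0" using B by (simp add: D_def)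
  have "run (CWhile ?b ?c) (C - 1 - ncost hi) (\<lambda>s. Inv s \<and> \<not> bval s ?b) ?s"
  proof (rule run_While[where \<phi> = \<phi>])
    show "Inv ?s" using upd[OF init(1)] by (simp add: Inv_def unch_def)
    show "\<phi> ?s \<le> C - 1 - ncost hi" using C by (simp add: \<phi>_def D_def)
  next
    fix s assume "Inv s"
    have "0 \<le> real (nats s i []) * D" using D by simp
    then show "1 + real (bcost ?b) \<le> \<phi> s" by (simp add: \<phi>_def)
  next
    fix s assume I: "Inv s" and b: "bval s ?b"
    then obtain k where k: "nats s i [] = Suc k" by (cases "nats s i []") auto
    have u: "unch (insert i (nmods c)) (rmods c) s0 s" using I by (simp add: Inv_def)
    have "run c B (P k) s"
      using body[OF _ k u] I k by (simp add: Inv_def)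
    then have "run c B (\<lambda>s'. run (dec i) 4 (\<lambda>s'. Inv s' \<and> 1 + real (bcost ?b) + (B + 4) + \<phi> s' \<le> \<phi> s) s') s"
    proof (rule run_conseq)
      fix s' assume u': "unch (nmods c) (rmods c) s s'" and P: "P k s'"
      have ik: "nats s' i [] = Suc k" using u' i k by (simp add: unch_def)
      have u2: "unch (insert i (nmods c)) (rmods c) s0 s'"
        by (rule unch_trans[OF u u']) auto
      then have u3: "unch (insert i (nmods c)) (rmods c) s0 (nupdate s' i [] k)"
        by (simp add: unch_def)
      show "run (dec i) 4 (\<lambda>s'. Inv s' \<and> 1 + real (bcost ?b) + (B + 4) + \<phi> s' \<le> \<phi> s) s'"
        using k upd[OF P] u3 I by (simp add: ik Inv_def \<phi>_def) (simp add: D_def algebra_simps)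
    qed simp
    then show "\<exists>B. run ?c B (\<lambda>s'. Inv s' \<and> 1 + real (bcost ?b) + B + \<phi> s' \<le> \<phi> s) s"
      by (intro exI[of _ "B + 4"], elim run_SeqI) simp
  qed
  then have "run (CWhile ?b ?c) (C - 1 - ncost hi) (P 0) ?s"
  proof (rule run_conseq)
    fix s' assume *: "Inv s' \<and> \<not> bval s' ?b"
    then have "nats s' i [] = 0" by simp
    then show "P 0 s'" using * by (auto simp: Inv_def)
  qed simp
  then show ?thesis unfolding DOWN_def run_Seq_NAssign by (simp add: hi algebra_simps)
qed

section \<open>Binary search and power levels\<close>

text \<open>\<open>unch\<close> frames whole arrays, but a loop over the carriers has to know that
  the rows of earlier carriers survive. This is checked syntactically: every array write has
  \<open>n\<close> as its first index. Scalars belong to no row and are exempt.\<close>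

fun row_writes :: "vname \<Rightarrow> com \<Rightarrow> bool" where
  "row_writes n CSkip \<longleftrightarrow> True"
| "row_writes n (NAssign x es e) \<longleftrightarrow> (case es of [] \<Rightarrow> True | a # _ \<Rightarrow> a = nv n)"
| "row_writes n (RAssign x es e) \<longleftrightarrow> (case es of [] \<Rightarrow> True | a # _ \<Rightarrow> a = nv n)"
| "row_writes n (CSeq c1 c2) \<longleftrightarrow> row_writes n c1 \<and> row_writes n c2"
| "row_writes n (CIf b c1 c2) \<longleftrightarrow> row_writes n c1 \<and> row_writes n c2"
| "row_writes n (CWhile b c) \<longleftrightarrow> row_writes n c"

definition row_frame :: "nat \<Rightarrow> state \<Rightarrow> state \<Rightarrow> bool" where
  "row_frame k s s' \<longleftrightarrow> (\<forall>x i is. i \<noteq> k \<longrightarrow> nats s' x (i # is) = nats s x (i # is) \<and>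
     reals s' x (i # is) = reals s x (i # is))"

lemma row_frameD:
  "row_frame k s s' \<Longrightarrow> i \<noteq> k \<Longrightarrow> nats s' x (i # is) = nats s x (i # is)"
  "row_frame k s s' \<Longrightarrow> i \<noteq> k \<Longrightarrow> reals s' x (i # is) = reals s x (i # is)"
  by (simp_all add: row_frame_def)

lemma exec_row_frame:
  "exec c s t s' \<Longrightarrow> row_writes n c \<Longrightarrow> n \<notin> nmods c \<Longrightarrow> row_frame (nats s n []) s s'"
proof (induction rule: exec.induct)
  case (Seq c1 s t1 s1 c2 t2 s2)
  have "nats s1 n [] = nats s n []"
    using exec_unch[OF Seq.hyps(1)] Seq.prems by (simp add: unch_def)
  then show ?case using Seq.IH Seq.prems by (simp add: row_frame_def)
next
  case (WhileTrue s b c t1 s1 t2 s2)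
  have "nats s1 n [] = nats s n []"
    using exec_unch[OF WhileTrue.hyps(2)] WhileTrue.prems by (simp add: unch_def)
  then show ?case using WhileTrue.IH WhileTrue.prems by (simp add: row_frame_def)
qed (auto simp: row_frame_def split: list.splits)

lemma run_row_frame:
  assumes "run c B Q s" "row_writes n c" "n \<notin> nmods c" "B \<le> B'"
    "\<And>s'. unch (nmods c) (rmods c) s s' \<Longrightarrow> row_frame (nats s n []) s s' \<Longrightarrow> Q s' \<Longrightarrow> Q' s'"
  shows "run c B' Q' s"
proof -
  obtain t s' where e: "exec c s t s'" "real t \<le> B" "Q s'" using assms(1) by (rule runE)
  show ?thesis
    by (rule runI[OF e(1)]) (use e assms exec_unch[OF e(1)] exec_row_frame[OF e(1)] in auto)
qed

lemma row_writes_FOR [simp]: "row_writes n (FOR i l hi c) \<longleftrightarrow> row_writes n c"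
  by (simp add: FOR_def)

lemma row_writes_DOWN [simp]: "row_writes n (DOWN i hi c) \<longleftrightarrow> row_writes n c"
  by (simp add: DOWN_def)

section \<open>Input cells that the programs preserve\<close>

definition inp :: "noma \<Rightarrow> real \<Rightarrow> state \<Rightarrow> bool" where
  "inp I \<epsilon> s \<longleftrightarrow> nats s ''K'' [] = users I \<and> nats s ''N'' [] = carriers I \<and> nats s ''M'' [] = mux I \<and>
     (\<forall>k\<in>{1..users I}. reals s ''w'' [k] = weight I k) \<and>
     (\<forall>n\<in>{1..carriers I}. reals s ''W'' [n] = bandwidth I n \<and> reals s ''Pn'' [n] = carrier_power I n \<and>
        (\<forall>k\<in>{1..users I}. reals s ''eta'' [n, k] = noise I n k)) \<and>
     reals s ''Pmax'' [] = total_power I \<and> reals s ''delta'' [] = power_unit I \<and> reals s ''eps'' [] = \<epsilon>"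

definition inp_nats :: "vname set" where "inp_nats = {''K'', ''N'', ''M''}"
definition inp_reals :: "vname set" where
  "inp_reals = {''w'', ''W'', ''Pn'', ''eta'', ''Pmax'', ''delta'', ''eps''}"

lemma inp_unch: "inp I \<epsilon> s \<Longrightarrow> unch X Y s s' \<Longrightarrow> X \<inter> inp_nats = {} \<Longrightarrow> Y \<inter> inp_reals = {} \<Longrightarrow> inp I \<epsilon> s'"
proof -
  assume a: "inp I \<epsilon> s" "unch X Y s s'" "X \<inter> inp_nats = {}" "Y \<inter> inp_reals = {}"
  have "nats s' x = nats s x" if "x \<in> inp_nats" for x using a that by (auto simp: unch_def)
  moreover have "reals s' x = reals s x" if "x \<in> inp_reals" for x using a that by (auto simp: unch_def)
  ultimately show ?thesis using a(1) by (simp add: inp_def inp_nats_def inp_reals_def)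
qed

lemma inp_nupdate [simp]: "x \<notin> inp_nats \<Longrightarrow> inp I \<epsilon> (nupdate s x is v) = inp I \<epsilon> s"
  using inp_unch[of I \<epsilon> s "{x}" "{}" "nupdate s x is v"] inp_unch[of I \<epsilon> "nupdate s x is v" "{x}" "{}" s]
  by (auto simp: unch_def)

lemma inp_rupdate [simp]: "x \<notin> inp_reals \<Longrightarrow> inp I \<epsilon> (rupdate s x is v) = inp I \<epsilon> s"
  using inp_unch[of I \<epsilon> s "{}" "{x}" "rupdate s x is v"] inp_unch[of I \<epsilon> "rupdate s x is v" "{}" "{x}" s]
  by (auto simp: unch_def)

text \<open>Intervals cannot be halved on the machine. Instead the bits of \<open>l\<close> are
  decided from the highest to the lowest, by adding the powers of two stored in \<open>pw\<close>;
  \<open>test\<close> reports through \<open>f\<close> whether the trial value \<open>q\<close> is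
  still acceptable.\<close>

definition bsearch :: "com \<Rightarrow> com" where
  "bsearch test = CSeq (NAssign ''l'' [] (NConst 0)) (DOWN ''c'' (nv ''B'')
     (CSeq (NAssign ''q'' [] (NAdd (nv ''l'') (NVar ''pw'' [NSub (nv ''c'') (NConst 1)])))
       (CSeq test (CIf (NLess (NConst 0) (nv ''f'')) (NAssign ''l'' [] (nv ''q'')) CSkip))))"

lemma mods_bsearch [simp]:
  "nmods (bsearch test) = {''l'', ''c'', ''q''} \<union> nmods test" "rmods (bsearch test) = rmods test"
  by (auto simp: bsearch_def)

lemma row_writes_bsearch [simp]: "row_writes n (bsearch test) \<longleftrightarrow> row_writes n test"
  by (simp add: bsearch_def)

definition bits_ok :: "nat \<Rightarrow> state \<Rightarrow> bool" where
  "bits_ok b s \<longleftrightarrow> nats s ''B'' [] = b \<and> (\<forall>k<b. nats s ''pw'' [k] = 2 ^ k)"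

lemma bits_ok_unch: "bits_ok b s \<Longrightarrow> unch X Y s s' \<Longrightarrow> ''B'' \<notin> X \<Longrightarrow> ''pw'' \<notin> X \<Longrightarrow> bits_ok b s'"
  unfolding bits_ok_def unch_def by simp

lemma bits_ok_upd [simp]: "x \<noteq> ''B'' \<Longrightarrow> x \<noteq> ''pw'' \<Longrightarrow> bits_ok b (nupdate s x is v) = bits_ok b s"
  "bits_ok b (rupdate s x is w) = bits_ok b s"
  unfolding bits_ok_def by auto

text \<open>The invariant is \<open>Q l\<close> together with the failure of \<open>Q\<close> at
  \<open>l + 2 ^ k\<close>, where \<open>k\<close> bits are still undecided. At \<open>k = 0\<close>
  it says that \<open>l\<close> is the greatest number with the downward closed property
  \<open>Q\<close>.\<close>

lemma run_bsearch:
  assumes bits: "bits_ok b s0"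
    and mods: "nmods test \<inter> {''l'', ''c'', ''q'', ''B'', ''pw''} = {}"
    and Q: "Q 0" "\<not> Q (2 ^ b)" "\<And>m m'. Q m \<Longrightarrow> m' \<le> m \<Longrightarrow> Q m'"
    and test: "\<And>s m. unch ({''l'', ''c'', ''q''} \<union> nmods test) (rmods test) s0 s \<Longrightarrow>
       nats s ''q'' [] = m \<Longrightarrow> run test T (\<lambda>s'. 0 < nats s' ''f'' [] \<longleftrightarrow> Q m) s"
    and T: "0 \<le> T" and C: "real b * (T + 30) + 13 \<le> C"
  shows "run (bsearch test) C (\<lambda>s. Q (nats s ''l'' []) \<and> \<not> Q (Suc (nats s ''l'' []))) s0"
proof -
  let ?s = "nupdate s0 ''l'' [] 0"
  let ?P = "\<lambda>k s. Q (nats s ''l'' []) \<and> \<not> Q (nats s ''l'' [] + 2 ^ k)"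
  let ?c = "CSeq (NAssign ''q'' [] (NAdd (nv ''l'') (NVar ''pw'' [NSub (nv ''c'') (NConst 1)])))
       (CSeq test (CIf (NLess (NConst 0) (nv ''f'')) (NAssign ''l'' [] (nv ''q'')) CSkip))"
  have "run (DOWN ''c'' (nv ''B'') ?c) (C - 2) (?P 0) ?s"
  proof (rule run_DOWN[where h = b and B = "T + 20"])
    show "nval ?s (nv ''B'') = b" using bits by (simp add: bits_ok_def)
    show "?P b ?s" using Q by simp
    show "?P k s \<Longrightarrow> ?P k (nupdate s ''c'' [] v)" for k s v by simp
    show "''c'' \<notin> nmods ?c" using mods by auto
    show "0 \<le> T + 20" using T by simp
    show "real b * (T + 20 + 10) + 10 + real (ncost (nv ''B'')) \<le> C - 2" using C by (simp add: algebra_simps)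
  next
    fix k s assume k: "k < b" and c: "nats s ''c'' [] = Suc k"
      and u: "unch (insert ''c'' (nmods ?c)) (rmods ?c) ?s s" and P: "?P (Suc k) s"
    have u0: "unch ({''l'', ''c'', ''q''} \<union> nmods test) (rmods test) s0 s"
      using u by (auto simp: unch_def)
    have "bits_ok b s" by (rule bits_ok_unch[OF bits u0]) (use mods in auto)
    then have pw: "nats s ''pw'' [k] = 2 ^ k" using k by (simp add: bits_ok_def)
    let ?q = "nats s ''l'' [] + 2 ^ k"
    let ?s1 = "nupdate s ''q'' [] ?q"
    have "run test T (\<lambda>s'. 0 < nats s' ''f'' [] \<longleftrightarrow> Q ?q) ?s1"
    proof (rule test)
      show "unch ({''l'', ''c'', ''q''} \<union> nmods test) (rmods test) s0 ?s1"
        using u0 by (auto simp: unch_def)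
    qed simp
    then have "run test T (\<lambda>s'. run (CIf (NLess (NConst 0) (nv ''f'')) (NAssign ''l'' [] (nv ''q'')) CSkip) 10 (?P k) s') ?s1"
    proof (rule run_conseq)
      fix s' assume u': "unch (nmods test) (rmods test) ?s1 s'" and f: "0 < nats s' ''f'' [] \<longleftrightarrow> Q ?q"
      have "nats s' ''q'' [] = ?q" "nats s' ''l'' [] = nats s ''l'' []"
        using u' mods by (auto simp: unch_def)
      then show "run (CIf (NLess (NConst 0) (nv ''f'')) (NAssign ''l'' [] (nv ''q'')) CSkip) 10 (?P k) s'"
        using f P by (auto simp: add.assoc[symmetric] mult_2)
    qed simp
    then have "run (CSeq test (CIf (NLess (NConst 0) (nv ''f'')) (NAssign ''l'' [] (nv ''q'')) CSkip)) (T + 10) (?P k) ?s1"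
      by (elim run_SeqI) simp
    then have "run (CSeq test (CIf (NLess (NConst 0) (nv ''f'')) (NAssign ''l'' [] (nv ''q'')) CSkip)) (T + 20 - 7) (?P k) ?s1"
      by (rule run_conseq) simp_all
    then show "run ?c (T + 20) (?P k) s" by (simp add: c pw)
  qed
  then show ?thesis by (simp add: bsearch_def)
qed

text \<open>Replaces the floor in the definition of \<open>J\<close> by a comparison of reals, the
  only form in which the machine can ask about it.\<close>

lemma le_J_levels_iff:
  assumes "valid_noma I"
  shows "real l * power_unit I \<le> total_power I \<longleftrightarrow> l \<le> J_levels I"
proof -
  have d: "0 < power_unit I" "0 \<le> total_power I" using assms by (auto simp: valid_noma_def)
  have "real l * power_unit I \<le> total_power I \<longleftrightarrow> of_int (int l) \<le> total_power I / power_unit I"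
    using d by (simp add: pos_le_divide_eq)
  also have "\<dots> \<longleftrightarrow> int l \<le> \<lfloor>total_power I / power_unit I\<rfloor>" by (rule le_floor_iff[symmetric])
  also have "\<dots> \<longleftrightarrow> l \<le> J_levels I" using d by (auto simp: J_levels_def le_nat_iff)
  finally show ?thesis .
qed

definition num_bits :: "nat \<Rightarrow> nat" where
  "num_bits J = (LEAST b. J < 2 ^ b)"

lemma less_num_bits: "J < 2 ^ num_bits J"
  unfolding num_bits_def by (rule LeastI_ex) (use less_exp in blast)

lemma num_bits_le: "J < 2 ^ b \<Longrightarrow> num_bits J \<le> b"
  unfolding num_bits_def by (rule Least_le)

lemma num_bits_bound: "1 \<le> J \<Longrightarrow> real (num_bits J) \<le> 1 + log 2 (real J)"
proof -
  assume J: "1 \<le> J"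
  obtain b where b: "num_bits J = Suc b"
    using less_num_bits[of J] J by (cases "num_bits J") auto
  have "\<not> J < 2 ^ b" using num_bits_le[of J b] b by auto
  then have "2 ^ b \<le> real J" by (metis not_less of_nat_le_iff of_nat_numeral of_nat_power)
  then have "log 2 (2 ^ b) \<le> log 2 (real J)" using J by (simp del: log_pow_cancel)
  then show ?thesis by (simp add: b)
qed

lemma num_bits_pos: "1 \<le> J \<Longrightarrow> 1 \<le> num_bits J"
  using less_num_bits[of J] by (cases "num_bits J") auto

definition pow_prog :: com where
  "pow_prog = CSeq (NAssign ''B'' [] (NConst 0)) (CSeq (NAssign ''pw'' [NConst 0] (NConst 1))
     (CWhile (BNot (RLess (rv ''Pmax'') (RMul (OfNat (NVar ''pw'' [nv ''B''])) (rv ''delta''))))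
       (CSeq (NAssign ''pw'' [NAdd (nv ''B'') (NConst 1)] (NAdd (NVar ''pw'' [nv ''B'']) (NVar ''pw'' [nv ''B''])))
         (inc ''B''))))"

lemma mods_pow_prog [simp]: "nmods pow_prog = {''B'', ''pw''}" "rmods pow_prog = {}"
  by (auto simp: pow_prog_def)

text \<open>The bit length of \<open>J\<close> is available before \<open>J\<close> itself:
  \<open>2 ^ k\<close> exceeds \<open>J\<close> as soon as \<open>2 ^ k\<close> times the power unit
  exceeds the total power.\<close>

lemma run_pow_prog:
  assumes v: "valid_noma I" and inp: "inp I \<epsilon> s0"
  shows "run pow_prog (30 * real (num_bits (J_levels I)) + 20) (bits_ok (num_bits (J_levels I))) s0"
proof -
  let ?b = "num_bits (J_levels I)"
  let ?s = "nupdate (nupdate s0 ''B'' [] 0) ''pw'' [0] 1"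
  let ?c = "CSeq (NAssign ''pw'' [NAdd (nv ''B'') (NConst 1)] (NAdd (NVar ''pw'' [nv ''B'']) (NVar ''pw'' [nv ''B'']))) (inc ''B'')"
  let ?t = "BNot (RLess (rv ''Pmax'') (RMul (OfNat (NVar ''pw'' [nv ''B''])) (rv ''delta'')))"
  define Inv :: "state \<Rightarrow> bool" where
    "Inv s \<longleftrightarrow> inp I \<epsilon> s \<and> nats s ''B'' [] \<le> ?b \<and> (\<forall>k\<le>nats s ''B'' []. nats s ''pw'' [k] = 2 ^ k)" for s
  have t: "bval s ?t \<longleftrightarrow> 2 ^ nats s ''B'' [] \<le> J_levels I" if "Inv s" for s
  proof -
    have "bval s ?t \<longleftrightarrow> real (2 ^ nats s ''B'' []) * power_unit I \<le> total_power I"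
      using that by (simp add: Inv_def inp_def not_less)
    then show ?thesis using le_J_levels_iff[OF v] by blast
  qed
  have "run (CWhile ?t ?c) (30 * real ?b + 15) (\<lambda>s. Inv s \<and> \<not> bval s ?t) ?s"
  proof (rule run_While[where \<phi> = "\<lambda>s. 30 * (real ?b - real (nats s ''B'' [])) + 15"])
    show "Inv ?s" using inp by (simp add: Inv_def inp_nats_def)
  next
    fix s assume I: "Inv s" and b: "bval s ?t"
    have "\<not> J_levels I < 2 ^ nats s ''B'' []" using b t[OF I] by simp
    then have "nats s ''B'' [] \<noteq> ?b" using less_num_bits[of "J_levels I"] by auto
    then have "nats s ''B'' [] < ?b" using I by (simp add: Inv_def)
    moreover have "\<forall>k\<le>Suc (nats s ''B'' []). (if k = Suc (nats s ''B'' []) then 2 * 2 ^ nats s ''B'' [] else nats s ''pw'' [k]) = 2 ^ k"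
      using I by (auto simp: Inv_def le_Suc_eq)
    ultimately show "\<exists>B. run ?c B (\<lambda>s'. Inv s' \<and> 1 + real (bcost ?t) + B +
        (30 * (real ?b - real (nats s' ''B'' [])) + 15) \<le> 30 * (real ?b - real (nats s ''B'' [])) + 15) s"
      using I by (intro exI[of _ 20]) (auto simp: Inv_def inp_nats_def le_Suc_eq)
  qed (auto simp: Inv_def)
  then have "run (CWhile ?t ?c) (30 * real ?b + 15) (bits_ok ?b) ?s"
  proof (rule run_conseq)
    fix s assume *: "Inv s \<and> \<not> bval s ?t"
    then have "J_levels I < 2 ^ nats s ''B'' []" using t[of s] by linarith
    then have "?b \<le> nats s ''B'' []" by (rule num_bits_le)
    then show "bits_ok ?b s" using * by (auto simp: Inv_def bits_ok_def)
  qed simp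
  then show ?thesis unfolding pow_prog_def by (simp, elim run_conseq) simp_all
qed

definition levels_prog :: com where
  "levels_prog = CSeq (bsearch (CIf (RLess (rv ''Pmax'') (RMul (OfNat (nv ''q'')) (rv ''delta'')))
     (NAssign ''f'' [] (NConst 0)) (NAssign ''f'' [] (NConst 1)))) (NAssign ''J'' [] (nv ''l''))"

lemma mods_levels_prog [simp]: "nmods levels_prog = {''l'', ''c'', ''q'', ''f'', ''J''}" "rmods levels_prog = {}"
  by (auto simp: levels_prog_def)

lemma run_levels_prog:
  assumes v: "valid_noma I" and inp: "inp I \<epsilon> s0" and b: "bits_ok (num_bits (J_levels I)) s0"
  shows "run levels_prog (50 * real (num_bits (J_levels I)) + 20) (\<lambda>s. nats s ''J'' [] = J_levels I) s0"
proof -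
  let ?b = "num_bits (J_levels I)"
  let ?t = "CIf (RLess (rv ''Pmax'') (RMul (OfNat (nv ''q'')) (rv ''delta'')))
     (NAssign ''f'' [] (NConst 0)) (NAssign ''f'' [] (NConst 1))"
  have "run (bsearch ?t) (50 * real ?b + 15) (\<lambda>s. nats s ''l'' [] \<le> J_levels I \<and> \<not> Suc (nats s ''l'' []) \<le> J_levels I) s0"
  proof (rule run_bsearch[OF b, where T = 15])
    fix s m assume u: "unch ({''l'', ''c'', ''q''} \<union> nmods ?t) (rmods ?t) s0 s" and q: "nats s ''q'' [] = m"
    have "inp I \<epsilon> s" by (rule inp_unch[OF inp u]) (auto simp: inp_nats_def)
    then have "reals s ''Pmax'' [] < real m * reals s ''delta'' [] \<longleftrightarrow> \<not> m \<le> J_levels I"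
      using le_J_levels_iff[OF v, of m] by (simp add: inp_def not_le[symmetric])
    then show "run ?t 15 (\<lambda>s'. 0 < nats s' ''f'' [] \<longleftrightarrow> m \<le> J_levels I) s" using q by simp
  qed (use less_num_bits[of "J_levels I"] in auto)
  then have "run (bsearch ?t) (50 * real ?b + 15) (\<lambda>s. run (NAssign ''J'' [] (nv ''l'')) 5 (\<lambda>s. nats s ''J'' [] = J_levels I) s) s0"
    by (rule run_conseq) auto
  then show ?thesis unfolding levels_prog_def by (elim run_SeqI) simp
qed

section \<open>Sorting the users and filling the switching tables\<close>

lemma run_Seq:
  assumes "run c1 B1 R s" "\<And>s'. unch (nmods c1) (rmods c1) s s' \<Longrightarrow> R s' \<Longrightarrow> run c2 B2 Q s'" "B1 + B2 \<le> B"
  shows "run (CSeq c1 c2) B Q s"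
  by (rule run_SeqI[OF run_conseq[OF assms(1)]]) (use assms in auto)

section \<open>Ranks of the users by noise\<close>

definition precedes :: "(nat \<Rightarrow> real) \<Rightarrow> nat \<Rightarrow> nat \<Rightarrow> bool" where
  "precedes f e i \<longleftrightarrow> f e < f i \<or> \<not> f i < f e \<and> e < i"

text \<open>Ties are broken by the index of the user, which need not agree with the decoding order of
  the instance; the characterisation of \<open>F_opt\<close> by \<open>attain\<close> does not depend on the order.\<close>

definition rank :: "(nat \<Rightarrow> real) \<Rightarrow> nat \<Rightarrow> nat \<Rightarrow> nat" where
  "rank f K i = Suc (card {e\<in>{1..K}. precedes f e i})"

lemma rank_less:
  assumes "precedes f e i" "e \<in> {1..K}"
  shows "rank f K e < rank f K i"
proof -
  have "{j\<in>{1..K}. precedes f j e} \<subset> {j\<in>{1..K}. precedes f j i}"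
    using assms by (auto simp: precedes_def)
  then show ?thesis unfolding rank_def by (simp add: psubset_card_mono)
qed

lemma rank_inj: "inj_on (rank f K) {1..K}"
proof (rule inj_onI, rule ccontr)
  fix i j assume *: "i \<in> {1..K}" "j \<in> {1..K}" "rank f K i = rank f K j" "i \<noteq> j"
  then have "precedes f i j \<or> precedes f j i" by (auto simp: precedes_def)
  then show False using rank_less[of f i j K] rank_less[of f j i K] * by auto
qed

lemma rank_bij: "bij_betw (rank f K) {1..K} {1..K}"
proof -
  have "rank f K i \<in> {1..K}" if i: "i \<in> {1..K}" for i
  proof -
    have "i \<notin> {j\<in>{1..K}. precedes f j i}" by (simp add: precedes_def)
    then have "{j\<in>{1..K}. precedes f j i} \<subset> {1..K}" using i by blast
    then have "card {j\<in>{1..K}. precedes f j i} < card {1..K}" by (rule psubset_card_mono[rotated]) simp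
    then show ?thesis by (simp add: rank_def)
  qed
  then have "rank f K ` {1..K} \<subseteq> {1..K}" by blast
  from endo_inj_surj[OF finite_atLeastAtMost this rank_inj] show ?thesis
    unfolding bij_betw_def using rank_inj by blast
qed

lemma rank_sorted:
  assumes "rank f K i \<le> rank f K j" "i \<in> {1..K}" "j \<in> {1..K}"
  shows "f i \<le> f j"
proof (rule ccontr)
  assume "\<not> f i \<le> f j"
  then have "precedes f j i" by (simp add: precedes_def)
  from rank_less[OF this assms(3)] assms(1) show False by simp
qed

abbreviation eta_e :: "nexp \<Rightarrow> rexp" where "eta_e k \<equiv> RVar ''eta'' [nv ''n'', k]"
abbreviation or_e :: "bexp \<Rightarrow> bexp \<Rightarrow> bexp" where "or_e a b \<equiv> BNot (BAnd (BNot a) (BNot b))"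
abbreviation succ_e :: "nexp \<Rightarrow> nexp" where "succ_e a \<equiv> NAdd a (NConst 1)"

text \<open>Each user is placed at its rank, which is counted directly. The quadratic cost is
  affordable because filling the tables of the carrier costs at least as much.\<close>

definition sort_prog :: com where
  "sort_prog = FOR ''i'' 1 (succ_e (nv ''K''))
     (CSeq (NAssign ''r'' [] (NConst 1))
     (CSeq (FOR ''e'' 1 (succ_e (nv ''K''))
        (CIf (or_e (RLess (eta_e (nv ''e'')) (eta_e (nv ''i'')))
            (BAnd (BNot (RLess (eta_e (nv ''i'')) (eta_e (nv ''e'')))) (NLess (nv ''e'') (nv ''i''))))
          (inc ''r'') CSkip))
     (NAssign ''o'' [nv ''n'', nv ''r''] (nv ''i''))))"

lemma mods_sort_prog [simp]: "nmods sort_prog = {''i'', ''r'', ''e'', ''o''}" "rmods sort_prog = {}"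
  by (auto simp: sort_prog_def)

lemma row_writes_sort_prog [simp]: "row_writes ''n'' sort_prog"
  by (simp add: sort_prog_def)

lemma run_sort_prog:
  assumes inp: "inp I \<epsilon> s0" and n: "nats s0 ''n'' [] = n" "n \<in> {1..carriers I}" and K: "1 \<le> users I"
  shows "run sort_prog (200 * real (users I) ^ 2)
    (\<lambda>s. \<forall>i\<in>{1..users I}. nats s ''o'' [n, rank (noise I n) (users I) i] = i) s0"
proof -
  let ?K = "users I" and ?r = "rank (noise I n) (users I)"
  let ?b = "CIf (or_e (RLess (eta_e (nv ''e'')) (eta_e (nv ''i'')))
            (BAnd (BNot (RLess (eta_e (nv ''i'')) (eta_e (nv ''e'')))) (NLess (nv ''e'') (nv ''i''))))
          (inc ''r'') CSkip"
  let ?inner = "FOR ''e'' 1 (succ_e (nv ''K'')) ?b"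
  let ?P = "\<lambda>k s. \<forall>i\<in>{1..<k}. nats s ''o'' [n, ?r i] = i"
  have "run (FOR ''i'' 1 (succ_e (nv ''K''))
     (CSeq (NAssign ''r'' [] (NConst 1)) (CSeq ?inner
     (NAssign ''o'' [nv ''n'', nv ''r''] (nv ''i'')))))
     (200 * real ?K ^ 2) (?P (Suc ?K)) s0"
  proof (rule run_FOR[where P = ?P and B = "80 * real ?K + 30"])
    show "?P 1 s0" by simp
    show "?P k s \<Longrightarrow> ?P k (nupdate s ''i'' [] v)" for k s v by simp
    fix s
    assume "unch (insert ''i'' (nmods (CSeq (NAssign ''r'' [] (NConst 1)) (CSeq ?inner
     (NAssign ''o'' [nv ''n'', nv ''r''] (nv ''i'')))))) (rmods (CSeq (NAssign ''r'' [] (NConst 1)) (CSeq ?inner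
     (NAssign ''o'' [nv ''n'', nv ''r''] (nv ''i''))))) s0 s"
    then have "unch {''i'', ''r'', ''e'', ''o''} {} s0 s" by (rule unch_mono) auto
    then have "inp I \<epsilon> s" by (rule inp_unch[OF inp]) (auto simp: inp_nats_def)
    then show "nval s (succ_e (nv ''K'')) = Suc ?K" by (simp add: inp_def)
  next
    fix k s assume k: "1 \<le> k" "k < Suc ?K" "nats s ''i'' [] = k"
      and u: "unch (insert ''i'' (nmods (CSeq (NAssign ''r'' [] (NConst 1)) (CSeq ?inner
     (NAssign ''o'' [nv ''n'', nv ''r''] (nv ''i'')))))) (rmods (CSeq (NAssign ''r'' [] (NConst 1)) (CSeq ?inner
     (NAssign ''o'' [nv ''n'', nv ''r''] (nv ''i''))))) s0 s" and P: "?P k s"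
    have u: "unch {''i'', ''r'', ''e'', ''o''} {} s0 s" by (rule unch_mono[OF u]) auto
    have inps: "inp I \<epsilon> s" by (rule inp_unch[OF inp u]) (auto simp: inp_nats_def)
    have nn: "nats s ''n'' [] = n" using u n by (simp add: unch_def)
    let ?s = "nupdate s ''r'' [] 1"
    have "run ?inner (80 * real ?K + 10) (\<lambda>s'. nats s' ''r'' [] = Suc (card {e\<in>{1..<Suc ?K}. precedes (noise I n) e k})) ?s"
    proof (rule run_FOR[where B = 60 and
          P = "\<lambda>m s'. nats s' ''r'' [] = Suc (card {e\<in>{1..<m}. precedes (noise I n) e k})"])
      fix s' assume "unch (insert ''e'' (nmods ?b)) (rmods ?b) ?s s'"
      then have "nats s' ''K'' = nats s ''K''" by (simp add: unch_def)
      then show "nval s' (succ_e (nv ''K'')) = Suc ?K" using inps by (simp add: inp_def)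
    next
      fix m s' assume m: "1 \<le> m" "m < Suc ?K" "nats s' ''e'' [] = m"
        and u': "unch (insert ''e'' (nmods ?b)) (rmods ?b) ?s s'"
        and P': "nats s' ''r'' [] = Suc (card {e\<in>{1..<m}. precedes (noise I n) e k})"
      have e: "nats s' ''n'' [] = n" "nats s' ''i'' [] = k" "reals s' ''eta'' [n, m] = noise I n m"
        "reals s' ''eta'' [n, k] = noise I n k"
        using u' nn k m inps n by (auto simp: unch_def inp_def)
      have "{e\<in>{1..<Suc m}. precedes (noise I n) e k} =
        (if precedes (noise I n) m k then insert m {e\<in>{1..<m}. precedes (noise I n) e k}
         else {e\<in>{1..<m}. precedes (noise I n) e k})" using m by (auto simp: less_Suc_eq)
      then have c: "card {e\<in>{1..<Suc m}. precedes (noise I n) e k} =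
        (if precedes (noise I n) m k then Suc (card {e\<in>{1..<m}. precedes (noise I n) e k})
         else card {e\<in>{1..<m}. precedes (noise I n) e k})" by simp
      show "run ?b 60 (\<lambda>s'. nats s' ''r'' [] = Suc (card {e\<in>{1..<Suc m}. precedes (noise I n) e k})) s'"
        unfolding c by (simp add: e m P') (auto simp: precedes_def)
    qed simp_all
    then have inner: "run ?inner (80 * real ?K + 10) (\<lambda>s'. run (NAssign ''o'' [nv ''n'', nv ''r''] (nv ''i'')) 10 (?P (Suc k)) s') ?s"
    proof (rule run_conseq)
      fix s' assume u': "unch (nmods ?inner) (rmods ?inner) ?s s'"
        and r: "nats s' ''r'' [] = Suc (card {e\<in>{1..<Suc ?K}. precedes (noise I n) e k})"
      have e: "nats s' ''n'' [] = n" "nats s' ''i'' [] = k" "nats s' ''o'' = nats s ''o''"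
        using u' nn k by (auto simp: unch_def)
      have "{1..<Suc ?K} = {1..?K}" by auto
      then have r: "nats s' ''r'' [] = ?r k" using r by (simp only: rank_def)
      have "?r i \<noteq> ?r k" if "i \<in> {1..<k}" for i
        using inj_onD[OF rank_inj, of "noise I n" ?K i k] that k by auto
      then show "run (NAssign ''o'' [nv ''n'', nv ''r''] (nv ''i'')) 10 (?P (Suc k)) s'"
        using P k by (auto simp: e r less_Suc_eq)
    qed simp
    have "run (CSeq ?inner (NAssign ''o'' [nv ''n'', nv ''r''] (nv ''i''))) (80 * real ?K + 20) (?P (Suc k)) ?s"
      by (rule run_SeqI[OF inner]) simp
    then have "run (CSeq ?inner (NAssign ''o'' [nv ''n'', nv ''r''] (nv ''i''))) (80 * real ?K + 30 - 2) (?P (Suc k)) ?s"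
      by (rule run_conseq) simp_all
    then show "run (CSeq (NAssign ''r'' [] (NConst 1)) (CSeq ?inner
     (NAssign ''o'' [nv ''n'', nv ''r''] (nv ''i'')))) (80 * real ?K + 30) (?P (Suc k)) s" by simp
  next
    have "1 \<le> real ?K" using K by simp
    then have "real ?K * 1 \<le> real ?K * real ?K" by (intro mult_left_mono) simp_all
    then have "8 + real ?K * 40 \<le> 120 * (real ?K * real ?K)" using \<open>1 \<le> real ?K\<close> by linarith
    then show "(real (Suc ?K) - real 1) * (80 * real ?K + 30 + 7 + ncost (succ_e (nv ''K''))) + 5 + ncost (succ_e (nv ''K'')) \<le> 200 * real ?K ^ 2"
      by (simp add: power2_eq_square algebra_simps)
  qed simp_all
  then show ?thesis unfolding sort_prog_def by (rule run_conseq) auto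
qed

section \<open>Computation of a single table entry\<close>

abbreviation ord_e :: "nexp \<Rightarrow> nexp" where "ord_e i \<equiv> NVar ''o'' [nv ''n'', i]"

definition h_e :: "nexp \<Rightarrow> rexp \<Rightarrow> rexp" where
  "h_e k y = RMul (RMul (RVar ''W'' [nv ''n'']) (RVar ''w'' [k])) (RLog (RAdd y (eta_e k)))"

lemma rcost_h_e [simp]: "rcost (h_e k y) = 9 + 2 * ncost k + rcost y"
  by (simp add: h_e_def)

text \<open>The machine logarithm is 0 on nonpositive arguments; nonnegative power and positive
  noise keep its argument in the range where it is the true logarithm.\<close>

lemma rval_h_e:
  assumes "inp I \<epsilon> s" "valid_noma I" "nats s ''n'' [] = n" "n \<in> {1..carriers I}" "nval s k \<in> {1..users I}"
    "0 \<le> rval s y"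
  shows "rval s (h_e k y) = hh I n (nval s k) (rval s y)"
proof -
  have "0 < noise I n (nval s k)" using noise_pos[OF assms(2,4,5)] .
  then have "0 < rval s y + noise I n (nval s k)" using assms(6) by linarith
  then show ?thesis using assms by (simp add: h_e_def inp_def hh_def)
qed

abbreviation Y_e :: "nexp \<Rightarrow> nexp \<Rightarrow> rexp" where "Y_e m i \<equiv> RVar ''Y'' [nv ''n'', m, i]"
abbreviation G_e :: "nexp \<Rightarrow> nexp \<Rightarrow> rexp" where "G_e m i \<equiv> RVar ''G'' [nv ''n'', m, i]"
abbreviation w_e :: "nexp \<Rightarrow> rexp" where "w_e k \<equiv> RVar ''w'' [k]"
abbreviation pred_e :: "nexp \<Rightarrow> nexp" where "pred_e m \<equiv> NSub m (NConst 1)"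

definition switch_prog :: com where
  "switch_prog =
    CSeq (CIf (RLess (w_e (ord_e (nv ''e''))) (w_e (ord_e (nv ''i''))))
       (RAssign ''y'' [] (RDiv
          (RSub (RMul (w_e (ord_e (nv ''e''))) (eta_e (ord_e (nv ''i''))))
                (RMul (w_e (ord_e (nv ''i''))) (eta_e (ord_e (nv ''e'')))))
          (RSub (w_e (ord_e (nv ''i''))) (w_e (ord_e (nv ''e''))))))
       (RAssign ''y'' [] (rv ''Pmax'')))
    (CSeq (CIf (RLess (rv ''y'') (Y_e (pred_e (nv ''m'')) (nv ''e'')))
       (RAssign ''y'' [] (Y_e (pred_e (nv ''m'')) (nv ''e''))) CSkip)
    (CSeq (CIf (RLess (rv ''Pmax'') (rv ''y'')) (RAssign ''y'' [] (rv ''Pmax'')) CSkip)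
    (CSeq (RAssign ''v'' [] (RSub (RAdd (G_e (pred_e (nv ''m'')) (nv ''e'')) (h_e (ord_e (nv ''e'')) (rv ''y'')))
        (h_e (ord_e (nv ''i'')) (rv ''y''))))
    (CIf (RLess (G_e (nv ''m'') (nv ''i'')) (rv ''v''))
      (CSeq (RAssign ''G'' [nv ''n'', nv ''m'', nv ''i''] (rv ''v''))
        (RAssign ''Y'' [nv ''n'', nv ''m'', nv ''i''] (rv ''y''))) CSkip))))"

lemma mods_switch_prog [simp]: "nmods switch_prog = {}" "rmods switch_prog = {''y'', ''v'', ''G'', ''Y''}"
  by (auto simp: switch_prog_def)

text \<open>The constant cost rests on the closed form in \<open>hh_best_switch\<close>. The
  postcondition gives the final arrays as functional updates, so the caller knows that every other
  entry is intact.\<close>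

lemma run_switch_prog:
  assumes inp: "inp I \<epsilon> s" and v: "valid_noma I" and n: "nats s ''n'' [] = n" "n \<in> {1..carriers I}"
    and idx: "nats s ''e'' [] = e" "nats s ''i'' [] = i" "nats s ''m'' [] = m"
    and us: "nats s ''o'' [n, e] \<in> {1..users I}" "nats s ''o'' [n, i] \<in> {1..users I}"
    and le: "noise I n (nats s ''o'' [n, e]) \<le> noise I n (nats s ''o'' [n, i])"
    and lo: "0 \<le> reals s ''Y'' [n, m - 1, e]" "reals s ''Y'' [n, m - 1, e] \<le> total_power I"
  shows "run switch_prog 200 (\<lambda>s'. \<exists>y. reals s ''Y'' [n, m - 1, e] \<le> y \<and> y \<le> total_power I \<and>
      (\<forall>x. reals s ''Y'' [n, m - 1, e] \<le> x \<longrightarrow> x \<le> total_power I \<longrightarrow>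
        hh I n (nats s ''o'' [n, e]) x - hh I n (nats s ''o'' [n, i]) x \<le>
        hh I n (nats s ''o'' [n, e]) y - hh I n (nats s ''o'' [n, i]) y) \<and>
      (let w = reals s ''G'' [n, m - 1, e] + hh I n (nats s ''o'' [n, e]) y - hh I n (nats s ''o'' [n, i]) y in
        reals s' ''G'' = (if reals s ''G'' [n, m, i] < w then (reals s ''G'')([n, m, i] := w) else reals s ''G'') \<and>
        reals s' ''Y'' = (if reals s ''G'' [n, m, i] < w then (reals s ''Y'')([n, m, i] := y) else reals s ''Y''))) s"
proof -
  let ?e = "nats s ''o'' [n, e]" and ?i = "nats s ''o'' [n, i]"
  let ?lo = "reals s ''Y'' [n, m - 1, e]" and ?B = "total_power I"
  define y0 where "y0 = (if weight I ?e < weight I ?i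
      then (weight I ?e * noise I n ?i - weight I ?i * noise I n ?e) / (weight I ?i - weight I ?e) else ?B)"
  define y where "y = min ?B (max ?lo y0)"
  have y: "?lo \<le> y" "y \<le> ?B" using lo by (auto simp: y_def)
  have best: "hh I n ?e x - hh I n ?i x \<le> hh I n ?e y - hh I n ?i y" if "?lo \<le> x" "x \<le> ?B" for x
    unfolding y_def by (rule hh_best_switch[OF v n(2) us le lo(1) that y0_def])
  have vals: "reals s ''w'' [?e] = weight I ?e" "reals s ''w'' [?i] = weight I ?i"
    "reals s ''eta'' [n, ?e] = noise I n ?e" "reals s ''eta'' [n, ?i] = noise I n ?i"
    "reals s ''Pmax'' [] = ?B" using inp us n by (auto simp: inp_def)
  let ?Q = "\<lambda>s'. let w = reals s ''G'' [n, m - 1, e] + hh I n ?e y - hh I n ?i y in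
        reals s' ''G'' = (if reals s ''G'' [n, m, i] < w then (reals s ''G'')([n, m, i] := w) else reals s ''G'') \<and>
        reals s' ''Y'' = (if reals s ''G'' [n, m, i] < w then (reals s ''Y'')([n, m, i] := y) else reals s ''Y'')"
  have "run switch_prog 200 ?Q s" unfolding switch_prog_def
  proof (rule run_Seq[where R = "\<lambda>s'. reals s' ''y'' [] = y0" and ?B1.0 = 50 and ?B2.0 = 150], goal_cases)
    case 1
    show ?case by (simp add: n idx vals y0_def)
  next
    case (2 s1)
    have s1: "nats s1 = nats s" "reals s1 ''Y'' = reals s ''Y''" using 2(1) by (auto simp: unch_def)
    show ?case
    proof (rule run_Seq[where R = "\<lambda>s'. reals s' ''y'' [] = max ?lo y0" and ?B1.0 = 20 and ?B2.0 = 130], goal_cases)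
      case 1
      show ?case using 2(2) by (auto simp: n idx s1)
    next
      case (2 s2)
      have s2: "reals s2 ''Pmax'' [] = ?B" using 2(1) \<open>unch _ _ s s1\<close> vals by (auto simp: unch_def)
      show ?case
      proof (rule run_Seq[where R = "\<lambda>s'. reals s' ''y'' [] = y" and ?B1.0 = 10 and ?B2.0 = 120], goal_cases)
        case 1
        show ?case using 2(2) by (auto simp: s2 y_def)
      next
        case (2 t)
        have t: "unch {} {''y''} s t"
          using 2(1) \<open>unch _ _ s1 s2\<close> \<open>unch _ _ s s1\<close> by (simp add: unch_def)
        have ti: "inp I \<epsilon> t" by (rule inp_unch[OF inp t(1)]) (auto simp: inp_reals_def)
        have tn: "nats t = nats s" "reals t ''G'' = reals s ''G''" "reals t ''Y'' = reals s ''Y''"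
          using t(1) by (auto simp: unch_def)
        have h: "rval t (h_e (ord_e (nv ''e'')) (rv ''y'')) = hh I n ?e y"
          "rval t (h_e (ord_e (nv ''i'')) (rv ''y'')) = hh I n ?i y"
          using rval_h_e[OF ti v, of n "ord_e (nv ''e'')" "rv ''y''"] rval_h_e[OF ti v, of n "ord_e (nv ''i'')" "rv ''y''"]
            tn n idx us 2(2) y lo by simp_all
        show ?case by (simp add: h tn n idx 2(2) Let_def)
      qed simp
    qed simp
  qed simp
  then show ?thesis by (rule run_conseq[OF _ order_refl], intro exI[of _ y] conjI) (use y best in blast)+
qed

text \<open>\<open>b\<close> is the first predecessor not yet tried, so the predicate serves as the
  invariant of the loop over predecessors; at \<open>b = i\<close> it provides the assumptions of
  \<open>user_tables\<close> on this entry.\<close>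

definition entry_ok :: "(nat \<Rightarrow> real \<Rightarrow> real) \<Rightarrow> (nat \<Rightarrow> nat) \<Rightarrow> real \<Rightarrow> (nat \<Rightarrow> nat \<Rightarrow> real) \<Rightarrow>
    (nat \<Rightarrow> nat \<Rightarrow> real) \<Rightarrow> nat \<Rightarrow> nat \<Rightarrow> nat \<Rightarrow> bool" where
  "entry_ok h us B Y G b m i \<longleftrightarrow> 0 \<le> Y m i \<and> Y m i \<le> B \<and>
     (m = 1 \<or> b = 1 \<longrightarrow> Y m i = 0 \<and> G m i = - h (us i) 0) \<and>
     (Y m i = 0 \<and> G m i = - h (us i) 0 \<or>
      1 < m \<and> (\<exists>e. 1 \<le> e \<and> e < b \<and> Y (m - 1) e \<le> Y m i \<and>
        G m i = G (m - 1) e + h (us e) (Y m i) - h (us i) (Y m i))) \<and>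
     (1 < m \<longrightarrow> (\<forall>e y. 1 \<le> e \<longrightarrow> e < b \<longrightarrow> Y (m - 1) e \<le> y \<longrightarrow> y \<le> B \<longrightarrow>
        G (m - 1) e + h (us e) y - h (us i) y \<le> G m i))"

lemma entry_ok_cong:
  assumes "Y' m i = Y m i" "G' m i = G m i" "\<And>e. 1 < m \<Longrightarrow> Y' (m - 1) e = Y (m - 1) e"
    "\<And>e. 1 < m \<Longrightarrow> G' (m - 1) e = G (m - 1) e"
  shows "entry_ok h us B Y' G' b m i = entry_ok h us B Y G b m i"
  using assms unfolding entry_ok_def by (cases "1 < m") simp_all

lemma entry_ok_init: "0 \<le> B \<Longrightarrow> Y m i = 0 \<Longrightarrow> G m i = - h (us i) 0 \<Longrightarrow> entry_ok h us B Y G (Suc 0) m i"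
  by (simp add: entry_ok_def)

lemma entry_ok_first: "entry_ok h us B Y G b 1 i \<Longrightarrow> entry_ok h us B Y G b' 1 i"
  by (simp add: entry_ok_def)

text \<open>Because \<open>y\<close> maximises the difference on the whole admissible range, one
  comparison covers predecessor \<open>e\<close> at all switching levels. Earlier predecessors stay
  covered since the value of the entry never drops.\<close>

lemma entry_ok_step:
  assumes ok: "entry_ok h us B Y G e m i" and m: "1 < m" "1 \<le> e" and Y0: "0 \<le> Y (m - 1) e"
    and y: "Y (m - 1) e \<le> y" "y \<le> B"
    and best: "\<And>x. Y (m - 1) e \<le> x \<Longrightarrow> x \<le> B \<Longrightarrow> h (us e) x - h (us i) x \<le> h (us e) y - h (us i) y"
    and w: "w = G (m - 1) e + h (us e) y - h (us i) y"
    and G': "G' m i = (if G m i < w then w else G m i)" and Y': "Y' m i = (if G m i < w then y else Y m i)"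
    and same: "\<And>e. Y' (m - 1) e = Y (m - 1) e" "\<And>e. G' (m - 1) e = G (m - 1) e"
  shows "entry_ok h us B Y' G' (Suc e) m i"
proof -
  have le: "G (m - 1) f + h (us f) x - h (us i) x \<le> G' m i"
    if f: "1 \<le> f" "f < Suc e" "Y (m - 1) f \<le> x" "x \<le> B" for f x
  proof (cases "f = e")
    case True
    then show ?thesis using best[of x] f w G' by auto
  next
    case False
    then have "G (m - 1) f + h (us f) x - h (us i) x \<le> G m i"
      using ok f m by (auto simp: entry_ok_def)
    then show ?thesis using G' by auto
  qed
  show ?thesis
  proof (cases "G m i < w")
    case True
    then have "\<exists>f. 1 \<le> f \<and> f < Suc e \<and> Y' (m - 1) f \<le> Y' m i \<and>
        G' m i = G' (m - 1) f + h (us f) (Y' m i) - h (us i) (Y' m i)"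
      using m y w G' Y' by (intro exI[of _ e]) (simp add: same[simplified])
    then show ?thesis using True Y' le m y Y0 unfolding entry_ok_def same by auto
  next
    case False
    from ok have "Y m i = 0 \<and> G m i = - h (us i) 0 \<or> (\<exists>f. 1 \<le> f \<and> f < Suc e \<and> Y (m - 1) f \<le> Y m i \<and>
        G m i = G (m - 1) f + h (us f) (Y m i) - h (us i) (Y m i))"
      unfolding entry_ok_def by (metis less_SucI)
    then show ?thesis using False Y' G' le m ok unfolding entry_ok_def same by auto
  qed
qed

definition fill_prog :: com where
  "fill_prog = CSeq (RAssign ''Y'' [nv ''n'', nv ''m'', nv ''i''] (OfNat (NConst 0)))
     (CSeq (RAssign ''G'' [nv ''n'', nv ''m'', nv ''i''] (RSub (OfNat (NConst 0)) (h_e (ord_e (nv ''i'')) (OfNat (NConst 0)))))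
     (CIf (NLess (NConst 1) (nv ''m'')) (FOR ''e'' 1 (nv ''i'') switch_prog) CSkip))"

lemma mods_fill_prog [simp]: "nmods fill_prog = {''e''}" "rmods fill_prog = {''y'', ''v'', ''G'', ''Y''}"
  by (auto simp: fill_prog_def)

abbreviation Yf :: "state \<Rightarrow> nat \<Rightarrow> nat \<Rightarrow> nat \<Rightarrow> real" where "Yf s n m i \<equiv> reals s ''Y'' [n, m, i]"
abbreviation Gf :: "state \<Rightarrow> nat \<Rightarrow> nat \<Rightarrow> nat \<Rightarrow> real" where "Gf s n m i \<equiv> reals s ''G'' [n, m, i]"

definition sorted_users :: "noma \<Rightarrow> nat \<Rightarrow> (nat \<Rightarrow> nat) \<Rightarrow> bool" where
  "sorted_users I n us \<longleftrightarrow> us ` {1..users I} = {1..users I} \<and>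
     (\<forall>i j. 1 \<le> i \<longrightarrow> i \<le> j \<longrightarrow> j \<le> users I \<longrightarrow> noise I n (us i) \<le> noise I n (us j))"

lemma run_fill_prog:
  assumes inp: "inp I \<epsilon> s0" and v: "valid_noma I" and n: "nats s0 ''n'' [] = n" "n \<in> {1..carriers I}"
    and us: "sorted_users I n us" "\<And>i. i \<in> {1..users I} \<Longrightarrow> nats s0 ''o'' [n, i] = us i"
    and i: "nats s0 ''i'' [] = i" "1 \<le> i" "i \<le> users I" and m: "nats s0 ''m'' [] = m" "1 \<le> m"
    and prev: "\<And>e. 1 < m \<Longrightarrow> e \<in> {1..users I} \<Longrightarrow> 0 \<le> Yf s0 n (m - 1) e \<and> Yf s0 n (m - 1) e \<le> total_power I"
  shows "run fill_prog (400 * real (users I))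
    (\<lambda>s. entry_ok (hh I n) us (total_power I) (Yf s n) (Gf s n) i m i \<and>
       (\<forall>is. is \<noteq> [n, m, i] \<longrightarrow> reals s ''Y'' is = reals s0 ''Y'' is \<and> reals s ''G'' is = reals s0 ''G'' is)) s0"
proof -
  let ?B = "total_power I" and ?K = "users I"
  have usK: "us e \<in> {1..?K}" if "e \<in> {1..?K}" for e using us(1) that by (auto simp: sorted_users_def)
  let ?s1 = "rupdate s0 ''Y'' [n, m, i] 0"
  let ?s = "rupdate ?s1 ''G'' [n, m, i] (- hh I n (us i) 0)"
  have h: "rval ?s1 (h_e (ord_e (nv ''i'')) (OfNat (NConst 0))) = hh I n (us i) 0"
    using rval_h_e[of I \<epsilon> ?s1 n "ord_e (nv ''i'')" "OfNat (NConst 0)"] inp v n i us(2)[of i] usK[of i]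
    by (simp add: inp_reals_def)
  let ?same = "\<lambda>s. \<forall>is. is \<noteq> [n, m, i] \<longrightarrow> reals s ''Y'' is = reals s0 ''Y'' is \<and> reals s ''G'' is = reals s0 ''G'' is"
  let ?P = "\<lambda>e s. entry_ok (hh I n) us ?B (Yf s n) (Gf s n) e m i \<and> ?same s"
  have B: "0 \<le> ?B" using v by (simp add: valid_noma_def)
  have P1: "?P 1 ?s" using entry_ok_init[OF B, of "Yf ?s n" m i "Gf ?s n" "hh I n" us] by simp
  have i': "real i \<le> real ?K" "1 \<le> real ?K" using i by auto
  have loop: "run (FOR ''e'' 1 (nv ''i'') switch_prog) (250 * real ?K + 10) (?P i) ?s" if m1: "1 < m"
  proof (rule run_FOR[where B = 200 and P = ?P and h = i])
    show "?P 1 ?s" by (rule P1)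
    fix s assume "unch (insert ''e'' (nmods switch_prog)) (rmods switch_prog) ?s s"
    then show "nval s (nv ''i'') = i" using i by (simp add: unch_def)
  next
    fix e s assume e: "1 \<le> e" "e < i" "nats s ''e'' [] = e"
      and u: "unch (insert ''e'' (nmods switch_prog)) (rmods switch_prog) ?s s" and P: "?P e s"
    have u: "unch {''e''} {''y'', ''v'', ''G'', ''Y''} s0 s" using u by (simp add: unch_def)
    have inps: "inp I \<epsilon> s" by (rule inp_unch[OF inp u]) (auto simp: inp_nats_def inp_reals_def)
    have idx: "nats s ''n'' [] = n" "nats s ''i'' [] = i" "nats s ''m'' [] = m" "nats s ''o'' [n, e] = us e" "nats s ''o'' [n, i] = us i"
      using u n i m e us(2)[of e] us(2)[of i] by (auto simp: unch_def)
    have mi: "[n, m - 1, e'] \<noteq> [n, m, i]" for e'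
    proof -
      have "m - 1 \<noteq> m" using m1 by arith
      then show ?thesis by simp
    qed
    have Ye: "0 \<le> Yf s n (m - 1) e" "Yf s n (m - 1) e \<le> ?B"
      using P mi prev[OF m1, of e] e i by auto
    have "run switch_prog 200 (\<lambda>s'. \<exists>y. Yf s n (m - 1) e \<le> y \<and> y \<le> ?B \<and>
      (\<forall>x. Yf s n (m - 1) e \<le> x \<longrightarrow> x \<le> ?B \<longrightarrow>
        hh I n (us e) x - hh I n (us i) x \<le> hh I n (us e) y - hh I n (us i) y) \<and>
      (let w = Gf s n (m - 1) e + hh I n (us e) y - hh I n (us i) y in
        reals s' ''G'' = (if Gf s n m i < w then (reals s ''G'')([n, m, i] := w) else reals s ''G'') \<and>
        reals s' ''Y'' = (if Gf s n m i < w then (reals s ''Y'')([n, m, i] := y) else reals s ''Y''))) s"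
      using run_switch_prog[OF inps v idx(1) n(2) e(3) idx(2,3), unfolded idx(4,5)] usK[of e] usK[of i] us(1) e i Ye
      by (auto simp: sorted_users_def)
    then show "run switch_prog 200 (?P (Suc e)) s"
    proof (rule run_conseq)
      fix s' :: state assume "\<exists>y. Yf s n (m - 1) e \<le> y \<and> y \<le> ?B \<and>
        (\<forall>x. Yf s n (m - 1) e \<le> x \<longrightarrow> x \<le> ?B \<longrightarrow>
          hh I n (us e) x - hh I n (us i) x \<le> hh I n (us e) y - hh I n (us i) y) \<and>
        (let w = Gf s n (m - 1) e + hh I n (us e) y - hh I n (us i) y in
        reals s' ''G'' = (if Gf s n m i < w then (reals s ''G'')([n, m, i] := w) else reals s ''G'') \<and>
        reals s' ''Y'' = (if Gf s n m i < w then (reals s ''Y'')([n, m, i] := y) else reals s ''Y''))"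
      then obtain y where y: "Yf s n (m - 1) e \<le> y" "y \<le> ?B"
        "\<And>x. Yf s n (m - 1) e \<le> x \<Longrightarrow> x \<le> ?B \<Longrightarrow>
          hh I n (us e) x - hh I n (us i) x \<le> hh I n (us e) y - hh I n (us i) y"
        and w: "let w = Gf s n (m - 1) e + hh I n (us e) y - hh I n (us i) y in
        reals s' ''G'' = (if Gf s n m i < w then (reals s ''G'')([n, m, i] := w) else reals s ''G'') \<and>
        reals s' ''Y'' = (if Gf s n m i < w then (reals s ''Y'')([n, m, i] := y) else reals s ''Y'')" by blast
      define w' where "w' = Gf s n (m - 1) e + hh I n (us e) y - hh I n (us i) y"
      have GY: "reals s' ''G'' = (if Gf s n m i < w' then (reals s ''G'')([n, m, i] := w') else reals s ''G'')"
        "reals s' ''Y'' = (if Gf s n m i < w' then (reals s ''Y'')([n, m, i] := y) else reals s ''Y'')"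
        using w unfolding Let_def w'_def by blast+
      have "entry_ok (hh I n) us ?B (Yf s' n) (Gf s' n) (Suc e) m i"
      proof (rule entry_ok_step[where Y = "Yf s n" and G = "Gf s n" and y = y and w = w'])
        show "entry_ok (hh I n) us ?B (Yf s n) (Gf s n) e m i" using P by blast
      qed (use m1 e Ye y w'_def mi GY in auto)
      then show "?P (Suc e) s'" using P by (simp add: GY)
    qed simp
  qed (use i i' in \<open>auto simp: algebra_simps\<close>)
  show ?thesis
  proof (cases "1 < m")
    case True
    have "run (FOR ''e'' 1 (nv ''i'') switch_prog) (400 * real ?K - 34) (?P i) ?s"
      by (rule run_conseq[OF loop[OF True]]) (use i' in auto)
    then show ?thesis using True unfolding fill_prog_def by (simp add: h n i m)
  next
    case False
    then have m1: "m = 1" using m by simp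
    have "?P i ?s" using P1 entry_ok_first[of "hh I n" us ?B "Yf ?s n" "Gf ?s n" 1 i i] unfolding m1 by blast
    then show ?thesis using m1 i' unfolding fill_prog_def by (simp add: h[unfolded m1 One_nat_def] n i m)
  qed
qed

section \<open>The tables of a whole carrier and their evaluation\<close>

definition tables_prog :: com where
  "tables_prog = FOR ''m'' 1 (succ_e (nv ''Mp'')) (FOR ''i'' 1 (succ_e (nv ''K'')) fill_prog)"

lemma mods_tables_prog [simp]: "nmods tables_prog = {''m'', ''i'', ''e''}" "rmods tables_prog = {''y'', ''v'', ''G'', ''Y''}"
  by (auto simp: tables_prog_def)

lemma row_writes_tables_prog [simp]: "row_writes ''n'' tables_prog"
  by (simp add: tables_prog_def fill_prog_def switch_prog_def)

text \<open>\<open>M\<close> enters the input size only through its logarithm, so the loop over the number of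
  pieces has to stop at \<open>min M K\<close>.\<close>

abbreviation Mp :: "noma \<Rightarrow> nat" where "Mp I \<equiv> min (mux I) (users I)"

lemma run_tables_prog:
  assumes inp: "inp I \<epsilon> s0" and v: "valid_noma I" and n: "nats s0 ''n'' [] = n" "n \<in> {1..carriers I}"
    and us: "sorted_users I n us" "\<And>i. i \<in> {1..users I} \<Longrightarrow> nats s0 ''o'' [n, i] = us i"
    and Mp: "nats s0 ''Mp'' [] = Mp I"
  shows "run tables_prog (600 * real (Mp I) * real (users I) ^ 2)
    (\<lambda>s. \<forall>m\<in>{1..Mp I}. \<forall>i\<in>{1..users I}.
      entry_ok (hh I n) us (total_power I) (Yf s n) (Gf s n) i m i) s0"
proof -
  let ?B = "total_power I" and ?K = "users I" and ?M = "Mp I"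
  let ?ok = "\<lambda>s m i. entry_ok (hh I n) us ?B (Yf s n) (Gf s n) i m i"
  let ?P = "\<lambda>m s. \<forall>m'\<in>{1..<m}. \<forall>i\<in>{1..?K}. ?ok s m' i"
  let ?c = "FOR ''i'' 1 (succ_e (nv ''K'')) fill_prog"
  have K: "1 \<le> real ?K" "1 \<le> real ?M" using v by (auto simp: valid_noma_def)
  have KK: "real ?K \<le> real ?K ^ 2" using mult_left_mono[OF K(1), of "real ?K"] by (simp add: power2_eq_square)
  have q: "8 + real ?K * 10 \<le> 100 * real ?K ^ 2" using KK K by linarith
  have "run tables_prog (600 * real ?M * real ?K ^ 2) (?P (Suc ?M)) s0" unfolding tables_prog_def
  proof (rule run_FOR[where P = ?P and B = "500 * real ?K ^ 2" and h = "Suc ?M"])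
    fix s :: state assume "unch (insert ''m'' (nmods ?c)) (rmods ?c) s0 s"
    then show "nval s (succ_e (nv ''Mp'')) = Suc ?M" using Mp by (simp add: unch_def)
  next
    fix m s assume m: "1 \<le> m" "m < Suc ?M" "nats s ''m'' [] = m"
      and u: "unch (insert ''m'' (nmods ?c)) (rmods ?c) s0 s" and P: "?P m s"
    let ?R = "\<lambda>k s. ?P m s \<and> (\<forall>i\<in>{1..<k}. ?ok s m i)"
    have "run ?c (500 * real ?K ^ 2) (?R (Suc ?K)) s"
    proof (rule run_FOR[where P = ?R and B = "400 * real ?K" and h = "Suc ?K"])
      show "?R 1 s" using P by simp
      fix t :: state assume "unch (insert ''i'' (nmods fill_prog)) (rmods fill_prog) s t"
      then have "nats t ''K'' = nats s0 ''K''" using u by (simp add: unch_def)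
      then show "nval t (succ_e (nv ''K'')) = Suc ?K" using inp by (simp add: inp_def)
    next
      fix i t assume i: "1 \<le> i" "i < Suc ?K" "nats t ''i'' [] = i"
        and ut: "unch (insert ''i'' (nmods fill_prog)) (rmods fill_prog) s t" and R: "?R i t"
      have ut: "unch {''m'', ''i'', ''e''} {''y'', ''v'', ''G'', ''Y''} s0 t"
        by (rule unch_trans[OF u ut]) auto
      have inpt: "inp I \<epsilon> t" by (rule inp_unch[OF inp ut]) (auto simp: inp_nats_def inp_reals_def)
      have tm: "nats t ''m'' [] = m" using \<open>unch _ _ s t\<close> m by (simp add: unch_def)
      have tn: "nats t ''n'' [] = n" "nats t ''o'' = nats s0 ''o''" using ut n by (auto simp: unch_def)
      have "run fill_prog (400 * real ?K) (\<lambda>s. ?ok s m i \<and>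
         (\<forall>is. is \<noteq> [n, m, i] \<longrightarrow> reals s ''Y'' is = reals t ''Y'' is \<and> reals s ''G'' is = reals t ''G'' is)) t"
      proof (rule run_fill_prog[OF inpt v tn(1) n(2) us(1) _ i(3,1) _ tm m(1)])
        show "nats t ''o'' [n, i] = us i" if "i \<in> {1..?K}" for i using us(2)[OF that] tn by simp
        show "i \<le> ?K" using i by simp
        fix e assume "1 < m" "e \<in> {1..?K}"
        then show "0 \<le> Yf t n (m - 1) e \<and> Yf t n (m - 1) e \<le> ?B" using R by (auto simp: entry_ok_def)
      qed
      then show "run fill_prog (400 * real ?K) (?R (Suc i)) t"
      proof (rule run_conseq)
        fix t' assume t': "?ok t' m i \<and>
         (\<forall>is. is \<noteq> [n, m, i] \<longrightarrow> reals t' ''Y'' is = reals t ''Y'' is \<and> reals t' ''G'' is = reals t ''G'' is)"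
        have "?ok t' m' i' = ?ok t m' i'" if "m' < m \<or> m' = m \<and> i' < i" for m' i'
        proof (rule entry_ok_cong)
          fix e assume "1 < m'"
          then have "m' - 1 \<noteq> m" using that by arith
          then show "Yf t' n (m' - 1) e = Yf t n (m' - 1) e" "Gf t' n (m' - 1) e = Gf t n (m' - 1) e"
            using t' by simp_all
        qed (use t' that in auto)
        then show "?R (Suc i) t'" using R t' by (auto simp: less_Suc_eq)
      qed simp
    qed (use q in \<open>auto simp: algebra_simps power2_eq_square\<close>)
    then show "run ?c (500 * real ?K ^ 2) (?P (Suc m)) s"
      by (rule run_conseq) (auto simp: less_Suc_eq atLeastLessThanSuc_atLeastAtMost)
  next
    have "1 * 1 \<le> real ?M * real ?K ^ 2" using K KK by (intro mult_mono) auto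
    moreover have "real ?M * 1 \<le> real ?M * real ?K ^ 2" using K KK by (intro mult_left_mono) auto
    ultimately have "8 + 10 * real ?M \<le> real ?M * (real ?K ^ 2 * 100)" by linarith
    then show "(real (Suc ?M) - real 1) * (500 * real ?K ^ 2 + 7 + ncost (succ_e (nv ''Mp''))) + 5 + ncost (succ_e (nv ''Mp'')) \<le> 600 * real ?M * real ?K ^ 2"
      by (simp add: algebra_simps)
  qed simp_all
  then show ?thesis by (rule run_conseq) (auto simp: less_Suc_eq_le)
qed

text \<open>States only what later programs need: whatever number is the maximum of the entries
  usable at \<open>x\<close> is the optimum of the carrier there. User order and exchange arguments
  stay hidden behind it. The condition on entry 1 guarantees that the maximum is never over the
  empty set.\<close>

definition tab_ok :: "noma \<Rightarrow> nat \<Rightarrow> state \<Rightarrow> bool" where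
  "tab_ok I n s \<longleftrightarrow> Yf s n (Mp I) 1 = 0 \<and> (\<forall>e\<in>{1..users I}. nats s ''o'' [n, e] \<in> {1..users I}) \<and>
     (\<forall>x v. 0 \<le> x \<longrightarrow> x \<le> total_power I \<longrightarrow>
       (\<exists>e\<in>{1..users I}. Yf s n (Mp I) e \<le> x \<and> v = Gf s n (Mp I) e + hh I n (nats s ''o'' [n, e]) x) \<longrightarrow>
       (\<forall>e\<in>{1..users I}. Yf s n (Mp I) e \<le> x \<longrightarrow> Gf s n (Mp I) e + hh I n (nats s ''o'' [n, e]) x \<le> v) \<longrightarrow>
       F_opt I n x = v)"

lemma tab_ok_cong:
  assumes "tab_ok I n s" "\<And>is. nats s' ''o'' (n # is) = nats s ''o'' (n # is)"
    "\<And>is. reals s' ''Y'' (n # is) = reals s ''Y'' (n # is)" "\<And>is. reals s' ''G'' (n # is) = reals s ''G'' (n # is)"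
  shows "tab_ok I n s'"
  using assms unfolding tab_ok_def by simp

lemma tab_okI:
  assumes v: "valid_noma I" and n: "n \<in> {1..carriers I}"
    and us: "sorted_users I n us" "\<And>i. i \<in> {1..users I} \<Longrightarrow> nats s ''o'' [n, i] = us i"
    and ok: "\<forall>m\<in>{1..Mp I}. \<forall>i\<in>{1..users I}. entry_ok (hh I n) us (total_power I) (Yf s n) (Gf s n) i m i"
  shows "tab_ok I n s"
proof -
  let ?K = "users I"
  have K: "1 \<le> ?K" "1 \<le> Mp I" using v by (auto simp: valid_noma_def)
  have usK: "us e \<in> {1..?K}" if "e \<in> {1..?K}" for e using us(1) that by (auto simp: sorted_users_def)
  have usim: "us ` {1..?K} = {1..?K}" using us(1) by (simp add: sorted_users_def)
  \<comment> \<open>For entry \<open>i\<close> the predecessor loop has ended at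
    \<open>b = i\<close>, so all smaller indices have been compared.\<close>
  interpret user_tables "hh I n" us ?K "Mp I" "total_power I" "Yf s n" "Gf s n"
  proof
    fix i j assume *: "1 \<le> j" "j < i" "i \<le> ?K"
    then show "quasiconcave (\<lambda>x. hh I n (us j) x - hh I n (us i) x)"
      using us(1) by (intro hh_quasiconcave[OF v n] usK) (auto simp: sorted_users_def)
  next
    fix m i assume *: "1 \<le> m" "m \<le> Mp I" "1 \<le> i" "i \<le> ?K"
    then have e: "entry_ok (hh I n) us (total_power I) (Yf s n) (Gf s n) i m i" using ok by simp
    then show "Yf s n m i = 0 \<and> Gf s n m i = - hh I n (us i) 0 \<or>
      1 < m \<and> Yf s n m i \<le> total_power I \<and> (\<exists>e. 1 \<le> e \<and> e < i \<and> Yf s n (m - 1) e \<le> Yf s n m i \<and>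
        Gf s n m i = Gf s n (m - 1) e + hh I n (us e) (Yf s n m i) - hh I n (us i) (Yf s n m i))"
      unfolding entry_ok_def by blast
    assume "m = 1 \<or> i = 1"
    then show "Yf s n m i = 0 \<and> Gf s n m i = - hh I n (us i) 0" using e unfolding entry_ok_def by blast
  next
    fix m i e y assume *: "1 < m" "m \<le> Mp I" "i \<le> ?K" "1 \<le> e" "e < i" "Yf s n (m - 1) e \<le> y" "y \<le> total_power I"
    then have "entry_ok (hh I n) us (total_power I) (Yf s n) (Gf s n) i m i" using ok by simp
    then show "Gf s n (m - 1) e + hh I n (us e) y - hh I n (us i) y \<le> Gf s n m i"
      using * unfolding entry_ok_def by blast
  qed
  show ?thesis unfolding tab_ok_def
  proof (intro conjI allI impI ballI)
    show "Yf s n (Mp I) 1 = 0" using base[of "Mp I" 1] K by simp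
    show "nats s ''o'' [n, e] \<in> {1..?K}" if "e \<in> {1..?K}" for e using us(2)[OF that] usK[OF that] by simp
  next
    fix x v assume x: "0 \<le> x" "x \<le> total_power I"
      and ex: "\<exists>e\<in>{1..?K}. Yf s n (Mp I) e \<le> x \<and> v = Gf s n (Mp I) e + hh I n (nats s ''o'' [n, e]) x"
      and le: "\<forall>e\<in>{1..?K}. Yf s n (Mp I) e \<le> x \<longrightarrow> Gf s n (Mp I) e + hh I n (nats s ''o'' [n, e]) x \<le> v"
    show "F_opt I n x = v"
    proof (rule F_opt_eqI[OF \<open>valid_noma I\<close> n])
      obtain e where e: "e \<in> {1..?K}" "Yf s n (Mp I) e \<le> x" "v = Gf s n (Mp I) e + hh I n (us e) x"
        using ex us(2) by auto
      have "attain (hh I n) (us ` {1..e}) (Mp I) x v"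
        using attain_table[of "Mp I" e x] e K by simp
      then show "attain (hh I n) {1..?K} (Mp I) x v"
      proof (rule attain_subset)
        have "{1..e} \<subseteq> {1..?K}" using e(1) by simp
        then show "us ` {1..e} \<subseteq> {1..?K}" using usim by blast
      qed
    next
      fix r assume "attain (hh I n) {1..?K} (Mp I) x r"
      then obtain e where e: "1 \<le> e" "e \<le> ?K" "Yf s n (Mp I) e \<le> x" "r \<le> Gf s n (Mp I) e + hh I n (us e) x"
        using attain_le_table[of "Mp I" ?K x r] K x unfolding usim by blast
      have "Gf s n (Mp I) e + hh I n (nats s ''o'' [n, e]) x \<le> v"
        using le[rule_format, of e] e by simp
      then show "r \<le> v" using e us(2)[of e] by simp
    qed
  qed
qed

definition prep_prog :: com where
  "prep_prog = FOR ''n'' 1 (succ_e (nv ''N'')) (CSeq sort_prog tables_prog)"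

lemma mods_prep_prog [simp]: "nmods prep_prog = {''n'', ''i'', ''r'', ''e'', ''o'', ''m''}"
  "rmods prep_prog = {''y'', ''v'', ''G'', ''Y''}"
  by (auto simp: prep_prog_def)

lemma run_prep_prog:
  assumes inp: "inp I \<epsilon> s0" and v: "valid_noma I" and Mp: "nats s0 ''Mp'' [] = Mp I"
  shows "run prep_prog (1000 * (real (carriers I) * real (Mp I) * real (users I) ^ 2))
    (\<lambda>s. \<forall>n\<in>{1..carriers I}. tab_ok I n s) s0"
proof -
  let ?K = "users I" and ?M = "Mp I" and ?N = "carriers I"
  let ?c = "CSeq sort_prog tables_prog"
  let ?P = "\<lambda>k s. \<forall>n\<in>{1..<k}. tab_ok I n s"
  have K: "1 \<le> ?K" "1 \<le> real ?K" "1 \<le> real ?M" "1 \<le> real ?N" using v by (auto simp: valid_noma_def)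
  have KK: "real ?K \<le> real ?K ^ 2" using mult_left_mono[OF K(2), of "real ?K"] by (simp add: power2_eq_square)
  have MK: "1 \<le> real ?M * real ?K ^ 2" using mult_mono[of 1 "real ?M" 1 "real ?K ^ 2"] K KK by simp
  have KM: "real ?K ^ 2 \<le> real ?M * real ?K ^ 2" using mult_right_mono[OF K(3), of "real ?K ^ 2"] by simp
  have "run prep_prog (1000 * (real ?N * real ?M * real ?K ^ 2)) (?P (Suc ?N)) s0" unfolding prep_prog_def
  proof (rule run_FOR[where P = ?P and B = "800 * (real ?M * real ?K ^ 2)" and h = "Suc ?N"])
    show "?P k s \<Longrightarrow> ?P k (nupdate s ''n'' [] w)" for k s w by (auto intro: tab_ok_cong)
    fix s :: state assume "unch (insert ''n'' (nmods ?c)) (rmods ?c) s0 s"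
    then show "nval s (succ_e (nv ''N'')) = Suc ?N" using inp by (simp add: unch_def inp_def)
  next
    fix n s assume n: "1 \<le> n" "n < Suc ?N" "nats s ''n'' [] = n"
      and u: "unch (insert ''n'' (nmods ?c)) (rmods ?c) s0 s" and P: "?P n s"
    have n': "n \<in> {1..?N}" using n by simp
    have u: "unch {''n'', ''i'', ''r'', ''e'', ''o'', ''m''} {''y'', ''v'', ''G'', ''Y''} s0 s" by (rule unch_mono[OF u]) auto
    have inps: "inp I \<epsilon> s" by (rule inp_unch[OF inp u]) (auto simp: inp_nats_def inp_reals_def)
    have Mps: "nats s ''Mp'' [] = Mp I" using u Mp by (simp add: unch_def)
    let ?r = "rank (noise I n) ?K"
    \<comment> \<open>A rank sends users to positions, whereas the tables are indexed by position;
      so the inverse map is needed.\<close>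
    define us where "us = inv_into {1..?K} ?r"
    have bij: "bij_betw us {1..?K} {1..?K}" unfolding us_def by (rule bij_betw_inv_into[OF rank_bij])
    have usK: "us i \<in> {1..?K}" "?r (us i) = i" if "i \<in> {1..?K}" for i
      using bij_betwE[OF bij] that bij_betw_inv_into_right[OF rank_bij that, of "noise I n"] by (auto simp: us_def)
    have sorted: "sorted_users I n us" unfolding sorted_users_def
    proof (intro conjI allI impI)
      show "us ` {1..?K} = {1..?K}" using bij by (simp add: bij_betw_def)
      fix i j assume "1 \<le> i" "i \<le> j" "j \<le> ?K"
      then show "noise I n (us i) \<le> noise I n (us j)" using usK[of i] usK[of j]
        by (intro rank_sorted[of "noise I n" ?K]) auto
    qed
    have "run ?c (200 * real ?K ^ 2 + 600 * real ?M * real ?K ^ 2) (tab_ok I n) s"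
    proof (rule run_Seq[OF run_sort_prog[OF inps n(3) n' K(1)] _ order_refl])
      fix s1 assume u1: "unch (nmods sort_prog) (rmods sort_prog) s s1"
        and o: "\<forall>i\<in>{1..?K}. nats s1 ''o'' [n, ?r i] = i"
      have os: "nats s1 ''o'' [n, i] = us i" if "i \<in> {1..?K}" for i using o usK[OF that] by metis
      have inp1: "inp I \<epsilon> s1" by (rule inp_unch[OF inps u1]) (auto simp: inp_nats_def inp_reals_def)
      have "nats s1 ''n'' [] = n" "nats s1 ''Mp'' [] = Mp I" using u1 n Mps by (auto simp: unch_def)
      from run_tables_prog[OF inp1 v this(1) n' sorted os this(2)]
      show "run tables_prog (600 * real ?M * real ?K ^ 2) (tab_ok I n) s1"
      proof (rule run_conseq)
        fix s' assume u': "unch (nmods tables_prog) (rmods tables_prog) s1 s'"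
          and ok: "\<forall>m\<in>{1..Mp I}. \<forall>i\<in>{1..?K}. entry_ok (hh I n) us (total_power I) (Yf s' n) (Gf s' n) i m i"
        have "nats s' ''o'' = nats s1 ''o''" using u' by (simp add: unch_def)
        then show "tab_ok I n s'" using tab_okI[OF v n' sorted _ ok] os by simp
      qed (assumption | rule order_refl)+
    qed
    then show "run ?c (800 * (real ?M * real ?K ^ 2)) (?P (Suc n)) s"
    proof (rule run_row_frame[where n = "''n''"])
      fix s' assume f: "row_frame (nats s ''n'' []) s s'" and ok: "tab_ok I n s'"
      have "tab_ok I k s'" if "k \<in> {1..<n}" for k
      proof (rule tab_ok_cong)
        show "tab_ok I k s" using P that by simp
      qed (use row_frameD[OF f] n that in auto)
      then show "?P (Suc n) s'" using ok by (auto simp: less_Suc_eq)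
    qed (use KM in auto)
  next
    have "real ?N * 1 \<le> real ?N * (real ?M * real ?K ^ 2)" using K MK by (intro mult_left_mono) auto
    then have "8 + real ?N * 10 \<le> real ?N * (real ?M * (real ?K ^ 2 * 200))"
      using K(4) unfolding mult.assoc[symmetric] by linarith
    then show "(real (Suc ?N) - real 1) * (800 * (real ?M * real ?K ^ 2) + 7 + ncost (succ_e (nv ''N''))) + 5 + ncost (succ_e (nv ''N''))
        \<le> 1000 * (real ?N * real ?M * real ?K ^ 2)"
      by (simp add: algebra_simps)
  qed simp_all
  then show ?thesis by (rule run_conseq) (auto simp: less_Suc_eq_le)
qed

text \<open>Only the row for \<open>Mp\<close> pieces is read: \<open>attain\<close> counts pieces
  up to a maximum, so this row already bounds allocations with fewer pieces. Hence a query costs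
  \<open>O(K)\<close> whatever \<open>M\<close> is.\<close>

definition query_prog :: com where
  "query_prog = CSeq (RAssign ''v'' [] (RAdd (G_e (nv ''Mp'') (NConst 1)) (h_e (ord_e (NConst 1)) (rv ''x''))))
     (FOR ''i'' 2 (succ_e (nv ''K''))
       (CIf (BAnd (BNot (RLess (rv ''x'') (Y_e (nv ''Mp'') (nv ''i''))))
             (RLess (rv ''v'') (RAdd (G_e (nv ''Mp'') (nv ''i'')) (h_e (ord_e (nv ''i'')) (rv ''x'')))))
         (RAssign ''v'' [] (RAdd (G_e (nv ''Mp'') (nv ''i'')) (h_e (ord_e (nv ''i'')) (rv ''x'')))) CSkip))"

lemma mods_query_prog [simp]: "nmods query_prog = {''i''}" "rmods query_prog = {''v''}"
  by (auto simp: query_prog_def)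

lemma row_writes_query_prog [simp]: "row_writes ''n'' query_prog"
  by (simp add: query_prog_def)

lemma run_query_prog:
  assumes inp: "inp I \<epsilon> s0" and v: "valid_noma I" and n: "nats s0 ''n'' [] = n" "n \<in> {1..carriers I}"
    and tab: "tab_ok I n s0" and Mp: "nats s0 ''Mp'' [] = Mp I"
    and x: "0 \<le> reals s0 ''x'' []" "reals s0 ''x'' [] \<le> total_power I"
  shows "run query_prog (200 * real (users I)) (\<lambda>s. reals s ''v'' [] = F_opt I n (reals s0 ''x'' [])) s0"
proof -
  let ?x = "reals s0 ''x'' []" and ?K = "users I"
  let ?g = "\<lambda>e. Gf s0 n (Mp I) e + hh I n (nats s0 ''o'' [n, e]) ?x"
  let ?c = "CIf (BAnd (BNot (RLess (rv ''x'') (Y_e (nv ''Mp'') (nv ''i''))))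
             (RLess (rv ''v'') (RAdd (G_e (nv ''Mp'') (nv ''i'')) (h_e (ord_e (nv ''i'')) (rv ''x'')))))
         (RAssign ''v'' [] (RAdd (G_e (nv ''Mp'') (nv ''i'')) (h_e (ord_e (nv ''i'')) (rv ''x'')))) CSkip"
  let ?P = "\<lambda>k s. (\<exists>e\<in>{1..<k}. Yf s0 n (Mp I) e \<le> ?x \<and> reals s ''v'' [] = ?g e) \<and>
      (\<forall>e\<in>{1..<k}. Yf s0 n (Mp I) e \<le> ?x \<longrightarrow> ?g e \<le> reals s ''v'' [])"
  have K: "1 \<le> ?K" "1 \<le> real ?K" using v by (auto simp: valid_noma_def)
  have oK: "nats s0 ''o'' [n, e] \<in> {1..?K}" if "e \<in> {1..?K}" for e using tab that by (auto simp: tab_ok_def)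
  have h: "rval s (h_e (ord_e i) (rv ''x'')) = hh I n (nats s0 ''o'' [n, nval s i]) ?x"
    if u: "unch {''i''} {''v''} s0 s" and i: "nval s i \<in> {1..?K}" for s i
  proof -
    have "inp I \<epsilon> s" by (rule inp_unch[OF inp u]) (auto simp: inp_nats_def inp_reals_def)
    moreover have "nats s ''n'' [] = n" "nats s ''o'' = nats s0 ''o''" "reals s ''x'' = reals s0 ''x''"
      using u n by (auto simp: unch_def)
    ultimately show ?thesis using rval_h_e[of I \<epsilon> s n "ord_e i" "rv ''x''"] v n oK[OF i] x by simp
  qed
  let ?s = "rupdate s0 ''v'' [] (?g 1)"
  have h1: "rval s0 (h_e (ord_e (NConst 1)) (rv ''x'')) = hh I n (nats s0 ''o'' [n, 1]) ?x"
    using h[of s0 "NConst 1"] K by simp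
  \<comment> \<open>The first entry has switching point 0, so it is usable at every budget and may
    initialise the maximum.\<close>
  have Y1: "Yf s0 n (Mp I) 1 = 0" using tab by (simp add: tab_ok_def)
  have "run (FOR ''i'' 2 (succ_e (nv ''K'')) ?c) (140 * real ?K + 10) (?P (Suc ?K)) ?s"
  proof (rule run_FOR[where P = ?P and B = 120 and h = "Suc ?K"])
    show "?P 2 ?s" using Y1 x by (auto simp: less_Suc_eq numeral_2_eq_2)
    show "2 \<le> Suc ?K" using K by simp
    fix s :: state assume "unch (insert ''i'' (nmods ?c)) (rmods ?c) ?s s"
    then have "nats s ''K'' = nats s0 ''K''" by (simp add: unch_def)
    then show "nval s (succ_e (nv ''K'')) = Suc ?K" using inp by (simp add: inp_def)
  next
    fix i s assume i: "2 \<le> i" "i < Suc ?K" "nats s ''i'' [] = i"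
      and u: "unch (insert ''i'' (nmods ?c)) (rmods ?c) ?s s" and P: "?P i s"
    have u: "unch {''i''} {''v''} s0 s" using u by (simp add: unch_def)
    have hi: "rval s (h_e (ord_e (nv ''i'')) (rv ''x'')) = hh I n (nats s0 ''o'' [n, i]) ?x"
      using h[OF u, of "nv ''i''"] i by simp
    have e: "nats s ''n'' [] = n" "nats s ''Mp'' [] = Mp I" "reals s ''x'' = reals s0 ''x''"
      "reals s ''Y'' = reals s0 ''Y''" "reals s ''G'' = reals s0 ''G''"
      using u n Mp by (auto simp: unch_def)
    show "run ?c 120 (?P (Suc i)) s"
    proof (cases "Yf s0 n (Mp I) i \<le> ?x \<and> reals s ''v'' [] < ?g i")
      case True
      then have "?P (Suc i) (rupdate s ''v'' [] (?g i))" using P i by (auto simp: less_Suc_eq intro: order_trans less_imp_le)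
      then show ?thesis using True by (simp add: hi e i)
    next
      case False
      then have "?P (Suc i) s" using P i by (auto simp: less_Suc_eq)
      then show ?thesis using False by (auto simp: hi e i)
    qed
  qed auto
  then have "run (FOR ''i'' 2 (succ_e (nv ''K'')) ?c) (200 * real ?K - 22) (\<lambda>s. reals s ''v'' [] = F_opt I n ?x) ?s"
  proof (rule run_conseq)
    fix s assume "?P (Suc ?K) s"
    then have "\<exists>e\<in>{1..?K}. Yf s0 n (Mp I) e \<le> ?x \<and> reals s ''v'' [] = ?g e"
      "\<forall>e\<in>{1..?K}. Yf s0 n (Mp I) e \<le> ?x \<longrightarrow> ?g e \<le> reals s ''v'' []" by (auto simp: less_Suc_eq_le)
    then show "reals s ''v'' [] = F_opt I n ?x" using tab x unfolding tab_ok_def by metis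
  qed (use K in simp)
  then show ?thesis unfolding query_prog_def using n Mp h1 by simp
qed

section \<open>The programs of the knapsack step\<close>

definition ready :: "noma \<Rightarrow> real \<Rightarrow> state \<Rightarrow> bool" where
  "ready I \<epsilon> s \<longleftrightarrow> inp I \<epsilon> s \<and> bits_ok (num_bits (J_levels I)) s \<and> nats s ''J'' [] = J_levels I \<and>
     nats s ''Mp'' [] = Mp I \<and> (\<forall>n\<in>{1..carriers I}. tab_ok I n s)"

definition ready_nats :: "vname set" where
  "ready_nats = {''K'', ''N'', ''M'', ''B'', ''pw'', ''J'', ''Mp'', ''o''}"
definition ready_reals :: "vname set" where
  "ready_reals = {''w'', ''W'', ''Pn'', ''eta'', ''Pmax'', ''delta'', ''eps'', ''Y'', ''G''}"

lemma ready_unch: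
  assumes "ready I \<epsilon> s" "unch X Y s s'" "X \<inter> ready_nats = {}" "Y \<inter> ready_reals = {}"
  shows "ready I \<epsilon> s'"
proof -
  have n: "nats s' x = nats s x" if "x \<in> ready_nats" for x using assms that by (auto simp: unch_def)
  have r: "reals s' x = reals s x" if "x \<in> ready_reals" for x using assms that by (auto simp: unch_def)
  have "tab_ok I n s'" if "n \<in> {1..carriers I}" for n
    by (rule tab_ok_cong[of I n s]) (use assms(1) that n r in \<open>auto simp: ready_def ready_nats_def ready_reals_def\<close>)
  then show ?thesis using assms(1) n r
    by (simp add: ready_def inp_def bits_ok_def ready_nats_def ready_reals_def)
qed

lemma ready_upd [simp]: "x \<notin> ready_nats \<Longrightarrow> ready I \<epsilon> s \<Longrightarrow> ready I \<epsilon> (nupdate s x is k)"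
  "y \<notin> ready_reals \<Longrightarrow> ready I \<epsilon> s \<Longrightarrow> ready I \<epsilon> (rupdate s y is r)"
  by (erule ready_unch[of I \<epsilon> s "{x}" "{}"]; simp add: unch_def)
    (erule ready_unch[of I \<epsilon> s "{}" "{y}"]; simp add: unch_def)

definition Fl :: "noma \<Rightarrow> nat \<Rightarrow> nat \<Rightarrow> real" where
  "Fl I n l = F_opt I n (real l * power_unit I)"

text \<open>Truncation at \<open>J\<close> loses no feasible vector. It keeps the binary searches
  within the bits of \<open>J\<close> and makes a single full carrier feasible.\<close>

definition cap_levels :: "noma \<Rightarrow> nat \<Rightarrow> nat" where
  "cap_levels I n = min (J_levels I) (nat \<lfloor>carrier_power I n / power_unit I\<rfloor>)"

lemma le_cap_levels_iff:
  assumes "valid_noma I" "n \<in> {1..carriers I}"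
  shows "l \<le> cap_levels I n \<longleftrightarrow> l \<le> J_levels I \<and> real l * power_unit I \<le> carrier_power I n"
proof -
  have d: "0 < power_unit I" "0 \<le> carrier_power I n" using assms by (auto simp: valid_noma_def)
  have "real l * power_unit I \<le> carrier_power I n \<longleftrightarrow> of_int (int l) \<le> carrier_power I n / power_unit I"
    using d by (simp add: pos_le_divide_eq)
  also have "\<dots> \<longleftrightarrow> int l \<le> \<lfloor>carrier_power I n / power_unit I\<rfloor>" by (rule le_floor_iff[symmetric])
  also have "\<dots> \<longleftrightarrow> l \<le> nat \<lfloor>carrier_power I n / power_unit I\<rfloor>" using d by (auto simp: le_nat_iff)
  finally show ?thesis by (simp add: cap_levels_def)
qed

definition level_prog :: "nexp \<Rightarrow> com" where
  "level_prog e = CSeq (RAssign ''x'' [] (RMul (OfNat e) (rv ''delta''))) query_prog"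

lemma mods_level_prog [simp]: "nmods (level_prog e) = {''i''}" "rmods (level_prog e) = {''x'', ''v''}"
  by (auto simp: level_prog_def)

lemma row_writes_level_prog [simp]: "row_writes ''n'' (level_prog e)"
  by (simp add: level_prog_def)

lemma run_level_prog:
  assumes r: "ready I \<epsilon> s" and v: "valid_noma I" and n: "nats s ''n'' [] = n" "n \<in> {1..carriers I}"
    and l: "nval s e = l" "l \<le> J_levels I" and C: "200 * real (users I) + 4 + ncost e \<le> C"
  shows "run (level_prog e) C (\<lambda>s. reals s ''v'' [] = Fl I n l) s"
proof -
  have d: "reals s ''delta'' [] = power_unit I" using r by (simp add: ready_def inp_def)
  let ?s = "rupdate s ''x'' [] (real l * power_unit I)"
  have rs: "ready I \<epsilon> ?s" using r by (simp add: ready_reals_def)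
  have p: "0 < power_unit I" using v by (simp add: valid_noma_def)
  have "run query_prog (200 * real (users I)) (\<lambda>s. reals s ''v'' [] = F_opt I n (reals ?s ''x'' [])) ?s"
    by (rule run_query_prog[OF _ v _ n(2)])
      (use rs n l p le_J_levels_iff[OF v, of l] in \<open>auto simp: ready_def\<close>)
  then have "run query_prog (C - real (4 + ncost e)) (\<lambda>s. reals s ''v'' [] = Fl I n l) ?s"
    by (rule run_conseq) (use C in \<open>auto simp: Fl_def\<close>)
  then show ?thesis by (simp add: level_prog_def d l)
qed

definition caps_prog :: com where
  "caps_prog = CSeq (RAssign ''U'' [] (OfNat (NConst 0))) (FOR ''n'' 1 (succ_e (nv ''N''))
    (CSeq (bsearch (CIf (BAnd (BNot (RLess (RVar ''Pn'' [nv ''n'']) (RMul (OfNat (nv ''q'')) (rv ''delta''))))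
         (BNot (NLess (nv ''J'') (nv ''q'')))) (NAssign ''f'' [] (NConst 1)) (NAssign ''f'' [] (NConst 0))))
    (CSeq (NAssign ''cap'' [nv ''n''] (nv ''l''))
    (CSeq (level_prog (nv ''l''))
    (CSeq (RAssign ''u'' [nv ''n''] (rv ''v''))
      (CIf (RLess (rv ''U'') (rv ''v'')) (RAssign ''U'' [] (rv ''v'')) CSkip))))))"

lemma mods_caps_prog [simp]: "nmods caps_prog = {''n'', ''l'', ''c'', ''q'', ''f'', ''cap'', ''i''}"
  "rmods caps_prog = {''U'', ''x'', ''v'', ''u''}"
  by (auto simp: caps_prog_def)

text \<open>\<open>U\<close> is accumulated from 0, hence the alternative \<open>U = 0\<close>; a
  positive \<open>U\<close> is the value of some carrier filled to its cap, and so a value that is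
  attained.\<close>

definition caps_ok :: "noma \<Rightarrow> state \<Rightarrow> bool" where
  "caps_ok I s \<longleftrightarrow> (\<forall>n\<in>{1..carriers I}. nats s ''cap'' [n] = cap_levels I n \<and>
     reals s ''u'' [n] = Fl I n (cap_levels I n) \<and> Fl I n (cap_levels I n) \<le> reals s ''U'' []) \<and>
     (reals s ''U'' [] = 0 \<or> (\<exists>n\<in>{1..carriers I}. reals s ''U'' [] = Fl I n (cap_levels I n)))"

lemma run_caps_prog:
  assumes r: "ready I \<epsilon> s0" and v: "valid_noma I" and J: "1 \<le> J_levels I"
  shows "run caps_prog (500 * (real (carriers I) * real (num_bits (J_levels I)) * real (users I))) (caps_ok I) s0"
proof -
  let ?N = "carriers I" and ?K = "users I" and ?b = "num_bits (J_levels I)"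
  let ?t = "CIf (BAnd (BNot (RLess (RVar ''Pn'' [nv ''n'']) (RMul (OfNat (nv ''q'')) (rv ''delta''))))
         (BNot (NLess (nv ''J'') (nv ''q'')))) (NAssign ''f'' [] (NConst 1)) (NAssign ''f'' [] (NConst 0))"
  let ?d = "CSeq (RAssign ''u'' [nv ''n''] (rv ''v''))
      (CIf (RLess (rv ''U'') (rv ''v'')) (RAssign ''U'' [] (rv ''v'')) CSkip)"
  let ?c = "CSeq (bsearch ?t) (CSeq (NAssign ''cap'' [nv ''n''] (nv ''l'')) (CSeq (level_prog (nv ''l'')) ?d))"
  let ?P = "\<lambda>k s. (\<forall>n\<in>{1..<k}. nats s ''cap'' [n] = cap_levels I n \<and>
     reals s ''u'' [n] = Fl I n (cap_levels I n) \<and> Fl I n (cap_levels I n) \<le> reals s ''U'' []) \<and>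
     (reals s ''U'' [] = 0 \<or> (\<exists>n\<in>{1..<k}. reals s ''U'' [] = Fl I n (cap_levels I n)))"
  let ?s = "rupdate s0 ''U'' [] 0"
  have K: "1 \<le> real ?K" "1 \<le> real ?N" "1 \<le> real ?b"
    using v num_bits_pos[OF J] by (auto simp: valid_noma_def)
  have "real ?b \<le> real ?b * real ?K" "real ?K \<le> real ?b * real ?K"
    using mult_left_mono[OF K(1), of "real ?b"] mult_right_mono[OF K(3), of "real ?K"] by auto
  then have bK: "real ?b \<le> real ?b * real ?K" "real ?K \<le> real ?b * real ?K" "1 \<le> real ?b * real ?K"
    using K(1) by linarith+
  have rs: "ready I \<epsilon> ?s" using r by (simp add: ready_reals_def)
  have loop: "run (FOR ''n'' 1 (succ_e (nv ''N'')) ?c) (490 * (real ?N * (real ?b * real ?K))) (?P (Suc ?N)) ?s"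
  proof (rule run_FOR[where P = ?P and B = "400 * (real ?b * real ?K)" and h = "Suc ?N"])
    fix s :: state assume "unch (insert ''n'' (nmods ?c)) (rmods ?c) ?s s"
    then show "nval s (succ_e (nv ''N'')) = Suc ?N" using r by (simp add: unch_def ready_def inp_def)
  next
    fix n s assume n: "1 \<le> n" "n < Suc ?N" "nats s ''n'' [] = n"
      and u: "unch (insert ''n'' (nmods ?c)) (rmods ?c) ?s s" and P: "?P n s"
    have n': "n \<in> {1..?N}" using n by simp
    have rds: "ready I \<epsilon> s" by (rule ready_unch[OF rs u]) (auto simp: ready_nats_def ready_reals_def)
    show "run ?c (400 * (real ?b * real ?K)) (?P (Suc n)) s"
    proof (rule run_Seq[where ?B1.0 = "60 * real ?b + 13" and ?B2.0 = "200 * real ?K + 50"])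
      show "run (bsearch ?t) (60 * real ?b + 13) (\<lambda>s. nats s ''l'' [] \<le> cap_levels I n \<and> \<not> Suc (nats s ''l'' []) \<le> cap_levels I n) s"
      proof (rule run_bsearch[where T = 30 and b = ?b])
        show "bits_ok ?b s" using rds by (simp add: ready_def)
        show "\<not> 2 ^ ?b \<le> cap_levels I n" using less_num_bits[of "J_levels I"] by (simp add: cap_levels_def)
      next
        fix t :: state and m assume ut: "unch ({''l'', ''c'', ''q''} \<union> nmods ?t) (rmods ?t) s t" and q: "nats t ''q'' [] = m"
        have rt: "ready I \<epsilon> t" by (rule ready_unch[OF rds ut]) (auto simp: ready_nats_def)
        have "nats t ''n'' [] = n" using ut n by (simp add: unch_def)
        then show "run ?t 30 (\<lambda>s'. 0 < nats s' ''f'' [] \<longleftrightarrow> m \<le> cap_levels I n) t"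
          using rt q n' by (auto simp: le_cap_levels_iff[OF v n'] ready_def inp_def)
      qed auto
    next
      fix s1 assume u1: "unch (nmods (bsearch ?t)) (rmods (bsearch ?t)) s s1"
        and "nats s1 ''l'' [] \<le> cap_levels I n \<and> \<not> Suc (nats s1 ''l'' []) \<le> cap_levels I n"
      then have l: "nats s1 ''l'' [] = cap_levels I n" by simp
      let ?s1 = "nupdate s1 ''cap'' [n] (cap_levels I n)"
      have r1: "ready I \<epsilon> s1" by (rule ready_unch[OF rds u1]) (auto simp: ready_nats_def)
      then have r2: "ready I \<epsilon> ?s1" by (simp add: ready_nats_def)
      have n1: "nats s1 ''n'' [] = n" using u1 n by (simp add: unch_def)
      have "run (CSeq (level_prog (nv ''l'')) ?d) (200 * real ?K + 40) (?P (Suc n)) ?s1"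
      proof (rule run_Seq[where ?B1.0 = "200 * real ?K + 5" and ?B2.0 = 20])
        show "run (level_prog (nv ''l'')) (200 * real ?K + 5) (\<lambda>s. reals s ''v'' [] = Fl I n (cap_levels I n)) ?s1"
          by (rule run_level_prog[OF r2 v _ n']) (use n1 l in \<open>auto simp: cap_levels_def\<close>)
      next
        fix s2 assume u2: "unch (nmods (level_prog (nv ''l''))) (rmods (level_prog (nv ''l''))) ?s1 s2"
          and v2: "reals s2 ''v'' [] = Fl I n (cap_levels I n)"
        have e: "nats s2 ''n'' [] = n" "nats s2 ''cap'' = (nats s ''cap'')([n] := cap_levels I n)"
          "reals s2 ''u'' = reals s ''u''" "reals s2 ''U'' = reals s ''U''"
          using u1 u2 n1 by (auto simp: unch_def)
        have iv: "{1..<Suc n} = insert n {1..<n}" using n by auto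
        show "run ?d 20 (?P (Suc n)) s2"
        proof (cases "reals s ''U'' [] < Fl I n (cap_levels I n)")
          case True
          then have "\<forall>k\<in>{1..<n}. Fl I k (cap_levels I k) \<le> Fl I n (cap_levels I n)"
            using P by (meson less_imp_le order_trans)
          then show ?thesis using P True unfolding iv by (simp add: e v2)
        next
          case False
          then show ?thesis using P unfolding iv by (auto simp: e v2)
        qed
      qed simp
      then show "run (CSeq (NAssign ''cap'' [nv ''n''] (nv ''l'')) (CSeq (level_prog (nv ''l'')) ?d)) (200 * real ?K + 50) (?P (Suc n)) s1"
        by (simp add: n1 l, elim run_conseq) auto
    next
      show "60 * real ?b + 13 + (200 * real ?K + 50) \<le> 400 * (real ?b * real ?K)" using bK by linarith
    qed
  next
    have "real ?N * 1 \<le> real ?N * (real ?b * real ?K)" using K bK by (intro mult_left_mono) auto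
    then have "8 + real ?N * 10 \<le> 90 * (real ?N * (real ?b * real ?K))" using K by linarith
    then show "(real (Suc ?N) - real 1) * (400 * (real ?b * real ?K) + 7 + ncost (succ_e (nv ''N''))) + 5 + ncost (succ_e (nv ''N''))
        \<le> 490 * (real ?N * (real ?b * real ?K))" by (simp add: algebra_simps)
  qed auto
  have "real ?N * 1 \<le> real ?N * (real ?b * real ?K)" using K bK by (intro mult_left_mono) auto
  then have C: "490 * (real ?N * (real ?b * real ?K)) \<le> 500 * (real ?N * real ?b * real ?K) - 3"
    unfolding mult.assoc using K(2) by linarith
  from loop have "run (FOR ''n'' 1 (succ_e (nv ''N'')) ?c) (500 * (real ?N * real ?b * real ?K) - 3) (caps_ok I) ?s"
    by (rule run_conseq[OF _ C]) (simp add: caps_ok_def atLeastLessThanSuc_atLeastAtMost)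
  then show ?thesis unfolding caps_prog_def by simp
qed

section \<open>Filling the knapsack table and tracing choices back\<close>

lemma dp_row_cong:
  assumes "D' n j = D n j" "ch' n j = ch n j" "\<And>i. D' (n - 1) i = D (n - 1) i"
  shows "dp_row L c H D' ch' n j = dp_row L c H D ch n j"
  unfolding dp_row_def assms ..

abbreviation Df :: "state \<Rightarrow> nat \<Rightarrow> nat \<Rightarrow> real" where "Df s n j \<equiv> reals s ''D'' [n, j]"
abbreviation chf :: "state \<Rightarrow> nat \<Rightarrow> nat \<Rightarrow> nat" where "chf s n j \<equiv> nats s ''ch'' [n, j]"

definition cell_prog :: com where
  "cell_prog = CSeq (RAssign ''D'' [nv ''n'', nv ''j''] (RAdd (RVar ''D'' [pred_e (nv ''n''), nv ''j'']) (RVar ''c'' [nv ''n'', NConst 0])))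
    (CSeq (NAssign ''ch'' [nv ''n'', nv ''j''] (NConst 0))
    (CSeq (CIf (NLess (nv ''j'') (NVar ''L'' [nv ''n''])) (NAssign ''h'' [] (nv ''j'')) (NAssign ''h'' [] (NVar ''L'' [nv ''n''])))
    (FOR ''a'' 1 (succ_e (nv ''h''))
      (CSeq (RAssign ''y'' [] (RAdd (RVar ''D'' [pred_e (nv ''n''), NSub (nv ''j'') (nv ''a'')]) (RVar ''c'' [nv ''n'', nv ''a''])))
      (CIf (RLess (RVar ''D'' [nv ''n'', nv ''j'']) (rv ''y''))
        (CSeq (RAssign ''D'' [nv ''n'', nv ''j''] (rv ''y'')) (NAssign ''ch'' [nv ''n'', nv ''j''] (nv ''a''))) CSkip)))))"

lemma mods_cell_prog [simp]: "nmods cell_prog = {''ch'', ''h'', ''a''}" "rmods cell_prog = {''D'', ''y''}"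
  by (auto simp: cell_prog_def)

lemma row_writes_cell_prog [simp]: "row_writes ''n'' cell_prog"
  by (simp add: cell_prog_def)

lemma run_cell_prog:
  assumes n: "nats s0 ''n'' [] = n" "1 \<le> n" and j: "nats s0 ''j'' [] = j"
    and L: "nats s0 ''L'' [n] = L n" "L n \<le> Lm" and c: "\<And>a. a \<le> L n \<Longrightarrow> reals s0 ''c'' [n, a] = c n a"
  shows "run cell_prog (100 * (real Lm + 1))
    (\<lambda>s. dp_row L c T (Df s) (chf s) n j \<and>
      (\<forall>is. is \<noteq> [n, j] \<longrightarrow> reals s ''D'' is = reals s0 ''D'' is \<and> nats s ''ch'' is = nats s0 ''ch'' is)) s0"
proof -
  let ?H = "min j (L n)"
  let ?same = "\<lambda>s. \<forall>is. is \<noteq> [n, j] \<longrightarrow> reals s ''D'' is = reals s0 ''D'' is \<and> nats s ''ch'' is = nats s0 ''ch'' is"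
  \<comment> \<open>The horizon of \<open>dp_row\<close> follows the loop counter: at counter
    \<open>k\<close> the candidates up to \<open>k - 1\<close> have been compared, candidate 0
    having been entered before the loop.\<close>
  let ?P = "\<lambda>k s. dp_row L c (k - 1) (Df s) (chf s) n j \<and> ?same s"
  let ?s1 = "nupdate (rupdate s0 ''D'' [n, j] (Df s0 (n - 1) j + c n 0)) ''ch'' [n, j] 0"
  let ?s = "nupdate ?s1 ''h'' [] ?H"
  let ?c = "CSeq (RAssign ''y'' [] (RAdd (RVar ''D'' [pred_e (nv ''n''), NSub (nv ''j'') (nv ''a'')]) (RVar ''c'' [nv ''n'', nv ''a''])))
      (CIf (RLess (RVar ''D'' [nv ''n'', nv ''j'']) (rv ''y''))
        (CSeq (RAssign ''D'' [nv ''n'', nv ''j''] (rv ''y'')) (NAssign ''ch'' [nv ''n'', nv ''j''] (nv ''a''))) CSkip)"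
  have nn: "n - 1 \<noteq> n" using n(2) by arith
  have nn': "[n - 1, a] \<noteq> [n, j]" for a using nn by simp
  have loop: "run (FOR ''a'' 1 (succ_e (nv ''h'')) ?c) (60 * real Lm + 10) (?P (Suc ?H)) t"
    if t: "unch {''h''} {} ?s1 t" "nats t ''h'' [] = ?H" for t
  proof (rule run_FOR[where P = ?P and B = 48 and h = "Suc ?H"])
    have "reals t ''D'' = reals ?s1 ''D''" "nats t ''ch'' = nats ?s1 ''ch''" using t(1) by (auto simp: unch_def)
    then show "?P 1 t" using nn c[of 0] by (simp add: dp_row_def)
    show "?P k s \<Longrightarrow> ?P k (nupdate s ''a'' [] w)" for k s w by simp
    fix s :: state assume "unch (insert ''a'' (nmods ?c)) (rmods ?c) t s"
    then show "nval s (succ_e (nv ''h'')) = Suc ?H" using t by (simp add: unch_def)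
  next
    fix a s assume a: "1 \<le> a" "a < Suc ?H" "nats s ''a'' [] = a"
      and u: "unch (insert ''a'' (nmods ?c)) (rmods ?c) t s" and P: "?P a s"
    have e: "nats s ''n'' [] = n" "nats s ''j'' [] = j" "reals s ''c'' [n, a] = c n a"
      using u t n j c[of a] a by (auto simp: unch_def)
    let ?y = "Df s (n - 1) (j - a) + c n a"
    have row: "dp_row L c a D' ch' n j"
      if "\<And>j. D' (n - 1) j = Df s (n - 1) j" "D' n j = max (Df s n j) ?y"
        "ch' n j = (if Df s n j < ?y then a else chf s n j)" for D' ch'
    proof -
      have "D' (n - 1) (j - b) + c n b \<le> D' n j" if b: "b \<le> a" "b \<le> j" "b \<le> L n" for b
      proof (cases "b = a")
        case True
        then show ?thesis using that(1,2) \<open>\<And>j. D' (n - 1) j = _ j\<close> \<open>D' n j = _\<close> by simp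
      next
        case False
        then have "b \<le> a - 1" using b by arith
        moreover have "\<forall>b\<le>a - 1. b \<le> j \<and> b \<le> L n \<longrightarrow> Df s (n - 1) (j - b) + c n b \<le> Df s n j"
          using P unfolding dp_row_def by blast
        ultimately have "Df s (n - 1) (j - b) + c n b \<le> Df s n j" using b by blast
        then show ?thesis unfolding \<open>\<And>j. D' (n - 1) j = _ j\<close> \<open>D' n j = _\<close> by (rule order_trans) simp
      qed
      moreover have "ch' n j \<le> j \<and> ch' n j \<le> L n \<and> D' n j = D' (n - 1) (j - ch' n j) + c n (ch' n j)"
      proof (cases "Df s n j < ?y")
        case True
        then have "ch' n j = a" "D' n j = ?y" using that(2,3) by simp_all
        moreover have "a \<le> j" "a \<le> L n" using a(2) by linarith+
        ultimately show ?thesis unfolding that(1) by simp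
      next
        case False
        then have "ch' n j = chf s n j" "D' n j = Df s n j" using that(2,3) by simp_all
        then show ?thesis using P unfolding that(1) dp_row_def by metis
      qed
      ultimately show ?thesis unfolding dp_row_def by blast
    qed
    show "run ?c 48 (?P (Suc a)) s"
    proof (cases "Df s n j < ?y")
      case True
      then show ?thesis using P nn
        by (simp add: e a, intro row) auto
    next
      case False
      then show ?thesis using P nn
        by (simp add: e a, intro row) auto
    qed
  qed (use L in \<open>auto simp: min_def\<close>)
  \<comment> \<open>There are no candidates beyond \<open>min j (L n)\<close>, so the horizon
    reached by the loop may be replaced by an arbitrary \<open>T\<close>.\<close>
  have fin: "run (FOR ''a'' 1 (succ_e (nv ''h'')) ?c) (60 * real Lm + 10)
    (\<lambda>s. dp_row L c T (Df s) (chf s) n j \<and> ?same s) t"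
    if t: "unch {''h''} {} ?s1 t" "nats t ''h'' [] = ?H" for t
    by (rule run_conseq[OF loop[OF t] order_refl]) (auto simp: dp_row_def)
  have "run (CSeq (CIf (NLess (nv ''j'') (NVar ''L'' [nv ''n''])) (NAssign ''h'' [] (nv ''j'')) (NAssign ''h'' [] (NVar ''L'' [nv ''n''])))
    (FOR ''a'' 1 (succ_e (nv ''h'')) ?c)) (60 * real Lm + 30) (\<lambda>s. dp_row L c T (Df s) (chf s) n j \<and> ?same s) ?s1"
  proof (rule run_Seq[where ?B1.0 = 12 and ?B2.0 = "60 * real Lm + 10"])
    show "run (CIf (NLess (nv ''j'') (NVar ''L'' [nv ''n''])) (NAssign ''h'' [] (nv ''j'')) (NAssign ''h'' [] (NVar ''L'' [nv ''n''])))
      12 (\<lambda>s. nats s ''h'' [] = ?H) ?s1" using n j L by simp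
    fix s' assume "unch (nmods (CIf (NLess (nv ''j'') (NVar ''L'' [nv ''n''])) (NAssign ''h'' [] (nv ''j'')) (NAssign ''h'' [] (NVar ''L'' [nv ''n'']))))
      (rmods (CIf (NLess (nv ''j'') (NVar ''L'' [nv ''n''])) (NAssign ''h'' [] (nv ''j'')) (NAssign ''h'' [] (NVar ''L'' [nv ''n''])))) ?s1 s'"
      and "nats s' ''h'' [] = ?H"
    then show "run (FOR ''a'' 1 (succ_e (nv ''h'')) ?c) (60 * real Lm + 10)
      (\<lambda>s. dp_row L c T (Df s) (chf s) n j \<and> ?same s) s'" by (intro fin) simp_all
  qed simp
  then have "run (CSeq (CIf (NLess (nv ''j'') (NVar ''L'' [nv ''n''])) (NAssign ''h'' [] (nv ''j'')) (NAssign ''h'' [] (NVar ''L'' [nv ''n''])))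
    (FOR ''a'' 1 (succ_e (nv ''h'')) ?c)) (100 * (real Lm + 1) - 16) (\<lambda>s. dp_row L c T (Df s) (chf s) n j \<and> ?same s) ?s1"
    by (rule run_conseq) auto
  then show ?thesis unfolding cell_prog_def using n j c[of 0] by simp
qed

definition dp_prog :: com where
  "dp_prog = CSeq (FOR ''j'' 0 (succ_e (nv ''T''))
      (RAssign ''D'' [NConst 0, nv ''j''] (RSub (OfNat (NConst 0)) (RMul (OfNat (nv ''z'')) (OfNat (nv ''j''))))))
    (FOR ''n'' 1 (succ_e (nv ''N'')) (FOR ''j'' 0 (succ_e (nv ''T'')) cell_prog))"

lemma mods_dp_prog [simp]: "nmods dp_prog = {''n'', ''j'', ''ch'', ''h'', ''a''}" "rmods dp_prog = {''D'', ''y''}"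
  by (auto simp: dp_prog_def)

lemma run_dp_prog:
  assumes N: "nats s0 ''N'' [] = N" "1 \<le> N" and T: "nats s0 ''T'' [] = T" and z: "nats s0 ''z'' [] = z"
    and L: "\<And>n. n \<in> {1..N} \<Longrightarrow> nats s0 ''L'' [n] = L n \<and> L n \<le> Lm"
    and c: "\<And>n a. n \<in> {1..N} \<Longrightarrow> a \<le> L n \<Longrightarrow> reals s0 ''c'' [n, a] = c n a"
  shows "run dp_prog (400 * (real N * (real T + 1) * (real Lm + 1)))
    (\<lambda>s. dp_table N T L z c (Df s) (chf s)) s0"
proof -
  let ?X = "(real T + 1) * (real Lm + 1)"
  let ?r = "RAssign ''D'' [NConst 0, nv ''j''] (RSub (OfNat (NConst 0)) (RMul (OfNat (nv ''z'')) (OfNat (nv ''j''))))"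
  let ?P = "\<lambda>k s. \<forall>j<k. Df s 0 j = - (real z * real j)"
  let ?Q = "\<lambda>n s. ?P (Suc T) s \<and> (\<forall>m\<in>{1..<n}. \<forall>j\<le>T. dp_row L c T (Df s) (chf s) m j)"
  let ?c = "FOR ''j'' 0 (succ_e (nv ''T'')) cell_prog"
  have X: "(real T + 1) * 1 \<le> ?X" by (intro mult_left_mono) auto
  have X1: "1 \<le> ?X" by (rule order_trans[OF _ X]) simp
  have N1: "1 \<le> real N" using N by simp
  have "run dp_prog (40 * (real T + 1) + 20 + 250 * (real N * ?X)) (?Q (Suc N)) s0" unfolding dp_prog_def
  proof (rule run_Seq)
    show "run (FOR ''j'' 0 (succ_e (nv ''T'')) ?r) (40 * (real T + 1) + 10) (?P (Suc T)) s0"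
    proof (rule run_FOR[where P = ?P and B = 20 and h = "Suc T"])
      fix s :: state assume "unch (insert ''j'' (nmods ?r)) (rmods ?r) s0 s"
      then show "nval s (succ_e (nv ''T'')) = Suc T" using T by (simp add: unch_def)
    next
      fix k s assume "nats s ''j'' [] = k" "unch (insert ''j'' (nmods ?r)) (rmods ?r) s0 s" "?P k s"
      then show "run ?r 20 (?P (Suc k)) s" using z by (simp add: unch_def less_Suc_eq)
    qed auto
  next
    fix s1 assume u1: "unch (nmods (FOR ''j'' 0 (succ_e (nv ''T'')) ?r)) (rmods (FOR ''j'' 0 (succ_e (nv ''T'')) ?r)) s0 s1"
      and P1: "?P (Suc T) s1"
    show "run (FOR ''n'' 1 (succ_e (nv ''N'')) ?c) (250 * (real N * ?X) + 10) (?Q (Suc N)) s1"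
    proof (rule run_FOR[where P = ?Q and B = "200 * ?X" and h = "Suc N"])
      show "?Q 1 s1" using P1 by simp
      show "?Q k s \<Longrightarrow> ?Q k (nupdate s ''n'' [] w)" for k s w by simp
      fix s :: state assume "unch (insert ''n'' (nmods ?c)) (rmods ?c) s1 s"
      then have "nats s ''N'' = nats s0 ''N''" using u1 by (simp add: unch_def)
      then show "nval s (succ_e (nv ''N'')) = Suc N" using N by simp
    next
      fix n s assume n: "1 \<le> n" "n < Suc N" "nats s ''n'' [] = n"
        and u: "unch (insert ''n'' (nmods ?c)) (rmods ?c) s1 s" and Q: "?Q n s"
      have u0: "unch {''n'', ''j'', ''ch'', ''h'', ''a''} {''D'', ''y''} s0 s"
        by (rule unch_trans[OF u1 u]) auto
      let ?R = "\<lambda>k s. \<forall>j<k. dp_row L c T (Df s) (chf s) n j"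
      have "run ?c (200 * ?X) (?R (Suc T)) s"
      proof (rule run_FOR[where P = ?R and B = "100 * (real Lm + 1)" and h = "Suc T"])
        fix t :: state assume "unch (insert ''j'' (nmods cell_prog)) (rmods cell_prog) s t"
        then have "nats t ''T'' = nats s0 ''T''" using u0 by (simp add: unch_def)
        then show "nval t (succ_e (nv ''T'')) = Suc T" using T by simp
      next
        fix j t assume j: "nats t ''j'' [] = j" "j < Suc T"
          and ut: "unch (insert ''j'' (nmods cell_prog)) (rmods cell_prog) s t" and R: "?R j t"
        have e: "nats t ''n'' [] = n" "nats t ''L'' = nats s0 ''L''" "reals t ''c'' = reals s0 ''c''"
          using ut u0 n by (auto simp: unch_def)
        have nn: "n - 1 \<noteq> n" using n by arith
        have nN: "n \<in> {1..N}" using n by simp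
        have "run cell_prog (100 * (real Lm + 1))
          (\<lambda>s. dp_row L c T (Df s) (chf s) n j \<and>
            (\<forall>is. is \<noteq> [n, j] \<longrightarrow> reals s ''D'' is = reals t ''D'' is \<and> nats s ''ch'' is = nats t ''ch'' is)) t"
          by (rule run_cell_prog) (use e n j L[OF nN] c[OF nN] in auto)
        then show "run cell_prog (100 * (real Lm + 1)) (?R (Suc j)) t"
        proof (rule run_conseq)
          fix t' :: state assume *: "dp_row L c T (Df t') (chf t') n j \<and>
            (\<forall>is. is \<noteq> [n, j] \<longrightarrow> reals t' ''D'' is = reals t ''D'' is \<and> nats t' ''ch'' is = nats t ''ch'' is)"
          have "dp_row L c T (Df t') (chf t') n k" if "k < j" for k
          proof -
            have "Df t' n k = Df t n k" "chf t' n k = chf t n k" "\<And>i. Df t' (n - 1) i = Df t (n - 1) i"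
              using * that nn by auto
            then show ?thesis using dp_row_cong[of "Df t'" n k "Df t" "chf t'" "chf t"] R that by blast
          qed
          then show "?R (Suc j) t'" using * by (auto simp: less_Suc_eq)
        qed simp
      next
        show "(real (Suc T) - real 0) * (100 * (real Lm + 1) + 7 + ncost (succ_e (nv ''T''))) + 5 + ncost (succ_e (nv ''T'')) \<le> 200 * ?X"
          using X by (simp add: algebra_simps)
      qed auto
      then show "run ?c (200 * ?X) (?Q (Suc n)) s"
      proof (rule run_row_frame[where n = "''n''"])
        fix s' assume f: "row_frame (nats s ''n'' []) s s'" and R: "?R (Suc T) s'"
        have "dp_row L c T (Df s') (chf s') m j" if "m \<in> {1..<n}" "j \<le> T" for m j
        proof -
          have "m \<noteq> n" "m - 1 \<noteq> n" using that by auto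
          then have "Df s' m i = Df s m i" "chf s' m i = chf s m i" "Df s' (m - 1) i = Df s (m - 1) i" for i
            using row_frameD[OF f] n by auto
          then show ?thesis using dp_row_cong[of "Df s'" m j "Df s" "chf s'" "chf s"] Q that by blast
        qed
        moreover have "Df s' 0 j = Df s 0 j" for j using row_frameD[OF f, of 0] n by auto
        moreover have "{1..<Suc n} = insert n {1..<n}" using n by auto
        ultimately show "?Q (Suc n) s'" using R Q unfolding less_Suc_eq_le by auto
      qed auto
    next
      have "real N * 1 \<le> real N * ?X" using X1 by (intro mult_left_mono) simp_all
      then show "(real (Suc N) - real 1) * (200 * ?X + 7 + ncost (succ_e (nv ''N''))) + 5 + ncost (succ_e (nv ''N'')) \<le> 250 * (real N * ?X) + 10"
        by (simp add: distrib_left mult.left_commute)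
    qed (use N in auto)
  qed simp
  then show ?thesis
  proof (rule run_conseq)
    have "1 * ?X \<le> real N * ?X" using N1 by (intro mult_right_mono) auto
    then have "?X \<le> real N * ?X" by simp
    moreover have "40 * (t + 1) + 20 + 250 * y \<le> 400 * y" if "x \<le> y" "t + 1 \<le> x" "0 \<le> t" for x y t :: real
      using that by simp
    ultimately show "40 * (real T + 1) + 20 + 250 * (real N * ?X) \<le> 400 * (real N * (real T + 1) * (real Lm + 1))"
      unfolding mult.assoc using X[unfolded mult_1_right] of_nat_0_le_iff by blast
    fix s assume "?Q (Suc N) s"
    then show "dp_table N T L z c (Df s) (chf s)"
      by (auto simp: dp_table_def less_Suc_eq_le atLeastLessThanSuc_atLeastAtMost)
  qed
qed

text \<open>The array \<open>wt\<close> translates a recorded choice into power levels: the choice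
  itself in the exact algorithm, the least sufficient level in the scaled one. So both share this
  program.\<close>

definition back_prog :: com where
  "back_prog = DOWN ''n'' (nv ''N'')
    (CSeq (RAssign ''P'' [nv ''n''] (RMul (OfNat (NVar ''wt'' [nv ''n'', NVar ''ch'' [nv ''n'', nv ''j'']])) (rv ''delta'')))
      (NAssign ''j'' [] (NSub (nv ''j'') (NVar ''ch'' [nv ''n'', nv ''j'']))))"

lemma mods_back_prog [simp]: "nmods back_prog = {''n'', ''j''}" "rmods back_prog = {''P''}"
  by (auto simp: back_prog_def)

lemma run_back_prog:
  assumes N: "nats s0 ''N'' [] = N" and j: "nats s0 ''j'' [] = j" "j \<le> T"
    and dp: "dp_table N T L z c (Df s0) (chf s0)" and d: "reals s0 ''delta'' [] = \<delta>"
  shows "run back_prog (40 * real N + 20)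
    (\<lambda>s. \<exists>a r. (\<forall>m\<in>{1..N}. a m \<le> L m \<and> reals s ''P'' [m] = real (nats s0 ''wt'' [m, a m]) * \<delta>) \<and>
       (\<Sum>m=1..N. a m) + r = j \<and> Df s0 N j = - (real z * real r) + (\<Sum>m=1..N. c m (a m))) s0"
proof -
  let ?c = "CSeq (RAssign ''P'' [nv ''n''] (RMul (OfNat (NVar ''wt'' [nv ''n'', NVar ''ch'' [nv ''n'', nv ''j'']])) (rv ''delta'')))
      (NAssign ''j'' [] (NSub (nv ''j'') (NVar ''ch'' [nv ''n'', nv ''j''])))"
  \<comment> \<open>Carriers above \<open>k\<close> have been assigned, and the budget remaining in
    \<open>j\<close> is the column to be entered in row \<open>k\<close>. What remains at row 0 is
    the leftover \<open>r\<close>.\<close>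
  let ?I = "\<lambda>k s a. (\<forall>m\<in>{k<..N}. a m \<le> L m \<and> reals s ''P'' [m] = real (nats s0 ''wt'' [m, a m]) * \<delta>) \<and>
       (\<Sum>m\<in>{k<..N}. a m) + nats s ''j'' [] = j \<and>
       Df s0 N j = Df s0 k (nats s ''j'' []) + (\<Sum>m\<in>{k<..N}. c m (a m))"
  let ?P = "\<lambda>k s. \<exists>a. ?I k s a"
  have "run back_prog (40 * real N + 20) (?P 0) s0" unfolding back_prog_def
  proof (rule run_DOWN[where P = ?P and B = 25 and h = N])
    show "?P k s \<Longrightarrow> ?P k (nupdate s ''n'' [] w)" for k s w by simp
  next
    fix k s assume k: "k < N" "nats s ''n'' [] = Suc k"
      and u: "unch (insert ''n'' (nmods ?c)) (rmods ?c) s0 s" and "?P (Suc k) s"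
    then obtain a where a: "?I (Suc k) s a" by blast
    let ?j = "nats s ''j'' []"
    let ?ch = "chf s0 (Suc k) ?j"
    have e: "nats s ''ch'' = nats s0 ''ch''" "nats s ''wt'' = nats s0 ''wt''" "reals s ''delta'' [] = \<delta>"
      using u d by (auto simp: unch_def)
    have "?j \<le> T" using a j by linarith
    then have row: "?ch \<le> ?j" "?ch \<le> L (Suc k)" "Df s0 (Suc k) ?j = Df s0 k (?j - ?ch) + c (Suc k) ?ch"
      using dp k by (auto simp: dp_table_def dp_row_def)
    have iv: "{k<..N} = insert (Suc k) {Suc k<..N}" using k by auto
    let ?a = "a(Suc k := ?ch)"
    let ?s = "nupdate (rupdate s ''P'' [Suc k] (real (nats s0 ''wt'' [Suc k, ?ch]) * \<delta>)) ''j'' [] (?j - ?ch)"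
    have sums: "(\<Sum>m\<in>{Suc k<..N}. ?a m) = (\<Sum>m\<in>{Suc k<..N}. a m)"
      "(\<Sum>m\<in>{Suc k<..N}. c m (?a m)) = (\<Sum>m\<in>{Suc k<..N}. c m (a m))" by (auto intro!: sum.cong)
    have "?I k ?s ?a" unfolding iv using a row sums by (simp add: sum.insert)
    then have "?P k ?s" by blast
    then show "run ?c 25 (?P k) s" by (simp add: k e)
  qed (use N j in \<open>auto intro!: exI[of _ "\<lambda>_. 0"]\<close>)
  then show ?thesis
  proof (rule run_conseq)
    fix s assume "?P 0 s"
    then obtain a where a: "?I 0 s a" by blast
    have iv: "{0<..N} = {1..N}" by auto
    have "nats s ''j'' [] \<le> T" using a j by linarith
    then have "Df s0 0 (nats s ''j'' []) = - (real z * real (nats s ''j'' []))" using dp by (simp add: dp_table_def)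
    then show "\<exists>a r. (\<forall>m\<in>{1..N}. a m \<le> L m \<and> reals s ''P'' [m] = real (nats s0 ''wt'' [m, a m]) * \<delta>) \<and>
       (\<Sum>m=1..N. a m) + r = j \<and> Df s0 N j = - (real z * real r) + (\<Sum>m=1..N. c m (a m))"
      using a unfolding iv by (intro exI[of _ a] exI[of _ "nats s ''j'' []"]) simp
  qed simp
qed

section \<open>The exact algorithm\<close>

lemma knapsack_levels:
  assumes v: "valid_noma I"
  shows "knapsack (carriers I) (J_levels I) (cap_levels I) (Fl I)"
proof
  show "1 \<le> carriers I" using v by (simp add: valid_noma_def)
  show "cap_levels I n \<le> J_levels I" for n by (simp add: cap_levels_def)
  have p: "0 < power_unit I" using v by (simp add: valid_noma_def)
  show "Fl I n l \<le> Fl I n l'" if "n \<in> {1..carriers I}" "l \<le> l'" for n l l'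
    unfolding Fl_def using that p by (intro F_opt_mono[OF v] mult_right_mono) auto
  show "Fl I n 0 = 0" if "n \<in> {1..carriers I}" for n
    unfolding Fl_def using F_opt_0[OF v that] by simp
qed

section \<open>Level vectors and discrete power vectors\<close>

abbreviation feas_l :: "noma \<Rightarrow> (nat \<Rightarrow> nat) \<Rightarrow> bool" where
  "feas_l I \<equiv> knapsack.feas (carriers I) (J_levels I) (cap_levels I)"
abbreviation val_l :: "noma \<Rightarrow> (nat \<Rightarrow> nat) \<Rightarrow> real" where
  "val_l I \<equiv> knapsack.val (carriers I) (Fl I)"

lemma discrete_of_levels:
  assumes v: "valid_noma I" and l: "feas_l I l"
    and P: "\<And>n. n \<in> {1..carriers I} \<Longrightarrow> P n = real (l n) * power_unit I" and ext: "P \<in> extensional {1..carriers I}"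
  shows "P \<in> discrete_feasible I" "mc_objective I P = val_l I l"
proof -
  interpret knapsack "carriers I" "J_levels I" "cap_levels I" "Fl I" by (rule knapsack_levels[OF v])
  have p: "0 < power_unit I" using v by (simp add: valid_noma_def)
  have "(\<Sum>n=1..carriers I. P n) = real (\<Sum>n=1..carriers I. l n) * power_unit I"
    using P by (simp add: sum_distrib_right)
  also have "\<dots> \<le> total_power I" using le_J_levels_iff[OF v] l unfolding feas_def by blast
  finally have 1: "(\<Sum>n=1..carriers I. P n) \<le> total_power I" .
  have 2: "0 \<le> P n \<and> P n \<le> carrier_power I n \<and> P n \<in> {real l * power_unit I | l. l \<in> {0..J_levels I}}"
    if n: "n \<in> {1..carriers I}" for n
  proof -
    have "l n \<le> cap_levels I n" using l n by (simp add: feas_def)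
    then have "l n \<le> J_levels I" "real (l n) * power_unit I \<le> carrier_power I n"
      using le_cap_levels_iff[OF v n] by auto
    then show ?thesis using P[OF n] p by auto
  qed
  show "P \<in> discrete_feasible I" using 1 2 ext unfolding discrete_feasible_def by blast
  show "mc_objective I P = val_l I l"
    unfolding mc_objective_def val_def Fl_def using P by (intro sum.cong) auto
qed

lemma levels_of_discrete:
  assumes v: "valid_noma I" and Q: "Q \<in> discrete_feasible I"
  shows "\<exists>l. feas_l I l \<and> mc_objective I Q = val_l I l"
proof -
  interpret knapsack "carriers I" "J_levels I" "cap_levels I" "Fl I" by (rule knapsack_levels[OF v])
  have "\<forall>n\<in>{1..carriers I}. \<exists>l. Q n = real l * power_unit I \<and> l \<le> J_levels I"
    using Q unfolding discrete_feasible_def by auto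
  then obtain l where l: "\<And>n. n \<in> {1..carriers I} \<Longrightarrow> Q n = real (l n) * power_unit I \<and> l n \<le> J_levels I"
    by metis
  have "(\<Sum>n=1..carriers I. Q n) = real (\<Sum>n=1..carriers I. l n) * power_unit I"
    using l by (simp add: sum_distrib_right)
  moreover have "(\<Sum>n=1..carriers I. Q n) \<le> total_power I" using Q by (simp add: discrete_feasible_def)
  ultimately have 1: "(\<Sum>n=1..carriers I. l n) \<le> J_levels I" using le_J_levels_iff[OF v] by metis
  have 2: "l n \<le> cap_levels I n" if n: "n \<in> {1..carriers I}" for n
  proof -
    have "Q n \<le> carrier_power I n" using Q n by (simp add: discrete_feasible_def)
    then show ?thesis using l[OF n] by (simp add: le_cap_levels_iff[OF v n])
  qed
  have "feas l" using 1 2 by (simp add: feas_def)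
  moreover have "mc_objective I Q = val l"
    unfolding mc_objective_def val_def Fl_def using l by (intro sum.cong) auto
  ultimately show ?thesis by blast
qed

definition levels_approx :: "noma \<Rightarrow> real \<Rightarrow> (nat \<Rightarrow> nat) \<Rightarrow> bool" where
  "levels_approx I \<epsilon> l \<longleftrightarrow> feas_l I l \<and> (\<forall>l'. feas_l I l' \<longrightarrow> (1 - \<epsilon>) * val_l I l' \<le> val_l I l)"

lemma approx_solution_of_levels:
  assumes v: "valid_noma I" and l: "levels_approx I \<epsilon> l"
    and P: "\<And>n. n \<in> {1..carriers I} \<Longrightarrow> P n = real (l n) * power_unit I"
  shows "approx_solution I \<epsilon> (restrict P {1..carriers I})"
proof -
  let ?P = "restrict P {1..carriers I}"
  have 1: "?P \<in> discrete_feasible I" "mc_objective I ?P = val_l I l"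
    using discrete_of_levels[OF v, of l ?P] l P by (auto simp: levels_approx_def)
  have "Max (mc_objective I ` discrete_feasible I) \<in> mc_objective I ` discrete_feasible I"
    by (rule Max_in) (use finite_discrete_feasible discrete_feasible_nonempty[OF v] in auto)
  then obtain Q where Q: "Q \<in> discrete_feasible I" "mc_objective I Q = Max (mc_objective I ` discrete_feasible I)"
    by force
  obtain l' where "feas_l I l'" "mc_objective I Q = val_l I l'" using levels_of_discrete[OF v Q(1)] by blast
  then have "(1 - \<epsilon>) * Max (mc_objective I ` discrete_feasible I) \<le> val_l I l"
    using l Q(2) by (auto simp: levels_approx_def)
  then show ?thesis using 1 by (simp add: approx_solution_def)
qed

text \<open>All values of \<open>F\<close> up to the caps are tabulated in advance, so that the
  dynamic program reads a stored number in each comparison instead of paying \<open>O(K)\<close> for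
  a query.\<close>

definition exact_items_prog :: com where
  "exact_items_prog = FOR ''n'' 1 (succ_e (nv ''N''))
    (CSeq (NAssign ''L'' [nv ''n''] (NVar ''cap'' [nv ''n'']))
      (FOR ''a'' 0 (succ_e (NVar ''cap'' [nv ''n'']))
        (CSeq (level_prog (nv ''a''))
        (CSeq (RAssign ''c'' [nv ''n'', nv ''a''] (rv ''v''))
          (NAssign ''wt'' [nv ''n'', nv ''a''] (nv ''a''))))))"

lemma mods_exact_items_prog [simp]: "nmods exact_items_prog = {''n'', ''L'', ''a'', ''i'', ''wt''}"
  "rmods exact_items_prog = {''x'', ''v'', ''c''}"
  by (auto simp: exact_items_prog_def)

definition exact_items :: "noma \<Rightarrow> nat \<Rightarrow> state \<Rightarrow> bool" where
  "exact_items I n s \<longleftrightarrow> nats s ''L'' [n] = cap_levels I n \<and>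
     (\<forall>a\<le>cap_levels I n. reals s ''c'' [n, a] = Fl I n a \<and> nats s ''wt'' [n, a] = a)"

lemma run_exact_items_prog:
  assumes r: "ready I \<epsilon> s0" and c: "caps_ok I s0" and v: "valid_noma I"
  shows "run exact_items_prog (400 * (real (carriers I) * (real (J_levels I) + 1) * real (users I)))
    (\<lambda>s. \<forall>n\<in>{1..carriers I}. exact_items I n s) s0"
proof -
  let ?N = "carriers I" and ?K = "users I" and ?J = "J_levels I"
  let ?d = "CSeq (RAssign ''c'' [nv ''n'', nv ''a''] (rv ''v'')) (NAssign ''wt'' [nv ''n'', nv ''a''] (nv ''a''))"
  let ?b = "CSeq (level_prog (nv ''a'')) ?d"
  let ?f = "FOR ''a'' 0 (succ_e (NVar ''cap'' [nv ''n''])) ?b"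
  let ?c = "CSeq (NAssign ''L'' [nv ''n''] (NVar ''cap'' [nv ''n''])) ?f"
  let ?P = "\<lambda>k s. \<forall>n\<in>{1..<k}. exact_items I n s"
  let ?X = "(real ?J + 1) * real ?K"
  have K: "1 \<le> real ?K" "1 \<le> real ?N" using v by (auto simp: valid_noma_def)
  have X: "real ?K \<le> ?X" "real ?J + 1 \<le> ?X"
    using mult_right_mono[of 1 "real ?J + 1" "real ?K"] mult_left_mono[OF K(1), of "real ?J + 1"] by auto
  have "run exact_items_prog (400 * (real ?N * ?X)) (?P (Suc ?N)) s0" unfolding exact_items_prog_def
  proof (rule run_FOR[where P = ?P and B = "300 * ?X" and h = "Suc ?N"])
    show "?P k s \<Longrightarrow> ?P k (nupdate s ''n'' [] w)" for k s w by (simp add: exact_items_def)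
    fix s :: state assume "unch (insert ''n'' (nmods ?c)) (rmods ?c) s0 s"
    then show "nval s (succ_e (nv ''N'')) = Suc ?N" using r by (simp add: unch_def ready_def inp_def)
  next
    fix n s assume n: "1 \<le> n" "n < Suc ?N" "nats s ''n'' [] = n"
      and u: "unch (insert ''n'' (nmods ?c)) (rmods ?c) s0 s" and P: "?P n s"
    have n': "n \<in> {1..?N}" using n by simp
    have rs: "ready I \<epsilon> s" by (rule ready_unch[OF r u]) (auto simp: ready_nats_def ready_reals_def)
    have cap: "nats s ''cap'' [n] = cap_levels I n" using u c n' by (simp add: unch_def caps_ok_def)
    let ?s = "nupdate s ''L'' [n] (cap_levels I n)"
    let ?R = "\<lambda>k s. nats s ''L'' [n] = cap_levels I n \<and>
      (\<forall>a<k. reals s ''c'' [n, a] = Fl I n a \<and> nats s ''wt'' [n, a] = a)"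
    have rs': "ready I \<epsilon> ?s" using rs by (simp add: ready_nats_def)
    have J: "real (cap_levels I n) \<le> real ?J" by (simp add: cap_levels_def)
    have "run ?f (300 * ?X - 4) (?R (Suc (cap_levels I n))) ?s"
    proof (rule run_FOR[where P = ?R and B = "200 * real ?K + 30" and h = "Suc (cap_levels I n)"])
      fix t :: state assume "unch (insert ''a'' (nmods ?b)) (rmods ?b) ?s t"
      then show "nval t (succ_e (NVar ''cap'' [nv ''n''])) = Suc (cap_levels I n)"
        using cap n by (simp add: unch_def)
    next
      fix a t assume a: "a < Suc (cap_levels I n)" "nats t ''a'' [] = a"
        and u: "unch (insert ''a'' (nmods ?b)) (rmods ?b) ?s t" and R: "?R a t"
      have rt: "ready I \<epsilon> t" by (rule ready_unch[OF rs' u]) (auto simp: ready_nats_def ready_reals_def)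
      have tn: "nats t ''n'' [] = n" using u n by (simp add: unch_def)
      show "run ?b (200 * real ?K + 30) (?R (Suc a)) t"
      proof (rule run_Seq[where ?B1.0 = "200 * real ?K + 10" and ?B2.0 = 20])
        show "run (level_prog (nv ''a'')) (200 * real ?K + 10) (\<lambda>s. reals s ''v'' [] = Fl I n a) t"
          by (rule run_level_prog[OF rt v tn n']) (use a in \<open>auto simp: cap_levels_def\<close>)
        fix t' assume "unch (nmods (level_prog (nv ''a''))) (rmods (level_prog (nv ''a''))) t t'"
          and v: "reals t' ''v'' [] = Fl I n a"
        then have "nats t' ''n'' = nats t ''n''" "nats t' ''a'' = nats t ''a''" "nats t' ''L'' = nats t ''L''"
          "reals t' ''c'' = reals t ''c''" "nats t' ''wt'' = nats t ''wt''" by (auto simp: unch_def)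
        then show "run ?d 20 (?R (Suc a)) t'" using R tn a v by (auto simp: less_Suc_eq)
      qed simp
    next
      have "(real (Suc (cap_levels I n)) - real 0) * (200 * real ?K + 50) \<le> (real ?J + 1) * (200 * real ?K + 50)"
        using J by (intro mult_right_mono) auto
      also have "\<dots> = 200 * ?X + 50 * (real ?J + 1)" by (simp add: algebra_simps)
      also have "\<dots> \<le> 200 * ?X + 50 * ?X" by (intro add_left_mono mult_left_mono X) simp
      also have "\<dots> = 250 * ?X" by simp
      finally show "(real (Suc (cap_levels I n)) - real 0) * (200 * real ?K + 30 + 7 + ncost (succ_e (NVar ''cap'' [nv ''n'']))) + 5 + ncost (succ_e (NVar ''cap'' [nv ''n'']))
          \<le> 300 * ?X - 4" using X K J by (simp add: algebra_simps)
    qed auto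
    then have "run ?c (300 * ?X) (?R (Suc (cap_levels I n))) s" by (simp add: n cap)
    then show "run ?c (300 * ?X) (?P (Suc n)) s"
    proof (rule run_row_frame[where n = "''n''"])
      fix s' assume f: "row_frame (nats s ''n'' []) s s'" and R: "?R (Suc (cap_levels I n)) s'"
      have "exact_items I k s'" if "k \<in> {1..<n}" for k
      proof -
        have "k \<noteq> n" using that by simp
        then show ?thesis using P that row_frameD[OF f] n by (simp add: exact_items_def)
      qed
      moreover have "exact_items I n s'" using R by (simp add: exact_items_def less_Suc_eq_le)
      moreover have "{1..<Suc n} = insert n {1..<n}" using n by auto
      ultimately show "?P (Suc n) s'" by simp
    qed auto
  next
    have "1 \<le> ?X" using X K by linarith
    then have "real ?N * 1 \<le> real ?N * ?X" by (intro mult_left_mono) simp_all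
    then have "8 + 10 * real ?N \<le> 100 * (real ?N * ?X)" using K by linarith
    then show "(real (Suc ?N) - real 1) * (300 * ?X + 7 + ncost (succ_e (nv ''N''))) + 5 + ncost (succ_e (nv ''N'')) \<le> 400 * (real ?N * ?X)"
      by (simp add: algebra_simps)
  qed auto
  then show ?thesis unfolding mult.assoc by (rule run_conseq) (auto simp: atLeastLessThanSuc_atLeastAtMost)
qed

definition exact_prog :: com where
  "exact_prog = CSeq (NAssign ''z'' [] (NConst 0)) (CSeq (NAssign ''T'' [] (nv ''J''))
     (CSeq exact_items_prog (CSeq dp_prog (CSeq (NAssign ''j'' [] (nv ''T'')) back_prog))))"

definition solved :: "noma \<Rightarrow> real \<Rightarrow> state \<Rightarrow> bool" where
  "solved I \<epsilon> s \<longleftrightarrow> (\<exists>l. levels_approx I \<epsilon> l \<and> (\<forall>n\<in>{1..carriers I}. reals s ''P'' [n] = real (l n) * power_unit I))"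

lemma run_exact_prog:
  assumes r: "ready I \<epsilon> s0" and c: "caps_ok I s0" and v: "valid_noma I" and J: "1 \<le> J_levels I" and \<epsilon>: "0 < \<epsilon>"
  shows "run exact_prog (3000 * (real (J_levels I) * real (carriers I) * real (users I) + real (J_levels I) ^ 2 * real (carriers I)))
     (solved I \<epsilon>) s0"
proof -
  interpret knapsack "carriers I" "J_levels I" "cap_levels I" "Fl I" by (rule knapsack_levels[OF v])
  let ?N = "carriers I" and ?K = "users I" and ?J = "J_levels I"
  let ?C1 = "400 * (real ?N * (real ?J + 1) * real ?K)" and ?C2 = "400 * (real ?N * (real ?J + 1) * (real ?J + 1))"
  let ?s = "nupdate (nupdate s0 ''z'' [] 0) ''T'' [] ?J"
  have rs: "ready I \<epsilon> ?s" using r by (simp add: ready_nats_def)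
  have cs: "caps_ok I ?s" using c by (simp add: caps_ok_def)
  have T0: "nats s0 ''J'' [] = ?J" using r by (simp add: ready_def)
  have "run (CSeq exact_items_prog (CSeq dp_prog (CSeq (NAssign ''j'' [] (nv ''T'')) back_prog)))
    (?C1 + (?C2 + (40 * real ?N + 30))) (solved I \<epsilon>) ?s"
  proof (rule run_Seq[OF run_exact_items_prog[OF rs cs v] _ order_refl])
    fix s1 assume u1: "unch (nmods exact_items_prog) (rmods exact_items_prog) ?s s1"
      and it: "\<forall>n\<in>{1..?N}. exact_items I n s1"
    have e1: "nats s1 ''N'' [] = ?N" "nats s1 ''T'' [] = ?J" "nats s1 ''z'' [] = 0" "reals s1 ''delta'' [] = power_unit I"
      using u1 rs by (auto simp: unch_def ready_def inp_def)
    show "run (CSeq dp_prog (CSeq (NAssign ''j'' [] (nv ''T'')) back_prog)) (?C2 + (40 * real ?N + 30)) (solved I \<epsilon>) s1"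
    proof (rule run_Seq[OF run_dp_prog[OF e1(1) N e1(2,3), of "cap_levels I" ?J "Fl I"] _ order_refl])
      fix s2 assume u2: "unch (nmods dp_prog) (rmods dp_prog) s1 s2"
        and dp: "dp_table ?N ?J (cap_levels I) 0 (Fl I) (Df s2) (chf s2)"
      let ?s2 = "nupdate s2 ''j'' [] ?J"
      have e2: "nats s2 ''N'' [] = ?N" "nats s2 ''T'' [] = ?J" "reals s2 ''delta'' [] = power_unit I" "nats s2 ''wt'' = nats s1 ''wt''"
        using u2 e1 by (auto simp: unch_def)
      have "run back_prog (40 * real ?N + 20)
        (\<lambda>s. \<exists>a r. (\<forall>m\<in>{1..?N}. a m \<le> cap_levels I m \<and> reals s ''P'' [m] = real (nats ?s2 ''wt'' [m, a m]) * power_unit I) \<and>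
          (\<Sum>m=1..?N. a m) + r = ?J \<and> Df ?s2 ?N ?J = - (real 0 * real r) + (\<Sum>m=1..?N. Fl I m (a m))) ?s2"
        by (rule run_back_prog[where T = ?J]) (use e2 dp in auto)
      then have "run back_prog (40 * real ?N + 26) (solved I \<epsilon>) ?s2"
      proof (rule run_conseq)
        fix s :: state assume "\<exists>a r. (\<forall>m\<in>{1..?N}. a m \<le> cap_levels I m \<and> reals s ''P'' [m] = real (nats ?s2 ''wt'' [m, a m]) * power_unit I) \<and>
          (\<Sum>m=1..?N. a m) + r = ?J \<and> Df ?s2 ?N ?J = - (real 0 * real r) + (\<Sum>m=1..?N. Fl I m (a m))"
        then obtain a r where a': "\<forall>m\<in>{1..?N}. a m \<le> cap_levels I m \<and> reals s ''P'' [m] = real (nats ?s2 ''wt'' [m, a m]) * power_unit I"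
          "(\<Sum>m=1..?N. a m) + r = ?J" "Df ?s2 ?N ?J = - (real 0 * real r) + (\<Sum>m=1..?N. Fl I m (a m))" by blast
        then have a: "\<And>m. m \<in> {1..?N} \<Longrightarrow> a m \<le> cap_levels I m \<and> reals s ''P'' [m] = real (nats s1 ''wt'' [m, a m]) * power_unit I"
          "(\<Sum>m=1..?N. a m) + r = ?J" "Df s2 ?N ?J = (\<Sum>m=1..?N. Fl I m (a m))" by (simp_all add: e2)
        have fa: "feas a" using a by (simp add: feas_def)
        have "val l' \<le> val a" if "feas l'" for l' using exact_dp[OF dp that] a(3) by (simp add: val_def)
        \<comment> \<open>Values are nonnegative, so an exact optimum satisfies the approximate
          guarantee for every positive \<open>\<epsilon>\<close>.\<close>
        moreover have "(1 - \<epsilon>) * val l' \<le> val l'" if "feas l'" for l'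
          using val_nonneg[OF that] \<epsilon> mult_right_mono[of "1 - \<epsilon>" 1 "val l'"] by simp
        ultimately have "levels_approx I \<epsilon> a" using fa unfolding levels_approx_def by (meson order_trans)
        moreover have "reals s ''P'' [m] = real (a m) * power_unit I" if "m \<in> {1..?N}" for m
          using a(1)[OF that] it that by (simp add: exact_items_def)
        ultimately show "solved I \<epsilon> s" unfolding solved_def by blast
      qed simp
      then show "run (CSeq (NAssign ''j'' [] (nv ''T'')) back_prog) (40 * real ?N + 30) (solved I \<epsilon>) s2"
        by (simp add: e2, elim run_conseq) auto
    qed (use it cap in \<open>auto simp: exact_items_def\<close>)
  qed
  moreover have "?C1 + (?C2 + (40 * real ?N + 30)) \<le> 3000 * (real ?J * real ?N * real ?K + real ?J ^ 2 * real ?N) - 10"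
  proof -
    have K: "1 \<le> real ?K" "1 \<le> real ?N" "1 \<le> real ?J" using v J by (auto simp: valid_noma_def)
    \<comment> \<open>With \<open>J \<ge> 1\<close> each factor \<open>J + 1\<close> is at most
      \<open>2 J\<close>; this gives the stated cost without lower order terms.\<close>
    have "real ?N * (real ?J + 1) * real ?K \<le> real ?N * (2 * real ?J) * real ?K"
      using K by (intro mult_left_mono mult_right_mono) auto
    moreover have "real ?N * (real ?J + 1) * (real ?J + 1) \<le> real ?N * (2 * real ?J) * (2 * real ?J)"
      using K by (intro mult_mono) auto
    moreover have "real ?N * 1 * 1 \<le> real ?N * real ?J * real ?K"
      using K by (intro mult_mono) auto
    ultimately have le: "real ?N * (real ?J + 1) * real ?K \<le> 2 * (real ?J * real ?N * real ?K)"
      "real ?N * (real ?J + 1) * (real ?J + 1) \<le> 4 * (real ?J ^ 2 * real ?N)"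
      "real ?N \<le> real ?J * real ?N * real ?K"
      by (simp_all only: power2_eq_square mult_1_right mult_ac)
    have gen: "400 * x + (400 * y + (40 * n + 30)) \<le> 3000 * (p + q) - 10"
      if "x \<le> 2 * p" "y \<le> 4 * q" "n \<le> p" "1 \<le> n" "0 \<le> q" for x y n p q :: real
      using that by simp
    show ?thesis by (rule gen[OF le K(2)]) simp
  qed
  ultimately have "run (CSeq exact_items_prog (CSeq dp_prog (CSeq (NAssign ''j'' [] (nv ''T'')) back_prog)))
    (3000 * (real ?J * real ?N * real ?K + real ?J ^ 2 * real ?N) - 10) (solved I \<epsilon>) ?s"
    by (rule run_conseq) auto
  then show ?thesis unfolding exact_prog_def by (simp add: T0, elim run_conseq) auto
qed

section \<open>The approximation algorithm\<close>

definition scaled_test :: com where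
  "scaled_test = CIf (NLess (NVar ''cap'' [nv ''n'']) (nv ''q'')) (NAssign ''f'' [] (NConst 0))
     (CSeq (level_prog (nv ''q'')) (CIf (RLess (rv ''v'') (RMul (OfNat (nv ''a'')) (rv ''g'')))
       (NAssign ''f'' [] (NConst 1)) (NAssign ''f'' [] (NConst 0))))"

lemma mods_scaled_test [simp]: "nmods scaled_test = {''f'', ''i''}" "rmods scaled_test = {''x'', ''v''}"
  by (auto simp: scaled_test_def)

lemma row_writes_scaled_test [simp]: "row_writes ''n'' scaled_test"
  by (simp add: scaled_test_def)

definition store_item :: com where
  "store_item = CSeq (NAssign ''wt'' [nv ''n'', nv ''a''] (succ_e (nv ''l'')))
     (CSeq (RAssign ''c'' [nv ''n'', nv ''a''] (RSub (OfNat (NConst 0)) (OfNat (succ_e (nv ''l'')))))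
     (CSeq (NAssign ''L'' [nv ''n''] (nv ''a'')) (inc ''a'')))"

text \<open>For \<open>a = 1, 2, ...\<close> the search finds the largest level worth less than
  \<open>a g\<close>, and the next level is the least one earning \<open>a\<close> profit units. As
  a quotient cannot be rounded, the number of profit levels is just the last \<open>a\<close> that
  does not exceed the value at the cap.\<close>

definition item_loop :: com where
  "item_loop = CWhile (BNot (RLess (RVar ''u'' [nv ''n'']) (RMul (OfNat (nv ''a'')) (rv ''g''))))
     (CSeq (bsearch scaled_test) store_item)"

lemma mods_store_item [simp]: "nmods store_item = {''wt'', ''L'', ''a''}" "rmods store_item = {''c''}"
  by (auto simp: store_item_def)

lemma mods_item_loop [simp]: "nmods item_loop = {''l'', ''c'', ''q'', ''f'', ''i'', ''wt'', ''L'', ''a''}"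
  "rmods item_loop = {''x'', ''v'', ''c''}"
  by (auto simp: item_loop_def)

lemma row_writes_item_loop [simp]: "row_writes ''n'' item_loop"
  by (simp add: item_loop_def store_item_def)

definition scaled_items_prog :: com where
  "scaled_items_prog = FOR ''n'' 1 (succ_e (nv ''N''))
    (CSeq (NAssign ''L'' [nv ''n''] (NConst 0)) (CSeq (RAssign ''c'' [nv ''n'', NConst 0] (OfNat (NConst 0)))
    (CSeq (NAssign ''wt'' [nv ''n'', NConst 0] (NConst 0)) (CSeq (NAssign ''a'' [] (NConst 1)) item_loop))))"

lemma mods_scaled_items_prog [simp]:
  "nmods scaled_items_prog = {''n'', ''l'', ''c'', ''q'', ''f'', ''i'', ''wt'', ''L'', ''a''}"
  "rmods scaled_items_prog = {''x'', ''v'', ''c''}"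
  by (auto simp: scaled_items_prog_def)

definition item_ok :: "noma \<Rightarrow> real \<Rightarrow> nat \<Rightarrow> nat \<Rightarrow> state \<Rightarrow> bool" where
  "item_ok I g n a s \<longleftrightarrow> reals s ''c'' [n, a] = - real (nats s ''wt'' [n, a]) \<and>
     nats s ''wt'' [n, a] \<le> cap_levels I n \<and> real a * g \<le> Fl I n (nats s ''wt'' [n, a]) \<and>
     (\<forall>k\<le>cap_levels I n. real a * g \<le> Fl I n k \<longrightarrow> nats s ''wt'' [n, a] \<le> k)"

definition scaled_items :: "noma \<Rightarrow> real \<Rightarrow> nat \<Rightarrow> state \<Rightarrow> bool" where
  "scaled_items I g n s \<longleftrightarrow> real (nats s ''L'' [n]) * g \<le> Fl I n (cap_levels I n) \<and>
     Fl I n (cap_levels I n) < real (Suc (nats s ''L'' [n])) * g \<and> (\<forall>a\<le>nats s ''L'' [n]. item_ok I g n a s)"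

lemma run_item_search:
  assumes r: "ready I \<epsilon> s" and c: "caps_ok I s" and v: "valid_noma I" and n: "nats s ''n'' [] = n" "n \<in> {1..carriers I}"
    and g: "reals s ''g'' [] = g" "0 < g" and a: "nats s ''a'' [] = a" "1 \<le> a"
  shows "run (bsearch scaled_test) (real (num_bits (J_levels I)) * (200 * real (users I) + 80) + 13)
    (\<lambda>s. (nats s ''l'' [] \<le> cap_levels I n \<and> Fl I n (nats s ''l'' []) < real a * g) \<and>
      \<not> (Suc (nats s ''l'' []) \<le> cap_levels I n \<and> Fl I n (Suc (nats s ''l'' [])) < real a * g)) s"
proof -
  interpret knapsack "carriers I" "J_levels I" "cap_levels I" "Fl I" by (rule knapsack_levels[OF v])
  let ?K = "users I"
  show ?thesis
  proof (rule run_bsearch[where T = "200 * real ?K + 50" and b = "num_bits (J_levels I)" and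
        Q = "\<lambda>l. l \<le> cap_levels I n \<and> Fl I n l < real a * g"])
    show "bits_ok (num_bits (J_levels I)) s" using r by (simp add: ready_def)
    show "0 \<le> cap_levels I n \<and> Fl I n 0 < real a * g" using zero[OF n(2)] a g by simp
    show "\<not> (2 ^ num_bits (J_levels I) \<le> cap_levels I n \<and> Fl I n (2 ^ num_bits (J_levels I)) < real a * g)"
      using less_num_bits[of "J_levels I"] cap[OF n(2)] by simp
    show "m' \<le> cap_levels I n \<and> Fl I n m' < real a * g"
      if "m \<le> cap_levels I n \<and> Fl I n m < real a * g" "m' \<le> m" for m m'
      using that mono[OF n(2), of m' m] by auto
  next
    fix t :: state and m
    assume ut: "unch ({''l'', ''c'', ''q''} \<union> nmods scaled_test) (rmods scaled_test) s t" and q: "nats t ''q'' [] = m"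
    have rt: "ready I \<epsilon> t" by (rule ready_unch[OF r ut]) (auto simp: ready_nats_def ready_reals_def)
    have e: "nats t ''n'' [] = n" "nats t ''cap'' [n] = cap_levels I n" "nats t ''a'' [] = a" "reals t ''g'' [] = g"
      using ut n c a g by (auto simp: unch_def caps_ok_def)
    let ?Q = "\<lambda>s'. 0 < nats s' ''f'' [] \<longleftrightarrow> m \<le> cap_levels I n \<and> Fl I n m < real a * g"
    show "run scaled_test (200 * real ?K + 50) ?Q t"
    proof (cases "cap_levels I n < m")
      case True
      then show ?thesis unfolding scaled_test_def by (simp add: e q)
    next
      case False
      then have mJ: "m \<le> J_levels I" using cap[OF n(2)] by linarith
      have "run (CSeq (level_prog (nv ''q'')) (CIf (RLess (rv ''v'') (RMul (OfNat (nv ''a'')) (rv ''g'')))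
        (NAssign ''f'' [] (NConst 1)) (NAssign ''f'' [] (NConst 0)))) (200 * real ?K + 40) ?Q t"
      proof (rule run_Seq[where ?B1.0 = "200 * real ?K + 10" and ?B2.0 = 20])
        show "run (level_prog (nv ''q'')) (200 * real ?K + 10) (\<lambda>s. reals s ''v'' [] = Fl I n m) t"
          by (rule run_level_prog[OF rt v e(1) n(2)]) (use q mJ in auto)
        fix t' assume "unch (nmods (level_prog (nv ''q''))) (rmods (level_prog (nv ''q''))) t t'"
          and "reals t' ''v'' [] = Fl I n m"
        moreover from this have "nats t' ''a'' [] = a" "reals t' ''g'' [] = g" using e by (auto simp: unch_def)
        ultimately show "run (CIf (RLess (rv ''v'') (RMul (OfNat (nv ''a'')) (rv ''g'')))
          (NAssign ''f'' [] (NConst 1)) (NAssign ''f'' [] (NConst 0))) 20 ?Q t'" using False by simp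
      qed simp
      then show ?thesis using False unfolding scaled_test_def
        by (simp add: e q, elim run_conseq) auto
    qed
  qed (auto simp: algebra_simps)
qed

text \<open>\<open>X\<close> is a real upper bound for the number of profit levels. The potential
  charges one binary search, with \<open>O(K)\<close> per probe, to each level not yet
  reached.\<close>

lemma run_item_loop:
  assumes r: "ready I \<epsilon> s0" and c: "caps_ok I s0" and v: "valid_noma I" and J: "1 \<le> J_levels I"
    and n: "nats s0 ''n'' [] = n" "n \<in> {1..carriers I}" and g: "reals s0 ''g'' [] = g" "0 < g"
    and init: "nats s0 ''a'' [] = 1" "nats s0 ''L'' [n] = 0" "item_ok I g n 0 s0"
    and Lm: "Fl I n (cap_levels I n) \<le> X * g"
  shows "run item_loop (400 * (X * (real (num_bits (J_levels I)) * real (users I))) + 20) (scaled_items I g n) s0"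
proof -
  interpret knapsack "carriers I" "J_levels I" "cap_levels I" "Fl I" by (rule knapsack_levels[OF v])
  let ?b = "BNot (RLess (RVar ''u'' [nv ''n'']) (RMul (OfNat (nv ''a'')) (rv ''g'')))"
  let ?c = "CSeq (bsearch scaled_test) store_item"
  let ?B = "real (num_bits (J_levels I))" and ?K = "real (users I)"
  let ?F = "Fl I n (cap_levels I n)"
  have K: "1 \<le> ?K" "1 \<le> ?B" using v num_bits_pos[OF J] by (auto simp: valid_noma_def)
  have BK: "?B \<le> ?B * ?K" "?K \<le> ?B * ?K"
    using mult_left_mono[OF K(1), of ?B] mult_right_mono[OF K(2), of ?K] by auto
  have step: "?B * (200 * ?K + 80) + 70 \<le> 400 * (?B * ?K)"
  proof -
    have "?B * (200 * ?K + 80) = 200 * (?B * ?K) + 80 * ?B" by (simp add: algebra_simps)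
    then show ?thesis using BK K by linarith
  qed
  define Inv :: "state \<Rightarrow> bool" where "Inv s \<longleftrightarrow> unch (nmods ?c) (rmods ?c) s0 s \<and>
    nats s ''a'' [] = Suc (nats s ''L'' [n]) \<and> real (nats s ''L'' [n]) * g \<le> ?F \<and>
    (\<forall>a\<le>nats s ''L'' [n]. item_ok I g n a s)" for s
  have e: "nats s ''n'' [] = n" "reals s ''u'' [n] = ?F" "reals s ''g'' [] = g" if "Inv s" for s
    using that c n g by (auto simp: Inv_def unch_def caps_ok_def)
  have LX: "real (nats s ''L'' [n]) \<le> X" if "Inv s" for s
  proof -
    have "real (nats s ''L'' [n]) * g \<le> X * g" using that Lm by (simp add: Inv_def)
    then show ?thesis using g by simp
  qed
  have "run (CWhile ?b ?c) (400 * (X * (?B * ?K)) + 20) (\<lambda>s. Inv s \<and> \<not> bval s ?b) s0"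
  proof (rule run_While[where \<phi> = "\<lambda>s. (X - real (nats s ''L'' [n])) * (400 * (?B * ?K)) + 20"])
    show "Inv s0" using init zero[OF n(2)] u_nonneg[OF n(2) order_refl] by (simp add: Inv_def)
    show "(X - real (nats s0 ''L'' [n])) * (400 * (?B * ?K)) + 20 \<le> 400 * (X * (?B * ?K)) + 20" using init by simp
    fix s assume I: "Inv s"
    have "0 \<le> (X - real (nats s ''L'' [n])) * (400 * (?B * ?K))" using LX[OF I] K by simp
    then show "1 + real (bcost ?b) \<le> (X - real (nats s ''L'' [n])) * (400 * (?B * ?K)) + 20" by simp
  next
    fix s assume I: "Inv s" and b: "bval s ?b"
    let ?a = "Suc (nats s ''L'' [n])"
    have u: "unch (nmods ?c) (rmods ?c) s0 s" and sa: "nats s ''a'' [] = ?a" using I by (auto simp: Inv_def)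
    have aF: "real ?a * g \<le> ?F" using b e[OF I] sa by (simp add: not_less)
    have rs: "ready I \<epsilon> s" by (rule ready_unch[OF r u]) (auto simp: ready_nats_def ready_reals_def)
    have cs: "caps_ok I s" using c u by (simp add: caps_ok_def unch_def)
    have srch: "run (bsearch scaled_test) (?B * (200 * ?K + 80) + 13)
      (\<lambda>s. (nats s ''l'' [] \<le> cap_levels I n \<and> Fl I n (nats s ''l'' []) < real ?a * g) \<and>
      \<not> (Suc (nats s ''l'' []) \<le> cap_levels I n \<and> Fl I n (Suc (nats s ''l'' [])) < real ?a * g)) s"
      by (rule run_item_search[OF rs cs v e(1)[OF I] n(2) e(3)[OF I] g(2) sa]) simp
    have "run ?c (?B * (200 * ?K + 80) + 13 + 40) (\<lambda>s'. Inv s' \<and> nats s' ''L'' [n] = ?a) s"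
    proof (rule run_Seq[OF srch _ order_refl])
      fix t assume ut: "unch (nmods (bsearch scaled_test)) (rmods (bsearch scaled_test)) s t"
        and l: "(nats t ''l'' [] \<le> cap_levels I n \<and> Fl I n (nats t ''l'' []) < real ?a * g) \<and>
      \<not> (Suc (nats t ''l'' []) \<le> cap_levels I n \<and> Fl I n (Suc (nats t ''l'' [])) < real ?a * g)"
      let ?l = "nats t ''l'' []"
      have te: "nats t ''n'' [] = n" "nats t ''a'' [] = ?a" "nats t ''wt'' = nats s ''wt''" "reals t ''c'' = reals s ''c''"
        using ut e[OF I] sa by (auto simp: unch_def)
      \<comment> \<open>The cap earns \<open>a\<close> units by the loop test, so the search stops
        strictly below it and \<open>Suc ?l\<close> is an admissible level. Monotonicity makes it
        the least one.\<close>
      have "?l \<noteq> cap_levels I n" using l aF by auto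
      then have l1: "Suc ?l \<le> cap_levels I n" using l by auto
      then have l2: "real ?a * g \<le> Fl I n (Suc ?l)" using l by auto
      have l3: "Suc ?l \<le> k" if "k \<le> cap_levels I n" "real ?a * g \<le> Fl I n k" for k
      proof (rule ccontr)
        assume "\<not> Suc ?l \<le> k"
        then have "Fl I n k \<le> Fl I n ?l" using mono[OF n(2), of k ?l] l by simp
        then show False using l that by linarith
      qed
      let ?t = "nupdate (nupdate (rupdate (nupdate t ''wt'' [n, ?a] (Suc ?l)) ''c'' [n, ?a] (- real (Suc ?l))) ''L'' [n] ?a) ''a'' [] (Suc ?a)"
      have "unch (nmods ?c) (rmods ?c) s0 t" by (rule unch_trans[OF u ut]) auto
      then have "unch (nmods ?c) (rmods ?c) s0 ?t" by (simp add: unch_def)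
      moreover have "item_ok I g n a ?t" if "a \<le> ?a" for a
      proof (cases "a = ?a")
        case True
        then show ?thesis using l1 l2 l3 by (simp add: item_ok_def)
      next
        case False
        then have "item_ok I g n a s" using that I by (simp add: Inv_def)
        then show ?thesis using False te by (simp add: item_ok_def)
      qed
      ultimately have "Inv ?t" using aF by (simp add: Inv_def)
      then show "run store_item 40 (\<lambda>s'. Inv s' \<and> nats s' ''L'' [n] = ?a) t"
        unfolding store_item_def by (simp add: te)
    qed
    then have "run ?c (?B * (200 * ?K + 80) + 53) (\<lambda>s'. Inv s' \<and> 1 + real (bcost ?b) + (?B * (200 * ?K + 80) + 53) +
        ((X - real (nats s' ''L'' [n])) * (400 * (?B * ?K)) + 20)
        \<le> (X - real (nats s ''L'' [n])) * (400 * (?B * ?K)) + 20) s"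
    proof (rule run_conseq)
      fix s' assume s': "Inv s' \<and> nats s' ''L'' [n] = ?a"
      have "(X - real ?a) * (400 * (?B * ?K)) = (X - real (nats s ''L'' [n])) * (400 * (?B * ?K)) - 400 * (?B * ?K)"
        by (simp add: algebra_simps)
      then show "Inv s' \<and> 1 + real (bcost ?b) + (?B * (200 * ?K + 80) + 53) +
        ((X - real (nats s' ''L'' [n])) * (400 * (?B * ?K)) + 20)
        \<le> (X - real (nats s ''L'' [n])) * (400 * (?B * ?K)) + 20" using s' step by simp
    qed simp
    then show "\<exists>B. run ?c B (\<lambda>s'. Inv s' \<and> 1 + real (bcost ?b) + B +
        ((X - real (nats s' ''L'' [n])) * (400 * (?B * ?K)) + 20)
        \<le> (X - real (nats s ''L'' [n])) * (400 * (?B * ?K)) + 20) s" by blast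
  qed
  then show ?thesis unfolding item_loop_def
  proof (rule run_conseq)
    fix s assume *: "Inv s \<and> \<not> bval s ?b"
    then have "?F < real (nats s ''a'' []) * g" using e[of s] by simp
    then show "scaled_items I g n s" using * by (auto simp: scaled_items_def Inv_def)
  qed simp
qed

lemma run_scaled_items_prog:
  assumes r: "ready I \<epsilon> s0" and c: "caps_ok I s0" and v: "valid_noma I" and J: "1 \<le> J_levels I"
    and g: "reals s0 ''g'' [] = g" "0 < g" and X: "0 \<le> X"
    and Lm: "\<And>n. n \<in> {1..carriers I} \<Longrightarrow> Fl I n (cap_levels I n) \<le> X * g"
  shows "run scaled_items_prog (500 * (real (carriers I) * ((X + 1) * (real (num_bits (J_levels I)) * real (users I)))))
    (\<lambda>s. \<forall>n\<in>{1..carriers I}. scaled_items I g n s) s0"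
proof -
  interpret knapsack "carriers I" "J_levels I" "cap_levels I" "Fl I" by (rule knapsack_levels[OF v])
  let ?N = "carriers I" and ?B = "real (num_bits (J_levels I))" and ?K = "real (users I)"
  let ?c = "CSeq (NAssign ''L'' [nv ''n''] (NConst 0)) (CSeq (RAssign ''c'' [nv ''n'', NConst 0] (OfNat (NConst 0)))
    (CSeq (NAssign ''wt'' [nv ''n'', NConst 0] (NConst 0)) (CSeq (NAssign ''a'' [] (NConst 1)) item_loop)))"
  let ?P = "\<lambda>k s. \<forall>n\<in>{1..<k}. scaled_items I g n s"
  let ?Y = "X * (?B * ?K)"
  have K: "1 \<le> ?K" "1 \<le> ?B" using v num_bits_pos[OF J] by (auto simp: valid_noma_def)
  have BK: "1 \<le> ?B * ?K" using K mult_mono[of 1 ?B 1 ?K] by simp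
  have Y: "0 \<le> ?Y" using X K by simp
  have "run scaled_items_prog (500 * (real ?N * ((X + 1) * (?B * ?K)))) (?P (Suc ?N)) s0" unfolding scaled_items_prog_def
  proof (rule run_FOR[where P = ?P and B = "400 * ?Y + 50" and h = "Suc ?N"])
    show "?P k s \<Longrightarrow> ?P k (nupdate s ''n'' [] w)" for k s w by (simp add: scaled_items_def item_ok_def)
    fix s :: state assume "unch (insert ''n'' (nmods ?c)) (rmods ?c) s0 s"
    then show "nval s (succ_e (nv ''N'')) = Suc ?N" using r by (simp add: unch_def ready_def inp_def)
  next
    fix n s assume n: "1 \<le> n" "n < Suc ?N" "nats s ''n'' [] = n"
      and u: "unch (insert ''n'' (nmods ?c)) (rmods ?c) s0 s" and P: "?P n s"
    have n': "n \<in> {1..?N}" using n by simp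
    have rs: "ready I \<epsilon> s" by (rule ready_unch[OF r u]) (auto simp: ready_nats_def ready_reals_def)
    have cs: "caps_ok I s" using c u by (simp add: caps_ok_def unch_def)
    let ?s = "nupdate (nupdate (rupdate (nupdate s ''L'' [n] 0) ''c'' [n, 0] 0) ''wt'' [n, 0] 0) ''a'' [] 1"
    have "run item_loop (400 * ?Y + 20) (scaled_items I g n) ?s"
    proof (rule run_item_loop[OF _ _ v J _ n' _ g(2) _ _ _ Lm[OF n']])
      show "ready I \<epsilon> ?s" using rs by (simp add: ready_nats_def ready_reals_def)
      show "caps_ok I ?s" using cs by (simp add: caps_ok_def)
      show "nats ?s ''n'' [] = n" using n by simp
      show "reals ?s ''g'' [] = g" using u g by (simp add: unch_def)
      show "item_ok I g n 0 ?s" using zero[OF n'] by (simp add: item_ok_def)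
    qed simp_all
    then have "run item_loop (400 * ?Y + 50 - 14) (scaled_items I g n) ?s" by (rule run_conseq) auto
    then have "run ?c (400 * ?Y + 50) (scaled_items I g n) s" by (simp add: n)
    then show "run ?c (400 * ?Y + 50) (?P (Suc n)) s"
    proof (rule run_row_frame[where n = "''n''"])
      fix s' assume f: "row_frame (nats s ''n'' []) s s'" and R: "scaled_items I g n s'"
      have "scaled_items I g k s'" if "k \<in> {1..<n}" for k
      proof -
        have "k \<noteq> n" using that by simp
        then show ?thesis using P that row_frameD[OF f] n by (simp add: scaled_items_def item_ok_def)
      qed
      moreover have "{1..<Suc n} = insert n {1..<n}" using n by auto
      ultimately show "?P (Suc n) s'" using R by simp
    qed auto
  next
    have N1: "1 \<le> real ?N" using N by simp
    have "real ?N * (400 * ?Y + 70) \<le> real ?N * (490 * ?Y + 490 * (?B * ?K))"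
      by (intro mult_left_mono) (use Y BK in linarith, simp)
    moreover have "1 * 1 \<le> real ?N * (?Y + ?B * ?K)" using N1 Y BK by (intro mult_mono) auto
    ultimately show "(real (Suc ?N) - real 1) * (400 * ?Y + 50 + 7 + ncost (succ_e (nv ''N''))) + 5 + ncost (succ_e (nv ''N''))
      \<le> 500 * (real ?N * ((X + 1) * (?B * ?K)))" by (simp add: algebra_simps)
  qed (use Y in auto)
  then show ?thesis by (rule run_conseq) (auto simp: atLeastLessThanSuc_atLeastAtMost)
qed

section \<open>One round for a fixed profit unit\<close>

definition select_prog :: com where
  "select_prog = CSeq (NAssign ''j'' [] (nv ''T''))
     (CWhile (RLess (RVar ''D'' [nv ''N'', nv ''j'']) (RSub (OfNat (NConst 0)) (OfNat (nv ''J'')))) (dec ''j''))"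

lemma mods_select_prog [simp]: "nmods select_prog = {''j''}" "rmods select_prog = {}"
  by (auto simp: select_prog_def)

text \<open>Scans from the top for the largest affordable profit. The hypothesis \<open>D0\<close>
  makes profit 0 affordable, which stops the scan before the counter would be truncated at
  0.\<close>

lemma run_select_prog:
  assumes N: "nats s0 ''N'' [] = N" and T: "nats s0 ''T'' [] = T" and J: "nats s0 ''J'' [] = J"
    and D0: "- real J \<le> Df s0 N 0"
  shows "run select_prog (20 * real T + 20)
    (\<lambda>s. nats s ''j'' [] \<le> T \<and> - real J \<le> Df s0 N (nats s ''j'' []) \<and>
       (\<forall>i. nats s ''j'' [] < i \<longrightarrow> i \<le> T \<longrightarrow> Df s0 N i < - real J)) s0"
proof -
  let ?b = "RLess (RVar ''D'' [nv ''N'', nv ''j'']) (RSub (OfNat (NConst 0)) (OfNat (nv ''J'')))"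
  let ?s = "nupdate s0 ''j'' [] T"
  define Inv :: "state \<Rightarrow> bool" where "Inv s \<longleftrightarrow> unch {''j''} {} s0 s \<and> nats s ''j'' [] \<le> T \<and>
    (\<forall>i. nats s ''j'' [] < i \<longrightarrow> i \<le> T \<longrightarrow> Df s0 N i < - real J)" for s
  have b: "bval s ?b \<longleftrightarrow> Df s0 N (nats s ''j'' []) < - real J" if "Inv s" for s
    using that N J by (simp add: Inv_def unch_def)
  have "run (CWhile ?b (dec ''j'')) (20 * real T + 15) (\<lambda>s. Inv s \<and> \<not> bval s ?b) ?s"
  proof (rule run_While[where \<phi> = "\<lambda>s. 20 * real (nats s ''j'' []) + 15"])
    fix s assume I: "Inv s" and "bval s ?b"
    then have lt: "Df s0 N (nats s ''j'' []) < - real J" using b by blast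
    then have "nats s ''j'' [] \<noteq> 0" using D0 by (auto intro: gr0I)
    then obtain k where k: "nats s ''j'' [] = Suc k" by (cases "nats s ''j'' []") auto
    have "Df s0 N i < - real J" if "k < i" "i \<le> T" for i
      using that lt I k by (cases "i = Suc k") (auto simp: Inv_def)
    then have "Inv (nupdate s ''j'' [] k)" using I k by (simp add: Inv_def unch_def)
    then show "\<exists>B. run (dec ''j'') B (\<lambda>s'. Inv s' \<and> 1 + real (bcost ?b) + B + (20 * real (nats s' ''j'' []) + 15) \<le> 20 * real (nats s ''j'' []) + 15) s"
      by (intro exI[of _ 6]) (simp add: k)
  qed (auto simp: Inv_def unch_def)
  then have "run (CWhile ?b (dec ''j'')) (18 + 20 * real T) (\<lambda>s. nats s ''j'' [] \<le> T \<and> - real J \<le> Df s0 N (nats s ''j'' []) \<and>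
       (\<forall>i. nats s ''j'' [] < i \<longrightarrow> i \<le> T \<longrightarrow> Df s0 N i < - real J)) ?s"
  proof (rule run_conseq)
    fix s assume *: "Inv s \<and> \<not> bval s ?b"
    then show "nats s ''j'' [] \<le> T \<and> - real J \<le> Df s0 N (nats s ''j'' []) \<and>
       (\<forall>i. nats s ''j'' [] < i \<longrightarrow> i \<le> T \<longrightarrow> Df s0 N i < - real J)"
      using b[of s] by (auto simp: Inv_def)
  qed simp
  then show ?thesis unfolding select_prog_def by (simp add: T)
qed

text \<open>\<open>best\<close> holds the certified profit \<open>j g\<close>, which may be below
  the true value of the stored solution. A new solution is traced back only if its certificate is
  better.\<close>

definition update_prog :: com where
  "update_prog = CIf (RLess (rv ''best'') (RMul (OfNat (nv ''j'')) (rv ''g'')))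
     (CSeq (RAssign ''best'' [] (RMul (OfNat (nv ''j'')) (rv ''g''))) back_prog) CSkip"

lemma mods_update_prog [simp]: "nmods update_prog = {''n'', ''j''}" "rmods update_prog = {''best'', ''P''}"
  by (auto simp: update_prog_def)

definition round_prog :: com where
  "round_prog = CSeq scaled_items_prog (CSeq dp_prog (CSeq select_prog update_prog))"

lemma mods_round_prog [simp]:
  "nmods round_prog = {''n'', ''l'', ''c'', ''q'', ''f'', ''i'', ''wt'', ''L'', ''a'', ''j'', ''ch'', ''h''}"
  "rmods round_prog = {''x'', ''v'', ''c'', ''D'', ''y'', ''best'', ''P''}"
  by (auto simp: round_prog_def)

definition sol_ok :: "noma \<Rightarrow> state \<Rightarrow> bool" where
  "sol_ok I s \<longleftrightarrow> (\<exists>l. feas_l I l \<and> (\<forall>n\<in>{1..carriers I}. reals s ''P'' [n] = real (l n) * power_unit I) \<and>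
     reals s ''best'' [] \<le> val_l I l)"

lemma sol_ok_unch: "sol_ok I s \<Longrightarrow> unch X Y s s' \<Longrightarrow> ''P'' \<notin> Y \<Longrightarrow> ''best'' \<notin> Y \<Longrightarrow> sol_ok I s'"
  by (simp add: sol_ok_def unch_def)

lemma run_update_prog:
  assumes v: "valid_noma I" and r: "ready I \<epsilon> s" and sol: "sol_ok I s" and g: "reals s ''g'' [] = g" "0 < g"
    and it: "\<forall>n\<in>{1..carriers I}. scaled_items I g n s"
    and dp: "dp_table (carriers I) T (\<lambda>n. nats s ''L'' [n]) (Suc (J_levels I)) (\<lambda>n a. - real (nats s ''wt'' [n, a])) (Df s) (chf s)"
    and j: "nats s ''j'' [] = j" "j \<le> T" "- real (J_levels I) \<le> Df s (carriers I) j"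
  shows "run update_prog (40 * real (carriers I) + 60)
    (\<lambda>s'. sol_ok I s' \<and> reals s ''best'' [] \<le> reals s' ''best'' [] \<and> real j * g \<le> reals s' ''best'' []) s"
proof (cases "reals s ''best'' [] < real j * g")
  case False
  then show ?thesis unfolding update_prog_def using sol j g by simp
next
  case True
  interpret knapsack "carriers I" "J_levels I" "cap_levels I" "Fl I" by (rule knapsack_levels[OF v])
  let ?N = "carriers I"
  let ?s = "rupdate s ''best'' [] (real j * g)"
  have e: "nats s ''N'' [] = ?N" "reals s ''delta'' [] = power_unit I" using r by (auto simp: ready_def inp_def)
  have "run back_prog (40 * real ?N + 20)
    (\<lambda>s'. \<exists>a r. (\<forall>m\<in>{1..?N}. a m \<le> nats s ''L'' [m] \<and> reals s' ''P'' [m] = real (nats ?s ''wt'' [m, a m]) * power_unit I) \<and>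
       (\<Sum>m=1..?N. a m) + r = j \<and> Df ?s ?N j = - (real (Suc (J_levels I)) * real r) + (\<Sum>m=1..?N. - real (nats s ''wt'' [m, a m]))) ?s"
    by (rule run_back_prog[where T = T and L = "\<lambda>m. nats s ''L'' [m]" and z = "Suc (J_levels I)" and
          c = "\<lambda>m a. - real (nats s ''wt'' [m, a])"]) (use e dp j in auto)
  then have "run back_prog (40 * real ?N + 60 - 14) (\<lambda>s'. sol_ok I s' \<and> reals s ''best'' [] \<le> reals s' ''best'' [] \<and> real j * g \<le> reals s' ''best'' []) ?s"
  proof (rule run_conseq)
    fix s' :: state assume u: "unch (nmods back_prog) (rmods back_prog) ?s s'"
      and "\<exists>a r. (\<forall>m\<in>{1..?N}. a m \<le> nats s ''L'' [m] \<and> reals s' ''P'' [m] = real (nats ?s ''wt'' [m, a m]) * power_unit I) \<and>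
       (\<Sum>m=1..?N. a m) + r = j \<and> Df ?s ?N j = - (real (Suc (J_levels I)) * real r) + (\<Sum>m=1..?N. - real (nats s ''wt'' [m, a m]))"
    then obtain a r where a: "\<forall>m\<in>{1..?N}. a m \<le> nats s ''L'' [m] \<and> reals s' ''P'' [m] = real (nats ?s ''wt'' [m, a m]) * power_unit I"
       "(\<Sum>m=1..?N. a m) + r = j" "Df ?s ?N j = - (real (Suc (J_levels I)) * real r) + (\<Sum>m=1..?N. - real (nats s ''wt'' [m, a m]))" by blast
    have best: "reals s' ''best'' [] = real j * g" using u by (simp add: unch_def)
    have "feas (\<lambda>n. nats s ''wt'' [n, a n]) \<and> real j * g \<le> val (\<lambda>n. nats s ''wt'' [n, a n])"
    proof (rule scaled_dp_feasible[where D = "Df s" and r = r and a = a and j = j])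
      show "Df s ?N j = - (real (Suc (J_levels I)) * real r) + (\<Sum>n=1..?N. - real (nats s ''wt'' [n, a n]))" using a(3) by simp
      fix n assume n: "n \<in> {1..?N}"
      then have "item_ok I g n (a n) s" using it a(1) by (simp add: scaled_items_def)
      then show "nats s ''wt'' [n, a n] \<le> cap_levels I n \<and> real (a n) * g \<le> Fl I n (nats s ''wt'' [n, a n])"
        by (simp add: item_ok_def)
    qed (use j a(2) g in auto)
    moreover have "reals s' ''P'' [m] = real (nats s ''wt'' [m, a m]) * power_unit I" if "m \<in> {1..?N}" for m
      using a(1) that by simp
    ultimately have "sol_ok I s'" unfolding sol_ok_def best by (intro exI[of _ "\<lambda>n. nats s ''wt'' [n, a n]"]) auto
    then show "sol_ok I s' \<and> reals s ''best'' [] \<le> reals s' ''best'' [] \<and> real j * g \<le> reals s' ''best'' []"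
      using True best by simp
  qed simp
  then show ?thesis unfolding update_prog_def using True j g by (simp, elim run_conseq) auto
qed

text \<open>The guarantee is absolute: after the round, \<open>best\<close> is within
  \<open>N g\<close> of every solution whose value the profit table can hold. Turning this into a
  relative error is left to the choice of \<open>g\<close>. The cost consists of
  \<open>X + 1\<close> searches per carrier and of the dynamic program.\<close>

lemma run_round_prog:
  assumes r: "ready I \<epsilon> s0" and c: "caps_ok I s0" and v: "valid_noma I" and J: "1 \<le> J_levels I"
    and g: "reals s0 ''g'' [] = g" "0 < g" and X: "0 \<le> X"
    and Lm: "\<And>n. n \<in> {1..carriers I} \<Longrightarrow> Fl I n (cap_levels I n) \<le> X * g"
    and T: "nats s0 ''T'' [] = T" and z: "nats s0 ''z'' [] = Suc (J_levels I)" and sol: "sol_ok I s0"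
  shows "run round_prog (1000 * (real (carriers I) * ((X + 1) * (real (num_bits (J_levels I)) * real (users I) + real T + 1))))
    (\<lambda>s. sol_ok I s \<and> reals s0 ''best'' [] \<le> reals s ''best'' [] \<and>
      (\<forall>l. feas_l I l \<longrightarrow> val_l I l \<le> real T * g \<longrightarrow> val_l I l - real (carriers I) * g \<le> reals s ''best'' [])) s0"
proof -
  interpret knapsack "carriers I" "J_levels I" "cap_levels I" "Fl I" by (rule knapsack_levels[OF v])
  let ?N = "carriers I" and ?J = "J_levels I"
  let ?BK = "real (num_bits (J_levels I)) * real (users I)"
  let ?Lm = "nat \<lfloor>X\<rfloor>"
  let ?C1 = "500 * (real ?N * ((X + 1) * ?BK))"
  let ?C2 = "400 * (real ?N * (real T + 1) * (real ?Lm + 1))"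
  let ?Q = "\<lambda>s. sol_ok I s \<and> reals s0 ''best'' [] \<le> reals s ''best'' [] \<and>
      (\<forall>l. feas l \<longrightarrow> val l \<le> real T * g \<longrightarrow> val l - real ?N * g \<le> reals s ''best'' [])"
  have "run round_prog (?C1 + (?C2 + (20 * real T + 20 + (40 * real ?N + 60)))) ?Q s0"
    unfolding round_prog_def
  proof (rule run_Seq[OF run_scaled_items_prog[OF r c v J g X Lm] _ order_refl])
    fix s1 assume u1: "unch (nmods scaled_items_prog) (rmods scaled_items_prog) s0 s1"
      and it: "\<forall>n\<in>{1..?N}. scaled_items I g n s1"
    let ?L = "\<lambda>n. nats s1 ''L'' [n]" and ?c = "\<lambda>n a. - real (nats s1 ''wt'' [n, a])"
    have r1: "ready I \<epsilon> s1" by (rule ready_unch[OF r u1]) (auto simp: ready_nats_def ready_reals_def)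
    have e1: "nats s1 ''N'' [] = ?N" "nats s1 ''T'' [] = T" "nats s1 ''z'' [] = Suc ?J"
      using u1 r1 T z by (auto simp: unch_def ready_def inp_def)
    have LL: "?L n = ?L n \<and> ?L n \<le> ?Lm" if n: "n \<in> {1..?N}" for n
    proof -
      have "real (?L n) * g \<le> Fl I n (cap_levels I n)" using it n by (simp add: scaled_items_def)
      then have "real (?L n) * g \<le> X * g" using Lm[OF n] by linarith
      then have "real (?L n) \<le> X" using g by simp
      then show ?thesis by (simp add: le_nat_floor)
    qed
    show "run (CSeq dp_prog (CSeq select_prog update_prog)) (?C2 + (20 * real T + 20 + (40 * real ?N + 60))) ?Q s1"
    proof (rule run_Seq[OF run_dp_prog[OF e1(1) N e1(2,3), of ?L ?Lm ?c, OF LL] _ order_refl])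
      show "reals s1 ''c'' [n, a] = - real (nats s1 ''wt'' [n, a])" if "n \<in> {1..?N}" "a \<le> ?L n" for n a
        using it that by (simp add: scaled_items_def item_ok_def)
      fix s2 assume u2: "unch (nmods dp_prog) (rmods dp_prog) s1 s2"
        and dp: "dp_table ?N T ?L (Suc ?J) ?c (Df s2) (chf s2)"
      have r2: "ready I \<epsilon> s2" by (rule ready_unch[OF r1 u2]) (auto simp: ready_nats_def ready_reals_def)
      have e2: "nats s2 ''N'' [] = ?N" "nats s2 ''T'' [] = T" "nats s2 ''J'' [] = ?J"
        "nats s2 ''wt'' = nats s1 ''wt''" "nats s2 ''L'' = nats s1 ''L''" "reals s2 ''c'' = reals s1 ''c''"
        using u2 e1 r2 by (auto simp: unch_def ready_def inp_def)
      have wt0: "nats s1 ''wt'' [n, 0] = 0" if n: "n \<in> {1..?N}" for n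
      proof -
        have "item_ok I g n 0 s1" using it n by (simp add: scaled_items_def)
        then show ?thesis using zero[OF n] by (auto simp: item_ok_def)
      qed
      \<comment> \<open>Applies \<open>dp_upper\<close> to the zero choice, whose weights vanish; so
        the scan for an affordable profit ends at index 0 at the latest.\<close>
      have "(\<Sum>i=1..?N. ?c i 0) - real (Suc ?J) * (real 0 - real (\<Sum>i=1..?N. 0::nat)) \<le> Df s2 ?N 0"
        by (rule dp_upper[OF dp]) auto
      then have "- real ?J \<le> Df s2 ?N 0" using wt0 by simp
      from run_select_prog[OF e2(1,2,3) this]
      show "run (CSeq select_prog update_prog) (20 * real T + 20 + (40 * real ?N + 60)) ?Q s2"
      proof (rule run_Seq[OF _ _ order_refl])
        fix s3 assume u3: "unch (nmods select_prog) (rmods select_prog) s2 s3"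
          and j: "nats s3 ''j'' [] \<le> T \<and> - real ?J \<le> Df s2 ?N (nats s3 ''j'' []) \<and>
            (\<forall>i. nats s3 ''j'' [] < i \<longrightarrow> i \<le> T \<longrightarrow> Df s2 ?N i < - real ?J)"
        let ?j = "nats s3 ''j'' []"
        have r3: "ready I \<epsilon> s3" by (rule ready_unch[OF r2 u3]) (auto simp: ready_nats_def ready_reals_def)
        have "unch {''n'', ''l'', ''c'', ''q'', ''f'', ''i'', ''wt'', ''L'', ''a'', ''j'', ''ch'', ''h''} {''x'', ''v'', ''c'', ''D'', ''y''} s0 s2"
          by (rule unch_trans[OF u1 u2]) auto
        from unch_trans[OF this u3, of "{''n'', ''l'', ''c'', ''q'', ''f'', ''i'', ''wt'', ''L'', ''a'', ''j'', ''ch'', ''h''}" "{''x'', ''v'', ''c'', ''D'', ''y''}"]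
        have u: "unch {''n'', ''l'', ''c'', ''q'', ''f'', ''i'', ''wt'', ''L'', ''a'', ''j'', ''ch'', ''h''} {''x'', ''v'', ''c'', ''D'', ''y''} s0 s3"
          by simp
        have sol3: "sol_ok I s3" by (rule sol_ok_unch[OF sol u]) simp_all
        have e3: "reals s3 ''g'' [] = g" "reals s3 ''best'' = reals s0 ''best''" using u g by (auto simp: unch_def)
        have f3: "nats s3 ''wt'' = nats s1 ''wt''" "nats s3 ''L'' = nats s1 ''L''" "reals s3 ''c'' = reals s1 ''c''"
          "reals s3 ''D'' = reals s2 ''D''" "nats s3 ''ch'' = nats s2 ''ch''"
          using u3 e2 by (auto simp: unch_def)
        have "run update_prog (40 * real ?N + 60)
          (\<lambda>s'. sol_ok I s' \<and> reals s3 ''best'' [] \<le> reals s' ''best'' [] \<and> real ?j * g \<le> reals s' ''best'' []) s3"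
          by (rule run_update_prog[OF v r3 sol3 e3(1) g(2), where T = T])
            (use it dp j in \<open>simp_all add: f3 scaled_items_def item_ok_def\<close>)
        then show "run update_prog (40 * real ?N + 60) ?Q s3"
        proof (rule run_conseq)
          fix s' assume *: "sol_ok I s' \<and> reals s3 ''best'' [] \<le> reals s' ''best'' [] \<and> real ?j * g \<le> reals s' ''best'' []"
          have "val l - real ?N * g \<le> real ?j * g" if l: "feas l" "val l \<le> real T * g" for l
          proof (rule scaled_dp_good[OF dp g(2) l(2,1)])
            show "Fl I n (cap_levels I n) < real (Suc (?L n)) * g" if "n \<in> {1..?N}" for n
              using it that unfolding scaled_items_def by blast
            show "nats s1 ''wt'' [n, a] \<le> k" if "n \<in> {1..?N}" "a \<le> ?L n" "k \<le> cap_levels I n" "real a * g \<le> Fl I n k" for n a k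
              using it that unfolding scaled_items_def item_ok_def by blast
          qed (use j in auto)
          then show "?Q s'" using * e3(2) by force
        qed simp
      qed
    qed
  qed
  then show ?thesis
  proof (rule run_conseq)
    have N1: "1 \<le> real ?N" using N by simp
    have "real ?Lm \<le> X" using X by simp
    then have a: "real ?N * (real T + 1) * (real ?Lm + 1) \<le> real ?N * ((X + 1) * (real T + 1))"
      by (simp add: mult.assoc mult.commute[of "real T + 1"] mult_left_mono mult_right_mono)
    have "1 * (1 * (real T + 1)) \<le> real ?N * ((X + 1) * (real T + 1))"
      using N1 X by (intro mult_mono) auto
    moreover have "real ?N * (1 * 1) \<le> real ?N * ((X + 1) * (real T + 1))"
      using X by (intro mult_left_mono mult_mono) auto
    moreover have "0 \<le> real ?N * ((X + 1) * ?BK)" using X by simp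
    moreover have "500 * p + (400 * y + (20 * t + 20 + (40 * n + 60))) \<le> 1000 * (p + q)"
      if "y \<le> q" "t + 1 \<le> q" "n \<le> q" "0 \<le> t" "0 \<le> p" "1 \<le> n" for p q y t n :: real
      using that by simp
    ultimately have "?C1 + (?C2 + (20 * real T + 20 + (40 * real ?N + 60))) \<le>
      1000 * (real ?N * ((X + 1) * ?BK) + real ?N * ((X + 1) * (real T + 1)))"
      using a N1 of_nat_0_le_iff unfolding mult_1 mult_1_right by blast
    also have "\<dots> = 1000 * (real ?N * ((X + 1) * (?BK + real T + 1)))" by (simp add: algebra_simps)
    finally show "?C1 + (?C2 + (20 * real T + 20 + (40 * real ?N + 60))) \<le> 1000 * (real ?N * ((X + 1) * (?BK + real T + 1)))" .
  qed
qed

section \<open>The combined algorithm\<close>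

text \<open>Computes a natural number \<open>T\<close> with \<open>T \<epsilon> \<ge> 2 N\<close> by
  counting. With \<open>g = \<epsilon> V / N\<close> a table of length \<open>T\<close> then reaches
  profit \<open>2 V\<close>, in every round with the same \<open>T\<close>.\<close>

definition granularity_prog :: com where
  "granularity_prog = CSeq (NAssign ''T'' [] (NConst 0))
     (CWhile (RLess (RMul (OfNat (nv ''T'')) (rv ''eps'')) (OfNat (NAdd (nv ''N'') (nv ''N'')))) (inc ''T''))"

lemma mods_granularity_prog [simp]: "nmods granularity_prog = {''T''}" "rmods granularity_prog = {}"
  by (auto simp: granularity_prog_def)

lemma run_granularity_prog:
  assumes N: "nats s0 ''N'' [] = N" and e: "reals s0 ''eps'' [] = \<epsilon>" "0 < \<epsilon>"
  shows "run granularity_prog (20 * (2 * real N / \<epsilon>) + 50)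
    (\<lambda>s. 2 * real N \<le> real (nats s ''T'' []) * \<epsilon> \<and> real (nats s ''T'' []) \<le> 2 * real N / \<epsilon> + 1) s0"
proof -
  let ?b = "RLess (RMul (OfNat (nv ''T'')) (rv ''eps'')) (OfNat (NAdd (nv ''N'') (nv ''N'')))"
  let ?s = "nupdate s0 ''T'' [] 0" and ?M = "2 * real N / \<epsilon>"
  define Inv :: "state \<Rightarrow> bool" where "Inv s \<longleftrightarrow> unch {''T''} {} s0 s \<and> real (nats s ''T'' []) \<le> ?M + 1" for s
  have b: "bval s ?b \<longleftrightarrow> real (nats s ''T'' []) * \<epsilon> < 2 * real N" if "Inv s" for s
    using that N e by (simp add: Inv_def unch_def)
  have "run (CWhile ?b (inc ''T'')) (20 * ?M + 40) (\<lambda>s. Inv s \<and> \<not> bval s ?b) ?s"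
  proof (rule run_While[where \<phi> = "\<lambda>s. 20 * (?M + 1 - real (nats s ''T'' [])) + 20"])
    show "Inv ?s" using e by (simp add: Inv_def unch_def)
    fix s assume "Inv s"
    then show "1 + real (bcost ?b) \<le> 20 * (?M + 1 - real (nats s ''T'' [])) + 20" by (simp add: Inv_def)
  next
    fix s assume I: "Inv s" and "bval s ?b"
    then have "real (nats s ''T'' []) * \<epsilon> < 2 * real N" using b by blast
    then have "real (nats s ''T'' []) < ?M" using e by (simp add: pos_less_divide_eq)
    then show "\<exists>B. run (inc ''T'') B (\<lambda>s'. Inv s' \<and> 1 + real (bcost ?b) + B + (20 * (?M + 1 - real (nats s' ''T'' [])) + 20)
        \<le> 20 * (?M + 1 - real (nats s ''T'' [])) + 20) s"
      using I by (intro exI[of _ 6]) (simp add: Inv_def unch_def)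
  qed simp
  then have "run (CWhile ?b (inc ''T'')) (20 * ?M + 48)
     (\<lambda>s. 2 * real N \<le> real (nats s ''T'' []) * \<epsilon> \<and> real (nats s ''T'' []) \<le> ?M + 1) ?s"
  proof (rule run_conseq)
    fix s assume *: "Inv s \<and> \<not> bval s ?b"
    then show "2 * real N \<le> real (nats s ''T'' []) * \<epsilon> \<and> real (nats s ''T'' []) \<le> ?M + 1"
      using b[of s] by (simp add: Inv_def not_less)
  qed simp
  then show ?thesis unfolding granularity_prog_def by (simp, elim run_conseq) auto
qed

definition doubling_prog :: com where
  "doubling_prog = CWhile (BNot (RLess (RMul (OfNat (nv ''N'')) (rv ''U'')) (rv ''V'')))
     (CSeq (RAssign ''g'' [] (RDiv (RMul (rv ''eps'') (rv ''V'')) (OfNat (nv ''N''))))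
     (CSeq round_prog (RAssign ''V'' [] (RAdd (rv ''V'') (rv ''V'')))))"

text \<open>The round for \<open>V\<close> serves the solutions with value in
  \<open>[V, 2 V)\<close>, where the loss \<open>N g = \<epsilon> V\<close> is at most
  \<open>\<epsilon>\<close> times the value. Since \<open>U / V\<close> halves with every round, the
  potential \<open>2 c U / V\<close> pays for the current round and keeps half of itself for the
  later ones.\<close>

lemma run_doubling_prog:
  assumes r: "ready I \<epsilon> s0" and c: "caps_ok I s0" and v: "valid_noma I" and J: "1 \<le> J_levels I"
    and \<epsilon>: "0 < \<epsilon>" "\<epsilon> < 1" and U: "reals s0 ''U'' [] = U" "0 < U" and V0: "reals s0 ''V'' [] = U"
    and T: "nats s0 ''T'' [] = T" "2 * real (carriers I) \<le> real T * \<epsilon>" and z: "nats s0 ''z'' [] = Suc (J_levels I)"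
    and sol: "sol_ok I s0" and b0: "reals s0 ''best'' [] = 0"
  shows "run doubling_prog
    (5000 * (real (carriers I) * (real (carriers I) / \<epsilon>) * (real (num_bits (J_levels I)) * real (users I) + real T + 1)))
    (solved I \<epsilon>) s0"
proof -
  interpret knapsack "carriers I" "J_levels I" "cap_levels I" "Fl I" by (rule knapsack_levels[OF v])
  let ?N = "carriers I" and ?BK = "real (num_bits (J_levels I)) * real (users I)"
  let ?Z = "?BK + real T + 1"
  \<comment> \<open>Up to the factor \<open>U / V\<close> this is the cost of a round: 1000 from
    \<open>run_round_prog\<close>, doubled because \<open>X + 1 \<le> 2 X\<close>, and 100 for the
    overhead.\<close>
  let ?c = "2100 * (real ?N * (real ?N / \<epsilon>) * ?Z)"
  let ?b = "BNot (RLess (RMul (OfNat (nv ''N'')) (rv ''U'')) (rv ''V''))"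
  let ?d = "CSeq (RAssign ''g'' [] (RDiv (RMul (rv ''eps'') (rv ''V'')) (OfNat (nv ''N''))))
     (CSeq round_prog (RAssign ''V'' [] (RAdd (rv ''V'') (rv ''V''))))"
  have N1: "1 \<le> real ?N" using N by simp
  have Z: "1 \<le> ?Z" by simp
  have FU: "Fl I n (cap_levels I n) \<le> U" if "n \<in> {1..?N}" for n using c U that by (simp add: caps_ok_def)
  define Inv :: "state \<Rightarrow> bool" where "Inv s \<longleftrightarrow> unch (nmods ?d) (rmods ?d) s0 s \<and> U \<le> reals s ''V'' [] \<and> sol_ok I s \<and>
    0 \<le> reals s ''best'' [] \<and>
    (\<forall>l. feas l \<longrightarrow> U \<le> val l \<longrightarrow> val l < reals s ''V'' [] \<longrightarrow> (1 - \<epsilon>) * val l \<le> reals s ''best'' [])" for s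
  have e: "nats s ''N'' [] = ?N" "reals s ''U'' [] = U" "reals s ''eps'' [] = \<epsilon>" "nats s ''T'' [] = T"
     "nats s ''z'' [] = Suc (J_levels I)" if "Inv s" for s
    using that r U T z by (auto simp: Inv_def unch_def ready_def inp_def)
  have "run (CWhile ?b ?d) (2 * ?c + 20) (\<lambda>s. Inv s \<and> \<not> bval s ?b) s0"
  proof (rule run_While[where \<phi> = "\<lambda>s. 2 * ?c * (U / reals s ''V'' []) + 20"])
    show "Inv s0" using sol b0 V0 by (simp add: Inv_def)
    show "2 * ?c * (U / reals s0 ''V'' []) + 20 \<le> 2 * ?c + 20" using V0 U by simp
    fix s assume I: "Inv s"
    have "0 \<le> 2 * ?c * (U / reals s ''V'' [])" using I U \<epsilon> by (simp add: Inv_def)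
    then show "1 + real (bcost ?b) \<le> 2 * ?c * (U / reals s ''V'' []) + 20" by simp
  next
    fix s assume I: "Inv s" and b: "bval s ?b"
    let ?V = "reals s ''V'' []"
    define g where "g = \<epsilon> * ?V / real ?N"
    define X where "X = U / g"
    have V: "U \<le> ?V" "0 < ?V" "?V \<le> real ?N * U" using b e[OF I] I U by (auto simp: Inv_def not_less)
    have g: "0 < g" "real ?N * g = \<epsilon> * ?V" using V \<epsilon> N1 by (simp_all add: g_def)
    have X: "0 \<le> X" "X * g = U" using g U by (simp_all add: X_def)
    have XV: "X = real ?N / \<epsilon> * (U / ?V)" by (simp add: X_def g_def field_simps)
    have "g \<le> U"
    proof -
      have "real ?N * g \<le> 1 * ?V" unfolding g(2) using \<epsilon> V by (intro mult_right_mono) auto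
      also have "\<dots> \<le> real ?N * U" using V by simp
      finally show ?thesis using N1 by simp
    qed
    \<comment> \<open>The loop test gives \<open>V \<le> N U\<close>, and
      \<open>\<epsilon> < 1\<close>, so one profit unit never exceeds \<open>U\<close>. Therefore
      the \<open>+ 1\<close> in the round cost is absorbed and the cost is truly proportional to
      \<open>U / V\<close>.\<close>
    then have X1: "1 \<le> X" using g by (simp add: X_def)
    let ?s = "rupdate s ''g'' [] g"
    have u: "unch (nmods ?d) (rmods ?d) s0 s" using I by (simp add: Inv_def)
    have us: "unch (nmods ?d) (rmods ?d) s0 ?s" using u by (simp add: unch_def)
    have rs: "ready I \<epsilon> ?s" by (rule ready_unch[OF r us]) (auto simp: ready_nats_def ready_reals_def)
    have cs: "caps_ok I ?s" using c us by (simp add: caps_ok_def unch_def)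
    have ss: "sol_ok I ?s" using I by (simp add: Inv_def sol_ok_def)
    have rnd: "run round_prog (1000 * (real ?N * ((X + 1) * ?Z)))
      (\<lambda>s'. sol_ok I s' \<and> reals ?s ''best'' [] \<le> reals s' ''best'' [] \<and>
        (\<forall>l. feas l \<longrightarrow> val l \<le> real T * g \<longrightarrow> val l - real ?N * g \<le> reals s' ''best'' [])) ?s"
      by (rule run_round_prog[OF rs cs v J _ g(1) X(1) _ _ _ ss]) (use FU X(2) e[OF I] in auto)
    have "run (CSeq round_prog (RAssign ''V'' [] (RAdd (rv ''V'') (rv ''V'')))) (1000 * (real ?N * ((X + 1) * ?Z)) + 6)
      (\<lambda>s'. Inv s' \<and> reals s' ''V'' [] = ?V + ?V) ?s"
    proof (rule run_Seq[OF rnd _ order_refl])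
      fix t assume ut: "unch (nmods round_prog) (rmods round_prog) ?s t"
        and t: "sol_ok I t \<and> reals ?s ''best'' [] \<le> reals t ''best'' [] \<and>
        (\<forall>l. feas l \<longrightarrow> val l \<le> real T * g \<longrightarrow> val l - real ?N * g \<le> reals t ''best'' [])"
      have tV: "reals t ''V'' [] = ?V" using ut by (simp add: unch_def)
      let ?t = "rupdate t ''V'' [] (?V + ?V)"
      have best: "reals s ''best'' [] \<le> reals t ''best'' []" using t by simp
      have good: "(1 - \<epsilon>) * val l \<le> reals t ''best'' []" if l: "feas l" "U \<le> val l" "val l < ?V + ?V" for l
      proof (cases "val l < ?V")
        case True
        then have "(1 - \<epsilon>) * val l \<le> reals s ''best'' []" using I l by (simp add: Inv_def)
        then show ?thesis using best by simp
      next
        case False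
        \<comment> \<open>The choice of \<open>T\<close> makes the table long enough for all values
          below the next guess.\<close>
        have "?V + ?V = 2 * real ?N * g / \<epsilon>" using g(2) \<epsilon> by (simp add: field_simps)
        also have "\<dots> \<le> real T * \<epsilon> * g / \<epsilon>" using T(2) g \<epsilon> by (intro divide_right_mono mult_right_mono) auto
        also have "\<dots> = real T * g" using \<epsilon> by simp
        finally have "val l \<le> real T * g" using l by simp
        then have "val l - real ?N * g \<le> reals t ''best'' []" using t l by blast
        moreover have "\<epsilon> * ?V \<le> \<epsilon> * val l" using False \<epsilon> by (intro mult_left_mono) auto
        ultimately show ?thesis using g(2) by (simp add: algebra_simps)
      qed
      have "unch (nmods ?d) (rmods ?d) s0 t" by (rule unch_trans[OF us ut]) auto
      then have "unch (nmods ?d) (rmods ?d) s0 ?t" by (simp add: unch_def)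
      moreover have "sol_ok I ?t" using t by (simp add: sol_ok_def)
      ultimately have "Inv ?t" using V best I good by (simp add: Inv_def)
      then show "run (RAssign ''V'' [] (RAdd (rv ''V'') (rv ''V''))) 6 (\<lambda>s'. Inv s' \<and> reals s' ''V'' [] = ?V + ?V) t"
        by (simp add: tV)
    qed
    then have d: "run ?d (1000 * (real ?N * ((X + 1) * ?Z)) + 20) (\<lambda>s'. Inv s' \<and> reals s' ''V'' [] = ?V + ?V) s"
      by (simp add: e[OF I] g_def, elim run_conseq) auto
    have "real ?N * ((X + 1) * ?Z) \<le> real ?N * (2 * X * ?Z)" using X1 Z by (intro mult_left_mono mult_right_mono) auto
    moreover have "1 * (1 * 1) \<le> real ?N * (X * ?Z)" using N1 X1 Z by (intro mult_mono) auto
    moreover have "1000 * y + 40 \<le> 2100 * w" if "y \<le> 2 * w" "1 \<le> w" for y w :: real using that by simp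
    moreover have "real ?N * (2 * X * ?Z) = 2 * (real ?N * (X * ?Z))" by simp
    ultimately have "1000 * (real ?N * ((X + 1) * ?Z)) + 40 \<le> 2100 * (real ?N * (X * ?Z))" by simp
    also have "\<dots> = ?c * (U / ?V)" unfolding XV by (simp add: mult_ac)
    finally have cost: "1000 * (real ?N * ((X + 1) * ?Z)) + 40 \<le> ?c * (U / ?V)" .
    have half: "2 * ?c * (U / (?V + ?V)) = ?c * (U / ?V)"
    proof -
      have "U / (?V + ?V) = U / ?V / 2" using V by (simp add: field_simps)
      then show ?thesis by simp
    qed
    have "run ?d (1000 * (real ?N * ((X + 1) * ?Z)) + 20) (\<lambda>s'. Inv s' \<and> 1 + real (bcost ?b) +
        (1000 * (real ?N * ((X + 1) * ?Z)) + 20) + (2 * ?c * (U / reals s' ''V'' []) + 20) \<le> 2 * ?c * (U / ?V) + 20) s"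
    proof (rule run_conseq[OF d order_refl])
      fix s' :: state assume s': "Inv s' \<and> reals s' ''V'' [] = ?V + ?V"
      then have sV: "reals s' ''V'' [] = ?V + ?V" by blast
      have dbl: "2 * ?c * (U / ?V) = ?c * (U / ?V) + ?c * (U / ?V)" by simp
      have bc: "real (bcost ?b) = 7" by simp
      show "Inv s' \<and> 1 + real (bcost ?b) +
        (1000 * (real ?N * ((X + 1) * ?Z)) + 20) + (2 * ?c * (U / reals s' ''V'' []) + 20) \<le> 2 * ?c * (U / ?V) + 20"
        unfolding sV half dbl bc using s' cost by linarith
    qed
    then show "\<exists>B. run ?d B (\<lambda>s'. Inv s' \<and> 1 + real (bcost ?b) + B + (2 * ?c * (U / reals s' ''V'' []) + 20)
        \<le> 2 * ?c * (U / ?V) + 20) s" by blast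
  qed
  then show ?thesis unfolding doubling_prog_def
  proof (rule run_conseq)
    have "1 \<le> real ?N / \<epsilon>" using N1 \<epsilon> by (simp add: pos_le_divide_eq)
    then have "1 * 1 * 1 \<le> real ?N * (real ?N / \<epsilon>) * ?Z"
      using \<epsilon> by (intro mult_mono N1 Z) simp_all
    moreover have "2 * (2100 * x) + 20 \<le> 5000 * x" if "1 * 1 * 1 \<le> x" for x :: real using that by simp
    ultimately show "2 * ?c + 20 \<le> 5000 * (real ?N * (real ?N / \<epsilon>) * ?Z)" by blast
  next
    fix s assume *: "Inv s \<and> \<not> bval s ?b"
    then have V: "real ?N * U < reals s ''V'' []" using e[of s] by simp
    obtain l where l: "feas l" "\<forall>n\<in>{1..?N}. reals s ''P'' [n] = real (l n) * power_unit I" "reals s ''best'' [] \<le> val l"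
      using * by (auto simp: Inv_def sol_ok_def)
    obtain n where n: "n \<in> {1..?N}" "U = Fl I n (cap_levels I n)" using c U by (auto simp: caps_ok_def)
    have "(1 - \<epsilon>) * val l' \<le> reals s ''best'' []" if l': "feas l'" for l'
    proof (cases "U \<le> val l'")
      case True
      then show ?thesis using * val_le[OF l' FU] V l' by (simp add: Inv_def)
    next
      case False
      \<comment> \<open>Solutions worth less than \<open>U\<close> fall below the first guess. They
        are dominated by the single carrier that attains \<open>U\<close>, which some round has
        served.\<close>
      let ?l = "\<lambda>i. if i = n then cap_levels I n else 0"
      have "feas ?l" "val ?l = U" using feas_single[OF n(1)] n(2) by auto
      moreover have "U < reals s ''V'' []" using V N1 U mult_right_mono[of 1 "real ?N" U] by linarith
      ultimately have "(1 - \<epsilon>) * U \<le> reals s ''best'' []" using * unfolding Inv_def by (metis order_refl)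
      moreover have "(1 - \<epsilon>) * val l' \<le> (1 - \<epsilon>) * U" using False \<epsilon> by (intro mult_left_mono) auto
      ultimately show ?thesis by simp
    qed
    then have "levels_approx I \<epsilon> l" using l unfolding levels_approx_def by (meson order_trans)
    then show "solved I \<epsilon> s" using l(2) unfolding solved_def by blast
  qed
qed

definition scaled_prog :: com where
  "scaled_prog = CIf (RLess (OfNat (NConst 0)) (rv ''U''))
     (CSeq granularity_prog (CSeq (NAssign ''z'' [] (succ_e (nv ''J'')))
       (CSeq (RAssign ''V'' [] (rv ''U'')) (CSeq (RAssign ''best'' [] (OfNat (NConst 0))) doubling_prog)))) CSkip"

lemma levels_approx_zero:
  assumes v: "valid_noma I" and 0: "\<And>l. feas_l I l \<Longrightarrow> (1 - \<epsilon>) * val_l I l \<le> 0"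
  shows "levels_approx I \<epsilon> (\<lambda>_. 0)"
proof -
  interpret knapsack "carriers I" "J_levels I" "cap_levels I" "Fl I" by (rule knapsack_levels[OF v])
  have "feas (\<lambda>_. 0)" "val (\<lambda>_. 0) = 0" using zero by (simp_all add: feas_def val_def)
  then show ?thesis using 0 by (simp add: levels_approx_def)
qed

lemma run_scaled_prog:
  assumes r: "ready I \<epsilon> s0" and c: "caps_ok I s0" and v: "valid_noma I" and J: "1 \<le> J_levels I"
    and \<epsilon>: "0 < \<epsilon>" "\<epsilon> < 1" and P: "\<And>n. reals s0 ''P'' [n] = 0"
  shows "run scaled_prog (25000 * (real (num_bits (J_levels I)) * real (carriers I) ^ 2 * real (users I) / \<epsilon> + real (carriers I) ^ 3 / \<epsilon> ^ 2))
    (solved I \<epsilon>) s0"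
proof -
  interpret knapsack "carriers I" "J_levels I" "cap_levels I" "Fl I" by (rule knapsack_levels[OF v])
  let ?N = "carriers I" and ?BK = "real (num_bits (J_levels I)) * real (users I)"
  define M where "M = real ?N / \<epsilon>"
  have N1: "1 \<le> real ?N" using N by simp
  have M1: "1 \<le> M" using N1 \<epsilon> by (simp add: M_def field_simps)
  let ?t = "real (num_bits (J_levels I)) * real ?N ^ 2 * real (users I) / \<epsilon> + real ?N ^ 3 / \<epsilon> ^ 2"
  have t: "?t = real ?N * M * ?BK + real ?N * M * M"
    by (simp add: M_def power2_eq_square power3_eq_cube)
  \<comment> \<open>Lets the counting loop for \<open>T\<close>, whose cost is of order
    \<open>N / \<epsilon>\<close>, disappear in the term
    \<open>N ^ 3 / \<epsilon> ^ 2\<close>.\<close>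
  have M2: "M \<le> real ?N * M * M"
    using N1 M1 mult_mono[of 1 "real ?N * M" M M] mult_mono[of 1 "real ?N" 1 M] by simp
  have BK0: "0 \<le> real ?N * M * ?BK" using M1 by simp
  show ?thesis
  proof (cases "0 < reals s0 ''U'' []")
    \<comment> \<open>If no carrier earns anything, every solution has value 0, and the output
      cells, still zero, are already optimal. This also excludes a doubling loop started at
      0.\<close>
    case False
    have "val l \<le> real ?N * 0" if "feas l" for l
      by (rule val_le[OF that]) (use False c in \<open>force simp: caps_ok_def\<close>)
    then have "val l = 0" if "feas l" for l using that val_nonneg[OF that] by fastforce
    then have "levels_approx I \<epsilon> (\<lambda>_. 0)" by (intro levels_approx_zero[OF v]) simp
    then have "solved I \<epsilon> s0" using P unfolding solved_def by (intro exI[of _ "\<lambda>_. 0"]) simp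
    moreover have "6 \<le> 25000 * (x + y)" if "1 \<le> M" "M \<le> y" "0 \<le> x" for x y using that by simp
    then have "6 \<le> 25000 * ?t" unfolding t using M1 M2 BK0 by blast
    ultimately show ?thesis unfolding scaled_prog_def using False by simp
  next
    case True
    let ?rest = "CSeq (NAssign ''z'' [] (succ_e (nv ''J'')))
       (CSeq (RAssign ''V'' [] (rv ''U'')) (CSeq (RAssign ''best'' [] (OfNat (NConst 0))) doubling_prog))"
    let ?D = "5000 * (real ?N * M * (?BK + (2 * M + 1) + 1))"
    have eN: "nats s0 ''N'' [] = ?N" "reals s0 ''eps'' [] = \<epsilon>" using r by (auto simp: ready_def inp_def)
    have "run (CSeq granularity_prog ?rest) (20 * (2 * real ?N / \<epsilon>) + 50 + (?D + 30)) (solved I \<epsilon>) s0"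
    proof (rule run_Seq[OF run_granularity_prog[OF eN \<epsilon>(1)] _ order_refl])
      fix s assume u: "unch (nmods granularity_prog) (rmods granularity_prog) s0 s"
        and T: "2 * real ?N \<le> real (nats s ''T'' []) * \<epsilon> \<and> real (nats s ''T'' []) \<le> 2 * real ?N / \<epsilon> + 1"
      let ?T = "nats s ''T'' []" and ?U = "reals s0 ''U'' []"
      let ?s = "rupdate (rupdate (nupdate s ''z'' [] (Suc (J_levels I))) ''V'' [] ?U) ''best'' [] 0"
      have us: "unch {''T'', ''z''} {''V'', ''best''} s0 ?s" using u by (simp add: unch_def)
      have rs: "ready I \<epsilon> ?s" by (rule ready_unch[OF r us]) (auto simp: ready_nats_def ready_reals_def)
      have cs: "caps_ok I ?s" using c us by (simp add: caps_ok_def unch_def)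
      have "feas (\<lambda>_. 0)" "val (\<lambda>_. 0) = 0" using zero by (simp_all add: feas_def val_def)
      moreover have "reals ?s ''P'' [n] = 0" for n using us P by (simp add: unch_def)
      ultimately have ss: "sol_ok I ?s" unfolding sol_ok_def by (intro exI[of _ "\<lambda>_. 0"]) simp
      have eU: "reals s ''U'' [] = ?U" "nats s ''J'' [] = J_levels I" using u r by (simp_all add: unch_def ready_def)
      have "run doubling_prog (5000 * (real ?N * (real ?N / \<epsilon>) * (?BK + real ?T + 1))) (solved I \<epsilon>) ?s"
        by (rule run_doubling_prog[OF rs cs v J \<epsilon> _ True _ _ _ _ ss]) (use T eU in simp_all)
      then have "run doubling_prog (?D + 18) (solved I \<epsilon>) ?s"
      proof (rule run_conseq)
        have "real ?N * M * (?BK + real ?T + 1) \<le> real ?N * M * (?BK + (2 * M + 1) + 1)"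
        proof (rule mult_left_mono)
          show "?BK + real ?T + 1 \<le> ?BK + (2 * M + 1) + 1" using T by (simp add: M_def)
          show "0 \<le> real ?N * M" using M1 by simp
        qed
        then show "5000 * (real ?N * (real ?N / \<epsilon>) * (?BK + real ?T + 1)) \<le> ?D + 18" by (simp add: M_def)
      qed
      then have "run doubling_prog (?D + 30 - 12) (solved I \<epsilon>) ?s" by (rule run_conseq) auto
      then show "run ?rest (?D + 30) (solved I \<epsilon>) s" by (simp add: eU, elim run_conseq) auto
    qed
    then have "run (CSeq granularity_prog ?rest) (25000 * ?t - 5) (solved I \<epsilon>) s0"
    proof (rule run_conseq)
      have "real ?N * M * (?BK + (2 * M + 1) + 1) \<le> real ?N * M * (?BK + 4 * M)"
        using M1 by (intro mult_left_mono) auto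
      also have "\<dots> = real ?N * M * ?BK + 4 * (real ?N * M * M)" by (simp add: algebra_simps)
      finally have D: "real ?N * M * (?BK + (2 * M + 1) + 1) \<le> real ?N * M * ?BK + 4 * (real ?N * M * M)" .
      have gen: "20 * (2 * m) + 50 + (5000 * d + 30) \<le> 25000 * (x + y) - 5"
        if "d \<le> x + 4 * y" "m \<le> y" "1 \<le> m" "0 \<le> x" for d x y m :: real using that by simp
      have "20 * (2 * M) + 50 + (?D + 30) \<le> 25000 * ?t - 5" unfolding t by (rule gen[OF D M2 M1 BK0])
      then show "20 * (2 * real ?N / \<epsilon>) + 50 + (?D + 30) \<le> 25000 * ?t - 5" by (simp add: M_def)
    qed
    then show ?thesis unfolding scaled_prog_def using True by simp
  qed
qed

definition scaled_cost :: "noma \<Rightarrow> real \<Rightarrow> real" where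
  "scaled_cost I \<epsilon> = real (num_bits (J_levels I)) * real (carriers I) ^ 2 * real (users I) / \<epsilon> + real (carriers I) ^ 3 / \<epsilon> ^ 2"

definition exact_cost :: "noma \<Rightarrow> real" where
  "exact_cost I = real (J_levels I) * real (carriers I) * real (users I) + real (J_levels I) ^ 2 * real (carriers I)"

text \<open>The estimate for the scaled algorithm uses the number \<open>B\<close> of bits of \<open>J\<close> in place of \<open>log J\<close>,
  which vanishes for \<open>J = 1\<close> although the binary searches still take one step. Neither
  estimate contains \<open>M\<close>: a table lookup costs \<open>O(K)\<close>.\<close>

definition cheaper_scaled :: bexp where
  "cheaper_scaled = RLess
        (RAdd (RDiv (RMul (RMul (OfNat (nv ''B'')) (RMul (OfNat (nv ''N'')) (OfNat (nv ''N'')))) (OfNat (nv ''K''))) (rv ''eps''))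
          (RDiv (RMul (RMul (OfNat (nv ''N'')) (OfNat (nv ''N''))) (OfNat (nv ''N''))) (RMul (rv ''eps'') (rv ''eps''))))
        (RAdd (RMul (RMul (OfNat (nv ''J'')) (OfNat (nv ''N''))) (OfNat (nv ''K'')))
          (RMul (RMul (OfNat (nv ''J'')) (OfNat (nv ''J''))) (OfNat (nv ''N''))))"

text \<open>The guard removes the degenerate inputs. For \<open>\<epsilon> \<ge> 1\<close> the
  target is not positive, and for \<open>J = 0\<close> only the zero vector is feasible; in both
  cases the untouched output cells hold an admissible answer.\<close>

definition jspa_prog :: com where
  "jspa_prog = CIf (BAnd (RLess (rv ''eps'') (OfNat (NConst 1))) (BNot (RLess (rv ''Pmax'') (rv ''delta''))))
    (CSeq pow_prog (CSeq levels_prog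
    (CSeq (CIf (NLess (nv ''M'') (nv ''K'')) (NAssign ''Mp'' [] (nv ''M'')) (NAssign ''Mp'' [] (nv ''K'')))
    (CSeq prep_prog (CSeq caps_prog
    (CIf cheaper_scaled scaled_prog exact_prog)))))) CSkip"

lemma inp_init: "inp I \<epsilon> (init_state I \<epsilon>)"
  by (simp add: inp_def init_state_def)

lemma run_jspa_prog:
  assumes v: "valid_noma I" and \<epsilon>: "0 < \<epsilon>"
  shows "run jspa_prog (30000 * (real (carriers I) * real (Mp I) * real (users I) ^ 2 + min (scaled_cost I \<epsilon>) (exact_cost I)))
    (solved I \<epsilon>) (init_state I \<epsilon>)"
proof -
  interpret knapsack "carriers I" "J_levels I" "cap_levels I" "Fl I" by (rule knapsack_levels[OF v])
  let ?s0 = "init_state I \<epsilon>"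
  let ?N = "carriers I" and ?K = "users I" and ?J = "J_levels I" and ?B = "num_bits (J_levels I)"
  let ?A = "real ?N * real (Mp I) * real ?K ^ 2"
  let ?m = "min (scaled_cost I \<epsilon>) (exact_cost I)"
  have K: "1 \<le> real ?K" "1 \<le> real ?N" "1 \<le> real (Mp I)" using v by (auto simp: valid_noma_def)
  have "1 * 1 * 1 \<le> real ?N * real (Mp I) * real ?K ^ 2" using K by (intro mult_mono) auto
  then have A: "1 \<le> ?A" by simp
  have c0: "0 \<le> scaled_cost I \<epsilon>" "0 \<le> exact_cost I" using \<epsilon> by (simp_all add: scaled_cost_def exact_cost_def)
  have m0: "0 \<le> ?m" using c0 by simp
  have inp: "inp I \<epsilon> ?s0" by (rule inp_init)
  have P0: "reals ?s0 ''P'' [n] = 0" for n by (simp add: init_state_def)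
  have dJ: "\<not> total_power I < power_unit I \<longleftrightarrow> 1 \<le> ?J" using le_J_levels_iff[OF v, of 1] by (simp add: not_less)
  show ?thesis
  proof (cases "\<epsilon> < 1 \<and> 1 \<le> ?J")
    case False
    have "(1 - \<epsilon>) * val l \<le> 0" if l: "feas l" for l
    proof (cases "\<epsilon> < 1")
      case True
      then have J0: "?J = 0" using False by auto
      have "l n = 0" if "n \<in> {1..?N}" for n
      proof -
        have "l n \<le> cap_levels I n" using l that by (simp add: feas_def)
        then show ?thesis using cap[OF that] J0 by linarith
      qed
      then have "val l = 0" using zero by (simp add: val_def)
      then show ?thesis by simp
    next
      case False
      then show ?thesis using val_nonneg[OF l] by (simp add: mult_nonpos_nonneg)
    qed
    then have "levels_approx I \<epsilon> (\<lambda>_. 0)" by (rule levels_approx_zero[OF v])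
    then have "solved I \<epsilon> ?s0" using P0 unfolding solved_def by (intro exI[of _ "\<lambda>_. 0"]) simp
    moreover have "20 \<le> 30000 * (a + m)" if "1 \<le> a" "0 \<le> m" for a m :: real using that by simp
    then have "20 \<le> 30000 * (?A + ?m)" using A m0 by blast
    moreover have "\<not> (\<epsilon> < 1 \<and> \<not> total_power I < power_unit I)" using False dJ by simp
    moreover have "reals ?s0 ''eps'' [] = \<epsilon>" "reals ?s0 ''Pmax'' [] = total_power I" "reals ?s0 ''delta'' [] = power_unit I"
      using inp by (simp_all add: inp_def)
    ultimately show ?thesis unfolding jspa_prog_def by (simp, blast)
  next
    case True
    then have J: "1 \<le> ?J" and e1: "\<epsilon> < 1" by auto
    have B1: "1 \<le> real ?B" using num_bits_pos[OF J] by simp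
    \<comment> \<open>Because \<open>J < 2 ^ J\<close>, the bit length is at most \<open>J\<close>;
      the caps, found by binary search, thus stay within the cost estimate of the exact algorithm
      too.\<close>
    have BJ: "real ?B \<le> real ?J" using num_bits_le[of ?J ?J] less_exp[of ?J] by simp
    have NBK: "1 \<le> real ?N * real ?B * real ?K" using mult_mono[of 1 "real ?N * real ?B" 1 "real ?K"] mult_mono[of 1 "real ?N" 1 "real ?B"] K B1 by simp
    have BN: "real ?B \<le> real ?N * real ?B * real ?K"
      using mult_mono[of "1 * real ?B" "real ?N * real ?B" 1 "real ?K"] mult_right_mono[of 1 "real ?N" "real ?B"] K by simp
    \<comment> \<open>Computing the caps costs \<open>N B K\<close>, which neither branch of the
      minimum mentions. It is at most either estimate, hence at most their minimum.\<close>
    have x1: "real ?N * real ?B * real ?K \<le> exact_cost I"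
    proof -
      have "real ?N * real ?B * real ?K \<le> real ?N * real ?J * real ?K"
        using BJ by (intro mult_left_mono mult_right_mono) auto
      also have "\<dots> = real ?J * real ?N * real ?K" by simp
      also have "\<dots> \<le> exact_cost I" by (simp add: exact_cost_def)
      finally show ?thesis .
    qed
    have x2: "real ?N * real ?B * real ?K \<le> scaled_cost I \<epsilon>"
    proof -
      have "real ?N * real ?B * real ?K \<le> real ?B * real ?N ^ 2 * real ?K"
        using K mult_right_mono[OF K(2), of "real ?N * real ?B * real ?K"] by (simp add: power2_eq_square mult_ac)
      also have "\<dots> \<le> real ?B * real ?N ^ 2 * real ?K / \<epsilon>" using \<epsilon> e1 by (simp add: pos_le_divide_eq mult_left_le)
      also have "\<dots> \<le> scaled_cost I \<epsilon>" using \<epsilon> by (simp add: scaled_cost_def)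
      finally show ?thesis .
    qed
    let ?choose = "CIf cheaper_scaled scaled_prog exact_prog"
    let ?Mp = "CIf (NLess (nv ''M'') (nv ''K'')) (NAssign ''Mp'' [] (nv ''M'')) (NAssign ''Mp'' [] (nv ''K''))"
    let ?Cc = "500 * (real ?N * real ?B * real ?K)" and ?Cp = "1000 * ?A" and ?C5 = "25000 * ?m + 60"
    have "run (CSeq pow_prog (CSeq levels_prog (CSeq ?Mp (CSeq prep_prog (CSeq caps_prog ?choose)))))
      (30 * real ?B + 20 + (50 * real ?B + 20 + (10 + (?Cp + (?Cc + ?C5))))) (solved I \<epsilon>) ?s0"
    proof (rule run_Seq[OF run_pow_prog[OF v inp] _ order_refl])
      fix s1 assume u1: "unch (nmods pow_prog) (rmods pow_prog) ?s0 s1" and b1: "bits_ok ?B s1"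
      have i1: "inp I \<epsilon> s1" by (rule inp_unch[OF inp u1]) (auto simp: inp_nats_def)
      show "run (CSeq levels_prog (CSeq ?Mp (CSeq prep_prog (CSeq caps_prog ?choose))))
        (50 * real ?B + 20 + (10 + (?Cp + (?Cc + ?C5)))) (solved I \<epsilon>) s1"
      proof (rule run_Seq[OF run_levels_prog[OF v i1 b1] _ order_refl])
        fix s2 assume u2: "unch (nmods levels_prog) (rmods levels_prog) s1 s2" and J2: "nats s2 ''J'' [] = ?J"
        have i2: "inp I \<epsilon> s2" by (rule inp_unch[OF i1 u2]) (auto simp: inp_nats_def)
        have b2: "bits_ok ?B s2" by (rule bits_ok_unch[OF b1 u2]) simp_all
        have "run ?Mp 10 (\<lambda>s. nats s ''Mp'' [] = Mp I) s2" using i2 by (simp add: inp_def min_def)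
        then show "run (CSeq ?Mp (CSeq prep_prog (CSeq caps_prog ?choose))) (10 + (?Cp + (?Cc + ?C5))) (solved I \<epsilon>) s2"
        proof (rule run_Seq[OF _ _ order_refl])
          fix s3 assume u3: "unch (nmods ?Mp) (rmods ?Mp) s2 s3" and M3: "nats s3 ''Mp'' [] = Mp I"
          have i3: "inp I \<epsilon> s3" by (rule inp_unch[OF i2 u3]) (auto simp: inp_nats_def)
          have b3: "bits_ok ?B s3" by (rule bits_ok_unch[OF b2 u3]) simp_all
          show "run (CSeq prep_prog (CSeq caps_prog ?choose)) (?Cp + (?Cc + ?C5)) (solved I \<epsilon>) s3"
          proof (rule run_Seq[OF run_prep_prog[OF i3 v M3] _ order_refl])
            fix s4 assume u4: "unch (nmods prep_prog) (rmods prep_prog) s3 s4" and t4: "\<forall>n\<in>{1..?N}. tab_ok I n s4"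
            have i4: "inp I \<epsilon> s4" by (rule inp_unch[OF i3 u4]) (auto simp: inp_nats_def inp_reals_def)
            have b4: "bits_ok ?B s4" by (rule bits_ok_unch[OF b3 u4]) simp_all
            have r4: "ready I \<epsilon> s4" using i4 b4 t4 u3 u4 J2 M3 by (simp add: ready_def unch_def)
            show "run (CSeq caps_prog ?choose) (?Cc + ?C5) (solved I \<epsilon>) s4"
            proof (rule run_Seq[OF run_caps_prog[OF r4 v J] _ order_refl])
              fix s5 assume u5: "unch (nmods caps_prog) (rmods caps_prog) s4 s5" and c5: "caps_ok I s5"
              have r5: "ready I \<epsilon> s5" by (rule ready_unch[OF r4 u5]) (auto simp: ready_nats_def ready_reals_def)
              have P5: "reals s5 ''P'' [n] = 0" for n
                using u1 u2 u3 u4 u5 P0[of n] by (simp add: unch_def)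
              have "run scaled_prog (25000 * scaled_cost I \<epsilon>) (solved I \<epsilon>) s5"
                unfolding scaled_cost_def by (rule run_scaled_prog[OF r5 c5 v J \<epsilon> e1 P5])
              moreover have "run exact_prog (3000 * exact_cost I) (solved I \<epsilon>) s5"
                unfolding exact_cost_def by (rule run_exact_prog[OF r5 c5 v J \<epsilon>])
              then have "run exact_prog (25000 * exact_cost I) (solved I \<epsilon>) s5"
                by (rule run_conseq) (use c0 in auto)
              moreover have e5: "nats s5 ''B'' [] = ?B" "nats s5 ''N'' [] = ?N" "nats s5 ''K'' [] = ?K" "nats s5 ''J'' [] = ?J" "reals s5 ''eps'' [] = \<epsilon>"
                using r5 by (auto simp: ready_def inp_def bits_ok_def)
              have "bval s5 cheaper_scaled \<longleftrightarrow> scaled_cost I \<epsilon> < exact_cost I"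
                by (simp add: cheaper_scaled_def e5 scaled_cost_def exact_cost_def power2_eq_square power3_eq_cube)
              moreover have "bcost cheaper_scaled \<le> 58" by (simp add: cheaper_scaled_def)
              ultimately show "run ?choose ?C5 (solved I \<epsilon>) s5"
                by (auto elim!: run_conseq)
            qed
          qed
        qed
      qed
    qed
    then have "run (CSeq pow_prog (CSeq levels_prog (CSeq ?Mp (CSeq prep_prog (CSeq caps_prog ?choose)))))
      (30000 * (?A + ?m) - 11) (solved I \<epsilon>) ?s0"
    proof (rule run_conseq)
      have "real ?N * real ?B * real ?K \<le> ?m" using x1 x2 by simp
      moreover have "30 * b + 20 + (50 * b + 20 + (10 + (1000 * a + (500 * x + (25000 * m + 60))))) \<le> 30000 * (a + m) - 11"
        if "b \<le> x" "x \<le> m" "1 \<le> a" "0 \<le> m" for a b x m :: real using that by simp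
      ultimately show "30 * real ?B + 20 + (50 * real ?B + 20 + (10 + (?Cp + (?Cc + ?C5)))) \<le> 30000 * (?A + ?m) - 11"
        using BN A m0 by blast
    qed
    then show ?thesis unfolding jspa_prog_def using True dJ inp by (simp add: inp_def, elim run_conseq) auto
  qed
qed

lemma runs_of_run:
  assumes v: "valid_noma I" and r: "run c B (solved I \<epsilon>) (init_state I \<epsilon>)"
  shows "\<exists>t P. runs c I \<epsilon> t P \<and> approx_solution I \<epsilon> P \<and> real t \<le> B"
proof -
  obtain t s where e: "exec c (init_state I \<epsilon>) t s" "real t \<le> B" "solved I \<epsilon> s" using r by (rule runE)
  obtain l where l: "levels_approx I \<epsilon> l"
    "\<forall>n\<in>{1..carriers I}. reals s ''P'' [n] = real (l n) * power_unit I"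
    using e(3) unfolding solved_def by blast
  have "approx_solution I \<epsilon> (\<lambda>n\<in>{1..carriers I}. reals s ''P'' [n])"
    by (rule approx_solution_of_levels[OF v l(1)]) (use l(2) in blast)
  moreover have "runs c I \<epsilon> t (\<lambda>n\<in>{1..carriers I}. reals s ''P'' [n])"
    unfolding runs_def using e(1) by blast
  ultimately show ?thesis using e(2) by blast
qed

text \<open>Passes from bit length to logarithm. For \<open>J \<ge> 2\<close> the bit length is at
  most \<open>2 log J\<close>, costing a factor 2. For \<open>J \<le> 1\<close> the logarithm
  vanishes, and the first summand \<open>N M K ^ 2\<close> pays for the exact algorithm, which
  raises the factor to 3.\<close>

lemma jspa_cost_min_bound:
  fixes I :: noma and \<epsilon> :: real
  defines "N \<equiv> real (carriers I)" and "M \<equiv> real (mux I)" and "K \<equiv> real (users I)" and "j \<equiv> real (J_levels I)"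
  assumes v: "valid_noma I" and \<epsilon>: "0 < \<epsilon>"
  shows "N * real (Mp I) * K ^ 2 + min (scaled_cost I \<epsilon>) (exact_cost I) \<le>
    3 * (N * M * K ^ 2 + min (log 2 j * (N ^ 2 * M * K / \<epsilon>) + N ^ 3 / \<epsilon> ^ 2) (j * N * M * K + j ^ 2 * N))"
proof -
  have K: "1 \<le> K" "1 \<le> N" "1 \<le> M" using v by (auto simp: valid_noma_def K_def N_def M_def)
  have j: "0 \<le> j" by (simp add: j_def)
  have KK: "K \<le> K ^ 2" using mult_left_mono[OF K(1), of K] K by (simp add: power2_eq_square)
  have a: "N * real (Mp I) * K ^ 2 \<le> N * M * K ^ 2"
    using K by (intro mult_right_mono mult_left_mono) (auto simp: M_def)
  have "j * N * 1 * K \<le> j * N * M * K" using K j by (intro mult_right_mono mult_left_mono) auto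
  then have x: "exact_cost I \<le> j * N * M * K + j ^ 2 * N"
    by (simp add: exact_cost_def j_def N_def K_def)
  show ?thesis
  proof (cases "2 \<le> J_levels I")
    case True
    then have lj: "1 \<le> log 2 j" by (simp add: j_def le_log_iff)
    have nb: "real (num_bits (J_levels I)) \<le> 2 * log 2 j"
    proof -
      have "real (num_bits (J_levels I)) \<le> 1 + log 2 j"
        using num_bits_bound[of "J_levels I"] True by (simp add: j_def)
      then show ?thesis using lj by linarith
    qed
    have "real (num_bits (J_levels I)) * (N ^ 2 * 1 * K / \<epsilon>) \<le> 2 * log 2 j * (N ^ 2 * M * K / \<epsilon>)"
      using nb K \<epsilon> lj by (intro mult_mono divide_right_mono mult_right_mono mult_left_mono) auto
    then have "scaled_cost I \<epsilon> \<le> 2 * (log 2 j * (N ^ 2 * M * K / \<epsilon>)) + N ^ 3 / \<epsilon> ^ 2"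
      by (simp add: scaled_cost_def N_def K_def)
    moreover have "0 \<le> N ^ 3 / \<epsilon> ^ 2" using K by simp
    moreover have "0 \<le> N * M * K ^ 2" "0 \<le> log 2 j * (N ^ 2 * M * K / \<epsilon>)" "0 \<le> j * N * M * K + j ^ 2 * N"
      using K \<epsilon> lj j by simp_all
    moreover have "p + min s e \<le> 3 * (q + min (l + c) w)"
      if "p \<le> q" "0 \<le> q" "s \<le> 2 * l + c" "0 \<le> c" "0 \<le> l" "e \<le> w" "0 \<le> w" for p q s e l c w :: real
      using that by (auto simp: min_def)
    ultimately show ?thesis using a x by blast
  next
    case False
    \<comment> \<open>\<open>J = 0\<close> enters through the convention that the logarithm of 0 is
      0, so both small cases give a vanishing logarithmic term.\<close>
    then have j1: "j = 0 \<or> j = 1" by (auto simp: j_def numeral_2_eq_2 not_le less_Suc_eq)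
    then have "log 2 j = 0" by (auto simp: log_def)
    then have 0: "0 \<le> min (log 2 j * (N ^ 2 * M * K / \<epsilon>) + N ^ 3 / \<epsilon> ^ 2) (j * N * M * K + j ^ 2 * N)"
      using K j by simp
    have "N * 1 * K \<le> N * M * K ^ 2" "N * 1 * 1 \<le> N * M * K ^ 2" using K KK by (intro mult_mono; simp)+
    moreover have "exact_cost I \<le> N * K + N" using j1 K by (auto simp: exact_cost_def j_def N_def K_def)
    moreover have "p + min s e \<le> 3 * (q + m)"
      if "p \<le> q" "e \<le> x + y" "x \<le> q" "y \<le> q" "0 \<le> m" for p q s e x y m :: real
      using that by (auto simp: min_def)
    ultimately show ?thesis using a 0 unfolding mult_1_right by blast
  qed
qed

text \<open>The exact algorithm is only pseudo-polynomial in \<open>J\<close>, so the minimum is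
  bounded through the scaled one. The count \<open>Mp \<le> K\<close> replaces \<open>M\<close>,
  which may be exponential in its binary length. Each monomial has degree at most four in quantities
  bounded by the input size.\<close>

lemma jspa_cost_poly_bound:
  assumes v: "valid_noma I" and \<epsilon>: "0 < \<epsilon>"
  shows "real (carriers I) * real (Mp I) * real (users I) ^ 2 + min (scaled_cost I \<epsilon>) (exact_cost I) \<le>
    input_size I ^ 4 * (1 + 1 / \<epsilon> + (1 / \<epsilon>) ^ 2)"
proof -
  let ?S = "input_size I" and ?N = "real (carriers I)" and ?K = "real (users I)" and ?L = "log 2 (1 + real (J_levels I))"
  let ?B = "real (num_bits (J_levels I))"
  have K: "1 \<le> ?K" "1 \<le> ?N" "1 \<le> real (mux I)" using v by (auto simp: valid_noma_def)
  have L: "0 \<le> ?L" "0 \<le> log 2 (real (mux I))" using K by (simp_all add: zero_le_log_cancel_iff)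
  have NL: "1 + ?L \<le> (?N + 2) * (1 + ?L)" using K L mult_right_mono[of 1 "?N + 2" "1 + ?L"] by simp
  have NK: "0 \<le> ?N * ?K" by simp
  have S: "?N \<le> ?S" "?K \<le> ?S" "1 + ?L \<le> ?S" "1 \<le> ?S"
    unfolding input_size_def using K L NL NK by linarith+
  have B: "?B \<le> 1 + ?L"
  proof (cases "J_levels I = 0")
    case True
    then show ?thesis using num_bits_le[of 0 0] by simp
  next
    case False
    then have "log 2 (real (J_levels I)) \<le> ?L" by simp
    moreover have "?B \<le> 1 + log 2 (real (J_levels I))" using False by (intro num_bits_bound) simp
    ultimately show ?thesis by linarith
  qed
  have "real (Mp I) \<le> ?K" by simp
  then have "?N * real (Mp I) * ?K ^ 2 \<le> ?S * ?S * ?S ^ 2"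
    using S K by (intro mult_mono power_mono) auto
  then have 1: "?N * real (Mp I) * ?K ^ 2 \<le> ?S ^ 4" by (simp add: power4_eq_xxxx power2_eq_square mult.assoc)
  have "?B * ?N ^ 2 * ?K \<le> ?S * ?S ^ 2 * ?S"
    using S K B by (intro mult_mono power_mono) auto
  then have "?B * ?N ^ 2 * ?K \<le> ?S ^ 4" by (simp add: power4_eq_xxxx power2_eq_square mult.assoc)
  then have 2: "?B * ?N ^ 2 * ?K / \<epsilon> \<le> ?S ^ 4 / \<epsilon>" using \<epsilon> by (intro divide_right_mono) auto
  have "?N ^ 3 * 1 \<le> ?S ^ 3 * ?S" using S K by (intro mult_mono power_mono) auto
  then have "?N ^ 3 \<le> ?S ^ 4" by (simp add: power4_eq_xxxx power3_eq_cube)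
  then have 3: "?N ^ 3 / \<epsilon> ^ 2 \<le> ?S ^ 4 / \<epsilon> ^ 2" by (intro divide_right_mono) auto
  have "min (scaled_cost I \<epsilon>) (exact_cost I) \<le> ?S ^ 4 / \<epsilon> + ?S ^ 4 / \<epsilon> ^ 2"
    using 2 3 by (simp add: scaled_cost_def min_le_iff_disj)
  moreover have "?S ^ 4 * (1 + 1 / \<epsilon> + (1 / \<epsilon>) ^ 2) = ?S ^ 4 + (?S ^ 4 / \<epsilon> + ?S ^ 4 / \<epsilon> ^ 2)"
    by (simp add: distrib_left power_divide)
  ultimately show ?thesis using 1 by linarith
qed

lemma fptas_jspa_prog: "fptas jspa_prog"
  unfolding fptas_def
proof (intro exI[of _ "[:monom 30000 4, monom 30000 4, monom 30000 4:]"] allI impI, elim conjE)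
  fix I :: noma and \<epsilon> :: real
  assume v: "valid_noma I" and \<epsilon>: "0 < \<epsilon>"
  \<comment> \<open>The outer variable stands for \<open>1 / \<epsilon>\<close> and the coefficients
    are polynomials in the input size; the witness is
    \<open>30000 S ^ 4 (1 + 1 / \<epsilon> + 1 / \<epsilon> ^ 2)\<close>.\<close>
  let ?p = "[:monom 30000 4, monom 30000 4, monom 30000 4:] :: real poly poly"
  let ?B = "30000 * (real (carriers I) * real (Mp I) * real (users I) ^ 2 + min (scaled_cost I \<epsilon>) (exact_cost I))"
  obtain t P where tP: "runs jspa_prog I \<epsilon> t P" "approx_solution I \<epsilon> P" "real t \<le> ?B"
    using runs_of_run[OF v run_jspa_prog[OF v \<epsilon>]] by blast
  have "?B \<le> 30000 * (input_size I ^ 4 * (1 + 1 / \<epsilon> + (1 / \<epsilon>) ^ 2))"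
    by (intro mult_left_mono jspa_cost_poly_bound[OF v \<epsilon>]) simp
  also have "\<dots> = poly (poly ?p [:1 / \<epsilon>:]) (input_size I)"
    by (simp add: poly_monom algebra_simps power2_eq_square)
  finally show "\<exists>t P. runs jspa_prog I \<epsilon> t P \<and> approx_solution I \<epsilon> P \<and>
      real t \<le> poly (poly ?p [:1 / \<epsilon>:]) (input_size I)"
    using tP by (meson order_trans)
qed

theorem theorem11:
  "\<exists>c. fptas c \<and>
     (\<exists>C>0. \<forall>(I :: noma) (\<epsilon> :: real). valid_noma I \<and> \<epsilon> > 0 \<longrightarrow>
        (\<exists>t P. runs c I \<epsilon> t P \<and> approx_solution I \<epsilon> P \<and>
           (let N = real (carriers I); M = real (mux I); K = real (users I); j = real (J_levels I) in
              real t \<le> C * (N * M * K^2 +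
                 min (log 2 j * (N^2 * M * K / \<epsilon>) + N^3 / \<epsilon>^2)
                     (j * N * M * K + j^2 * N)))))"
proof (intro exI[of _ jspa_prog] conjI fptas_jspa_prog exI[of _ "90000 :: real"] allI impI, simp, elim conjE)
  fix I :: noma and \<epsilon> :: real
  assume v: "valid_noma I" and \<epsilon>: "0 < \<epsilon>"
  let ?N = "real (carriers I)" and ?M = "real (mux I)" and ?K = "real (users I)" and ?j = "real (J_levels I)"
  let ?B = "30000 * (?N * real (Mp I) * ?K ^ 2 + min (scaled_cost I \<epsilon>) (exact_cost I))"
  obtain t P where tP: "runs jspa_prog I \<epsilon> t P" "approx_solution I \<epsilon> P" "real t \<le> ?B"
    using runs_of_run[OF v run_jspa_prog[OF v \<epsilon>]] by blast
  \<comment> \<open>The final constant is 30000 from the program times 3 from the comparison of cost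
    expressions.\<close>
  have "?B \<le> 30000 * (3 * (?N * ?M * ?K ^ 2 + min (log 2 ?j * (?N ^ 2 * ?M * ?K / \<epsilon>) + ?N ^ 3 / \<epsilon> ^ 2)
      (?j * ?N * ?M * ?K + ?j ^ 2 * ?N)))"
    by (intro mult_left_mono jspa_cost_min_bound[OF v \<epsilon>]) simp
  then have "real t \<le> 90000 * (?N * ?M * ?K ^ 2 + min (log 2 ?j * (?N ^ 2 * ?M * ?K / \<epsilon>) + ?N ^ 3 / \<epsilon> ^ 2)
      (?j * ?N * ?M * ?K + ?j ^ 2 * ?N))"
    using tP(3) by simp
  then show "\<exists>t P. runs jspa_prog I \<epsilon> t P \<and> approx_solution I \<epsilon> P \<and>
      (let N = ?N; M = ?M; K = ?K; j = ?j in
        real t \<le> 90000 * (N * M * K^2 + min (log 2 j * (N^2 * M * K / \<epsilon>) + N^3 / \<epsilon>^2) (j * N * M * K + j^2 * N)))"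
    using tP unfolding Let_def by blast
qed

end
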